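(* There exist infinitely many non-abelian finite simple groups $G_j$ $(j\geqslant 1)$ satisfying $l(G_j)\to\infty$ as $j\to\infty$ and \[ \lambda(G_j)>\log_3 l(G_j)+1 \quad\text{for all } j\geqslant 1. \]
   Context: For a finite group $G$, an unrefinable chain of length $t$ is a chain of subgroups $G=G_0>G_1>\cdots>G_{t-1}>G_t=1$ in which each $G_i$ is a maximal subgroup of $G_{i-1}$. The depth $\lambda(G)$ is the minimal length of an unrefinable chain of $G$. The length $l(G)$ is the maximal length of a strictly descending chain of subgroups from $G$ to $1$. *)

theory Defs
  imports Complex_Main "HOL-Algebra.SimpleGroups"
begin

definition maximal_subgroup :: "'a set \<Rightarrow> ('a, 'b) monoid_scheme \<Rightarrow> bool" where
  "maximal_subgroup M G \<longleftrightarrow>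
     subgroup M G \<and> M \<noteq> carrier G \<and>
     (\<forall>L. subgroup L G \<longrightarrow> M \<subseteq> L \<longrightarrow> L = M \<or> L = carrier G)"

text \<open>
  A chain of length \<open>t\<close> consists of the \<open>t + 1\<close> subgroups \<open>H 0, \<dots>, H t\<close>; the values of \<open>H\<close>
  beyond \<open>t\<close> are irrelevant.
\<close>

definition unrefinable_chain ::
    "('a, 'b) monoid_scheme \<Rightarrow> nat \<Rightarrow> (nat \<Rightarrow> 'a set) \<Rightarrow> bool" where
  "unrefinable_chain G t H \<longleftrightarrow>
     H 0 = carrier G \<and> H t = {\<one>\<^bsub>G\<^esub>} \<and>
     (\<forall>i\<le>t. subgroup (H i) G) \<and>
     (\<forall>i<t. maximal_subgroup (H (Suc i)) (G\<lparr>carrier := H i\<rparr>))"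

definition descending_chain ::
    "('a, 'b) monoid_scheme \<Rightarrow> nat \<Rightarrow> (nat \<Rightarrow> 'a set) \<Rightarrow> bool" where
  "descending_chain G t H \<longleftrightarrow>
     H 0 = carrier G \<and> H t = {\<one>\<^bsub>G\<^esub>} \<and>
     (\<forall>i\<le>t. subgroup (H i) G) \<and>
     (\<forall>i<t. H (Suc i) \<subset> H i)"

text \<open>
  The following two notions are meaningful for finite groups only: there, chains of both kinds
  exist and their length is bounded by the order of the group, so minimum and maximum are attained.
\<close>

definition group_depth :: "('a, 'b) monoid_scheme \<Rightarrow> nat" where
  "group_depth G = (LEAST t. \<exists>H. unrefinable_chain G t H)"

definition group_length :: "('a, 'b) monoid_scheme \<Rightarrow> nat" where
  "group_length G = (GREATEST t. \<exists>H. descending_chain G t H)"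

end

theory Submission
  imports Defs "HOL-Algebra.Sylow" "HOL-Algebra.Algebraic_Closure_Type"
    "HOL-Algebra.Weak_Morphisms" "HOL-Library.Z2"
begin

text \<open>
  The groups are \<open>G\<^sub>j = SL\<^sub>2(q)\<close> with \<open>q = 2^(3^j)\<close>. Each step of a descending chain at least
  halves the order, and \<open>\<bar>G\<^sub>j\<bar> = q (q^2 - 1) < q^3 = 2^(3^(j+1))\<close>; hence \<open>l(G\<^sub>j) < 3^(j+1)\<close>, and the
  claim reduces to \<open>\<lambda>(G\<^sub>j) \<ge> j + 2\<close>.

  The depth is bounded below by induction on \<open>j\<close> along the maximal subgroups of \<open>SL\<^sub>2(q)\<close>. These are
  the Borel subgroups \<open>q : (q - 1)\<close>, the dihedral groups of order \<open>2 (q \<plusminus> 1)\<close>, and copies of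
  \<open>SL\<^sub>2(q\<^sub>0)\<close> with \<open>q\<^sub>0^3 = q\<close>. A Borel or dihedral group loses at most one prime factor of its odd
  part with every step of an unrefinable chain, and the factorisations
  \<open>q\<^sub>0^3 - 1 = (q\<^sub>0 - 1) (q\<^sub>0^2 + q\<^sub>0 + 1)\<close> and \<open>q\<^sub>0^3 + 1 = (q\<^sub>0 + 1) (q\<^sub>0^2 - q\<^sub>0 + 1)\<close> show that
  \<open>q \<plusminus> 1\<close> has at least \<open>j\<close> prime factors. A further step is needed to remove the even part, so the
  depth of these groups is at least \<open>j + 1\<close>. To the copies of
  \<open>SL\<^sub>2(q\<^sub>0)\<close> the induction hypothesis applies. Here it matters that the exponents are powers of 3:
  a maximal subgroup defined over a subfield must be defined over the largest one, which is \<open>q\<^sub>0\<close>.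

  The maximal subgroups are found by a fixed-point count in place of Dickson's list of subgroups.
  Let \<open>K\<close> be an algebraically closed field of characteristic 2 and let \<open>SL\<^sub>2(K)\<close> act on its projective
  line. A nontrivial element fixes one point if it is an involution and two points otherwise. For a
  nontrivial finite subgroup \<open>H\<close>, counting pairs of a nontrivial element and a fixed point gives
  \<open>2 - 2/\<bar>H\<bar> = \<Sum> (1 + (e - 2)/k)\<close>, a sum over the orbits of points with nontrivial stabiliser,
  where \<open>k\<close> is the order of a stabiliser and \<open>e\<close> that of its subgroup of elements fixing no other
  point. Orbits with \<open>e > 1\<close> contribute at least 1 and the others at least \<open>2/3\<close>, so there are at most two
  orbits, and only three kinds of \<open>H\<close> remain (\<open>finite_subgroup_cases\<close>): \<open>H\<close> fixes a point, \<open>H\<close> swaps two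
  points, or \<open>H\<close> has the numerical parameters of \<open>SL\<^sub>2(e)\<close>. Applied to maximal subgroups this gives the
  list above (\<open>maximal_of_linear_type\<close>, \<open>maximal_linear_subgroup\<close>); applied to normal subgroups it gives
  simplicity (\<open>normal_subgroup_of_linear_type\<close>); applied to the stabiliser of the projective line over
  the field of \<open>q\<close> elements it shows that \<open>SL\<^sub>2(q)\<close> itself is of the third kind
  (\<open>ex_linear_type\<close>).
\<close>

hide_const (open) Divisibility.prime Polynomial.order

section \<open>Lower bounds for the length of unrefinable chains\<close>

lemma card_eq_fibre_card_times_image:
  assumes "finite A" and "\<And>y. y \<in> f ` A \<Longrightarrow> card {x \<in> A. f x = y} = k"
  shows "card A = k * card (f ` A)"
proof -
  have "card A = (\<Sum>y\<in>f ` A. \<Sum>x | x \<in> A \<and> f x = y. 1)"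
    unfolding card_eq_sum by (rule sum.image_gen[OF assms(1)])
  also have "\<dots> = (\<Sum>y\<in>f ` A. k)"
    using assms(2) by (intro sum.cong) auto
  finally show ?thesis by simp
qed

text \<open>
  Maximality is expressed between subgroups of one fixed ambient group, so that chains can be cut and
  intersected with other subgroups without changing the group record.
\<close>
definition maximal_in :: "('a, 'b) monoid_scheme \<Rightarrow> 'a set \<Rightarrow> 'a set \<Rightarrow> bool" where
  "maximal_in G M H \<longleftrightarrow> subgroup M G \<and> subgroup H G \<and> M \<subset> H \<and>
     (\<forall>L. subgroup L G \<longrightarrow> M \<subseteq> L \<longrightarrow> L \<subseteq> H \<longrightarrow> L = M \<or> L = H)"

inductive steps_to_one :: "('a, 'b) monoid_scheme \<Rightarrow> nat \<Rightarrow> 'a set \<Rightarrow> bool"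
  for G where
    one: "steps_to_one G 0 {\<one>\<^bsub>G\<^esub>}"
  | step: "maximal_in G M H \<Longrightarrow> steps_to_one G t M \<Longrightarrow> steps_to_one G (Suc t) H"

lemma (in group) maximal_subgroup_imp_maximal_in:
  assumes "subgroup H G" "maximal_subgroup M (G\<lparr>carrier := H\<rparr>)"
  shows "maximal_in G M H"
proof -
  have M: "subgroup M (G\<lparr>carrier := H\<rparr>)" and ne: "M \<noteq> H"
    and mx: "\<And>L. subgroup L (G\<lparr>carrier := H\<rparr>) \<Longrightarrow> M \<subseteq> L \<Longrightarrow> L = M \<or> L = H"
    using assms(2) unfolding maximal_subgroup_def by auto
  have "M \<subseteq> H" using M by (simp add: subgroup_def)
  then show ?thesis
    unfolding maximal_in_def using assms(1) incl_subgroup[OF assms(1) M] ne mx subgroup_incl by blast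
qed

lemma (in group) unrefinable_chain_imp_steps_to_one:
  assumes "unrefinable_chain (G\<lparr>carrier := H\<rparr>) t C" "subgroup H G"
  shows "steps_to_one G t H"
  using assms
proof (induction t arbitrary: C H)
  case 0
  then have "H = {\<one>}" by (auto simp: unrefinable_chain_def)
  then show ?case by (simp add: steps_to_one.one)
next
  case (Suc t)
  define D where "D = (\<lambda>i. C (Suc i))"
  have c: "C 0 = H" "C (Suc t) = {\<one>}" "\<And>i. i \<le> Suc t \<Longrightarrow> subgroup (C i) (G\<lparr>carrier := H\<rparr>)"
     "\<And>i. i < Suc t \<Longrightarrow> maximal_subgroup (C (Suc i)) (G\<lparr>carrier := C i\<rparr>)"
    using Suc.prems(1) unfolding unrefinable_chain_def by auto
  have sG: "subgroup (C i) G" if "i \<le> Suc t" for i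
    using incl_subgroup[OF Suc.prems(2) c(3)[OF that]] .
  have mx: "maximal_in G (C 1) H"
    using maximal_subgroup_imp_maximal_in[OF Suc.prems(2)] c(4)[of 0] c(1) by simp
  have sub: "D i \<subseteq> D 0" if "i \<le> t" for i
    using that
  proof (induction i)
    case (Suc i)
    have "D (Suc i) \<subseteq> D i"
      using maximal_subgroup_imp_maximal_in[OF sG c(4), of "Suc i"] Suc.prems
      unfolding D_def maximal_in_def by auto
    then show ?case using Suc by auto
  qed simp
  have "unrefinable_chain (G\<lparr>carrier := C 1\<rparr>) t D"
    unfolding unrefinable_chain_def
  proof (intro conjI allI impI)
    show "D 0 = carrier (G\<lparr>carrier := C 1\<rparr>)" by (simp add: D_def)
    show "D t = {\<one>\<^bsub>G\<lparr>carrier := C 1\<rparr>\<^esub>}" using c(2) by (simp add: D_def)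
    show "subgroup (D i) (G\<lparr>carrier := C 1\<rparr>)" if "i \<le> t" for i
      using subgroup_incl[OF sG[of "Suc i"] sG[of 1]] sub[OF that] that by (simp add: D_def)
    show "maximal_subgroup (D (Suc i)) (G\<lparr>carrier := C 1, carrier := D i\<rparr>)" if "i < t" for i
      using c(4)[of "Suc i"] that by (simp add: D_def)
  qed
  then have "steps_to_one G t (C 1)" using Suc.IH sG[of 1] by simp
  with mx show ?case by (rule steps_to_one.step)
qed

lemma (in group) card_subgroup_dvd:
  assumes "subgroup H G" "subgroup K G" "K \<subseteq> H"
  shows "card K dvd card H"
  using group.lagrange[OF subgroup_imp_group[OF assms(1)] subgroup_incl[OF assms(2,1,3)]]
  by (simp add: Coset.order_def) (metis dvd_triv_right)

text \<open>
  The quotient has no proper nontrivial subgroup, while Cauchy's theorem provides one of prime order.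
\<close>
lemma (in group) prime_index_of_normal_maximal:
  assumes mx: "maximal_in G M H" and fin: "finite H"
    and nrm: "\<And>x m. x \<in> H \<Longrightarrow> m \<in> M \<Longrightarrow> x \<otimes> m \<otimes> inv x \<in> M"
  obtains p where "prime p" "card H = p * card M"
proof -
  define K where "K = G\<lparr>carrier := H\<rparr>"
  have H: "subgroup H G" and M: "subgroup M G" and MH: "M \<subset> H"
    and between: "\<And>L. subgroup L G \<Longrightarrow> M \<subseteq> L \<Longrightarrow> L \<subseteq> H \<Longrightarrow> L = M \<or> L = H"
    using mx unfolding maximal_in_def by auto
  interpret K: group K unfolding K_def using H by (rule subgroup_imp_group)
  have MK: "subgroup M K" unfolding K_def using subgroup_incl M H MH by blast
  have "M \<lhd> K"
    unfolding K.normal_inv_iff using MK nrm m_inv_consistent[OF H] by (auto simp: K_def)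
  then interpret N: normal M K .
  have finQ: "finite (rcosets\<^bsub>K\<^esub> M)"
    unfolding RCOSETS_def using fin by (auto simp: K_def)
  have lag: "order (K Mod M) * card M = card H"
    using K.lagrange[OF MK] by (simp add: Coset.order_def FactGroup_def K_def)
  have finM: "finite M" using MH fin finite_subset by blast
  have "order (K Mod M) \<noteq> 1"
  proof
    assume "order (K Mod M) = 1"
    then have "card M = card H" using lag by simp
    then show False using MH fin by (simp add: psubset_card_mono less_not_refl3)
  qed
  then obtain p where p: "prime p" "p dvd order (K Mod M)"
    using prime_factor_nat by blast
  then obtain m where m: "order (K Mod M) = p ^ 1 * m" by auto
  have "finite (carrier (K Mod M))" using finQ by (simp add: FactGroup_def)
  then obtain A where A: "subgroup A (K Mod M)" "card A = p ^ 1"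
    using sylow_thm[OF p(1) N.factorgroup_is_group m] by blast
  have Asub: "A \<subseteq> rcosets\<^bsub>K\<^esub> M" using A(1) by (simp add: subgroup_def FactGroup_def)
  have sU: "subgroup (\<Union>A) G"
    using incl_subgroup[OF H] N.factgroup_subgroup_union_subgroup[OF A(1)] by (simp add: K_def)
  have "M \<in> A" using subgroup.one_closed[OF A(1)] by (simp add: FactGroup_def)
  moreover have UH: "\<Union>A \<subseteq> H"
    using N.factgroup_subgroup_union_subgroup[OF A(1)] by (simp add: K_def subgroup_def)
  moreover have "card M * card A = card (\<Union>A)"
  proof (rule card_partition)
    show "finite A" using finite_subset[OF Asub finQ] .
    show "finite (\<Union>A)" using UH fin finite_subset by blast
    show "card c = card M" if "c \<in> A" for c
      using K.card_rcosets_equal[of c M] that Asub finM MH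
      by (auto simp: K_def)
    show "c1 \<inter> c2 = {}" if "c1 \<in> A" "c2 \<in> A" "c1 \<noteq> c2" for c1 c2
      using K.rcos_disjoint[OF MK] that Asub by (meson disjnt_def pairwiseD subsetD)
  qed
  moreover have "card M > 0" using finM subgroup.one_closed[OF M] by (auto simp: card_gt_0_iff)
  then have "card M * card A \<noteq> card M" using A(2) p(1) by (auto simp: prime_nat_iff)
  ultimately have "\<Union>A = H" using between[OF sU] by fastforce
  then have "card H = p * card M" using \<open>card M * card A = card (\<Union>A)\<close> A(2) by (simp add: mult.commute)
  with p(1) show thesis using that by blast
qed

lemma (in group) inv_mult_cancel_left:
  assumes "x \<in> carrier G" "y \<in> carrier G"
  shows "inv x \<otimes> (x \<otimes> y) = y" and "x \<otimes> (inv x \<otimes> y) = y"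
  using assms by (simp_all add: m_assoc[symmetric])

lemma (in group) subgroup_set_mult_normalised:
  assumes M: "subgroup M G" and V: "subgroup V G"
    and nrm: "\<And>x v. x \<in> M \<Longrightarrow> v \<in> V \<Longrightarrow> x \<otimes> v \<otimes> inv x \<in> V"
  shows "subgroup (M <#> V) G"
proof -
  note c = subgroup.mem_carrier[OF M] subgroup.mem_carrier[OF V]
  have nrm': "inv x \<otimes> v \<otimes> x \<in> V" if "x \<in> M" "v \<in> V" for x v
    using nrm[of "inv x" v] that subgroup.m_inv_closed[OF M] c by simp
  show ?thesis
  proof (rule subgroupI)
    show "M <#> V \<subseteq> carrier G" using c by (auto simp: set_mult_def)
    show "M <#> V \<noteq> {}" using subgroup.one_closed[OF M] subgroup.one_closed[OF V]
      by (auto simp: set_mult_def)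
    fix a assume "a \<in> M <#> V"
    then obtain m v where a: "m \<in> M" "v \<in> V" "a = m \<otimes> v" by (auto simp: set_mult_def)
    have "inv a = inv m \<otimes> (m \<otimes> inv v \<otimes> inv m)"
      using a c by (simp add: inv_mult_group m_assoc inv_mult_cancel_left)
    moreover have "inv m \<in> M" "m \<otimes> inv v \<otimes> inv m \<in> V"
      using a nrm subgroup.m_inv_closed[OF M] subgroup.m_inv_closed[OF V] by blast+
    ultimately show "inv a \<in> M <#> V" unfolding set_mult_def by blast
    fix b assume "b \<in> M <#> V"
    then obtain n w where b: "n \<in> M" "w \<in> V" "b = n \<otimes> w" by (auto simp: set_mult_def)
    have "a \<otimes> b = (m \<otimes> n) \<otimes> ((inv n \<otimes> v \<otimes> n) \<otimes> w)"
      using a b c by (simp add: m_assoc inv_mult_cancel_left)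
    moreover have "m \<otimes> n \<in> M" "(inv n \<otimes> v \<otimes> n) \<otimes> w \<in> V"
      using a b nrm' subgroup.m_closed[OF M] subgroup.m_closed[OF V] by blast+
    ultimately show "a \<otimes> b \<in> M <#> V" unfolding set_mult_def by blast
  qed
qed

lemma (in group) card_set_mult_subgroups:
  assumes M: "subgroup M G" and V: "subgroup V G" and "finite M" "finite V"
  shows "card (M <#> V) * card (M \<inter> V) = card M * card V"
proof -
  note c = subgroup.mem_carrier[OF M] subgroup.mem_carrier[OF V]
  let ?f = "\<lambda>(m, v). m \<otimes> v"
  have "card {x \<in> M \<times> V. ?f x = y} = card (M \<inter> V)" if "y \<in> ?f ` (M \<times> V)" for y
  proof -
    from that obtain m v where y: "m \<in> M" "v \<in> V" "y = m \<otimes> v" by auto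
    have "bij_betw (\<lambda>d. (m \<otimes> d, inv d \<otimes> v)) (M \<inter> V) {x \<in> M \<times> V. ?f x = y}"
    proof (rule bij_betwI[where g = "\<lambda>(a, b). inv m \<otimes> a"])
      show "(\<lambda>d. (m \<otimes> d, inv d \<otimes> v)) \<in> M \<inter> V \<rightarrow> {x \<in> M \<times> V. ?f x = y}"
      proof
        fix d assume d: "d \<in> M \<inter> V"
        have "m \<otimes> d \<otimes> (inv d \<otimes> v) = m \<otimes> (d \<otimes> inv d) \<otimes> v"
          using d y c by (simp add: m_assoc inv_mult_cancel_left)
        then have "m \<otimes> d \<otimes> (inv d \<otimes> v) = y" using d y c by simp
        then show "(m \<otimes> d, inv d \<otimes> v) \<in> {x \<in> M \<times> V. ?f x = y}"
          using d y subgroup.m_closed[OF M] subgroup.m_closed[OF V] subgroup.m_inv_closed[OF V]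
          by auto
      qed
      show "(\<lambda>(a, b). inv m \<otimes> a) \<in> {x \<in> M \<times> V. ?f x = y} \<rightarrow> M \<inter> V"
      proof
        fix x assume "x \<in> {x \<in> M \<times> V. ?f x = y}"
        then obtain a b where x: "x = (a, b)" and ab: "a \<in> M" "b \<in> V" "a \<otimes> b = y" by auto
        have "inv m \<otimes> a = v \<otimes> inv b"
        proof -
          have "inv m \<otimes> a = inv m \<otimes> (a \<otimes> b) \<otimes> inv b" using ab(1,2) y(1,2) c by (simp add: m_assoc)
          also have "\<dots> = v \<otimes> inv b" unfolding ab(3) y(3) using ab(2) y(1,2) c
            by (simp add: m_assoc inv_mult_cancel_left)
          finally show ?thesis .
        qed
        then show "(case x of (a, b) \<Rightarrow> inv m \<otimes> a) \<in> M \<inter> V"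
          unfolding x using subgroup.m_closed[OF M subgroup.m_inv_closed[OF M y(1)] ab(1)]
            subgroup.m_closed[OF V y(2) subgroup.m_inv_closed[OF V ab(2)]] by simp
      qed
      show "(case (m \<otimes> d, inv d \<otimes> v) of (a, b) \<Rightarrow> inv m \<otimes> a) = d" if "d \<in> M \<inter> V" for d
        using that y c by (simp add: m_assoc[symmetric])
      show "(m \<otimes> (case x of (a, b) \<Rightarrow> inv m \<otimes> a), inv (case x of (a, b) \<Rightarrow> inv m \<otimes> a) \<otimes> v) = x"
        if "x \<in> {x \<in> M \<times> V. ?f x = y}" for x
      proof -
        obtain a b where x: "x = (a, b)" "a \<in> M" "b \<in> V" "a \<otimes> b = m \<otimes> v" using \<open>x \<in> _\<close> y by auto
        have "inv (inv m \<otimes> a) \<otimes> v = inv a \<otimes> (m \<otimes> v)"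
          using x(2) y(1,2) c by (simp add: inv_mult_group m_assoc)
        also have "\<dots> = b" unfolding x(4)[symmetric] using x(2,3) c by (simp add: inv_mult_cancel_left)
        finally have "inv (inv m \<otimes> a) \<otimes> v = b" .
        moreover have "m \<otimes> (inv m \<otimes> a) = a" using x y c by (simp add: m_assoc[symmetric])
        ultimately show ?thesis using x(1) by simp
      qed
    qed
    then show ?thesis by (simp add: bij_betw_same_card)
  qed
  then have "card (M \<times> V) = card (M \<inter> V) * card (?f ` (M \<times> V))"
    using assms by (intro card_eq_fibre_card_times_image) auto
  moreover have "?f ` (M \<times> V) = M <#> V" by (force simp: set_mult_def)
  ultimately show ?thesis by (simp add: card_cartesian_product mult.commute)
qed

text \<open>
  The two cases \<open>V \<subseteq> M\<close> and \<open>M V = H\<close> drive both lower bounds for chain lengths below.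
\<close>
lemma (in group) maximal_in_supplement:
  assumes mx: "maximal_in G M H" and V: "subgroup V G" "V \<subseteq> H" "\<not> V \<subseteq> M"
    and nrm: "\<And>x v. x \<in> H \<Longrightarrow> v \<in> V \<Longrightarrow> x \<otimes> v \<otimes> inv x \<in> V"
  shows "M <#> V = H"
proof -
  have H: "subgroup H G" and M: "subgroup M G" and MH: "M \<subset> H"
    and between: "\<And>L. subgroup L G \<Longrightarrow> M \<subseteq> L \<Longrightarrow> L \<subseteq> H \<Longrightarrow> L = M \<or> L = H"
    using mx unfolding maximal_in_def by auto
  have s: "subgroup (M <#> V) G"
    using subgroup_set_mult_normalised[OF M V(1)] nrm MH by blast
  have 1: "M \<subseteq> M <#> V"
    using subgroup.one_closed[OF V(1)] subgroup.mem_carrier[OF M] by (force simp: set_mult_def)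
  have 2: "V \<subseteq> M <#> V"
    using subgroup.one_closed[OF M] subgroup.mem_carrier[OF V(1)] by (force simp: set_mult_def)
  have "M <#> V \<subseteq> H"
    using MH V(2) subgroup.m_closed[OF H] unfolding set_mult_def by blast
  then show ?thesis using between[OF s 1] 2 V(3) by blast
qed

abbreviation bigomega :: "nat \<Rightarrow> nat" where
  "bigomega n \<equiv> size (prime_factorization n)"

lemma bigomega_prime_mult: "prime p \<Longrightarrow> n > 0 \<Longrightarrow> bigomega (p * n) = Suc (bigomega n)"
  by (simp add: prime_factorization_mult prime_factorization_prime)

text \<open>
  Let \<open>V\<close> be a subgroup with abelian quotient \<open>H / V\<close>, and let \<open>M\<close> be the next member of the chain. If
  \<open>V \<subseteq> M\<close>, then \<open>M\<close> is normal and the quotient loses exactly one prime factor. Otherwise \<open>M V = H\<close>, so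
  \<open>M / (M \<inter> V)\<close> is as large as \<open>H / V\<close>, and at most the information that \<open>V\<close> is nontrivial is lost.
  This will be used for point stabilisers, with \<open>V\<close> the normal 2-subgroup.
\<close>
theorem (in group) steps_ge_abelian_quotient:
  assumes "steps_to_one G t H" "finite H" "subgroup V G" "V \<subseteq> H"
    and "\<And>x y. x \<in> H \<Longrightarrow> y \<in> H \<Longrightarrow> x \<otimes> y \<otimes> inv x \<otimes> inv y \<in> V"
    and "card H = n * card V"
  shows "bigomega n + (if V = {\<one>} then 0 else 1) \<le> t"
  using assms
proof (induction arbitrary: V n rule: steps_to_one.induct)
  case one
  have "V = {\<one>}" using subgroup.one_closed[OF one.prems(2)] one.prems(3) by blast
  then have "n = 1" using one.prems(5) by simp
  then show ?case using \<open>V = {\<one>}\<close> by simp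
next
  case (step M H t)
  have H: "subgroup H G" and M: "subgroup M G" and MH: "M \<subset> H"
    using step.hyps(1) unfolding maximal_in_def by auto
  note c = subgroup.mem_carrier[OF H]
  have finM: "finite M" and finV: "finite V"
    using step.prems(1,3) MH finite_subset by blast+
  have cM: "card M > 0" and cV: "card V > 0"
    using finM finV subgroup.one_closed[OF M] subgroup.one_closed[OF step.prems(2)]
    by (auto simp: card_gt_0_iff)
  have nrmV: "x \<otimes> v \<otimes> inv x \<in> V" if "x \<in> H" "v \<in> V" for x v
  proof -
    have "(x \<otimes> v \<otimes> inv x \<otimes> inv v) \<otimes> v \<in> V"
      by (rule subgroup.m_closed[OF step.prems(2) step.prems(4)]) (use that step.prems(3) in auto)
    moreover have "x \<in> carrier G" "v \<in> carrier G" using that step.prems(3) c by auto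
    ultimately show ?thesis by (simp add: m_assoc)
  qed
  show ?case
  proof (cases "V \<subseteq> M")
    case True
    have nrmM: "x \<otimes> m \<otimes> inv x \<in> M" if "x \<in> H" "m \<in> M" for x m
    proof -
      have "(x \<otimes> m \<otimes> inv x \<otimes> inv m) \<otimes> m \<in> M"
        by (rule subgroup.m_closed[OF M]) (use step.prems(4)[of x m] True that MH in auto)
      moreover have "x \<in> carrier G" "m \<in> carrier G" using that MH c by auto
      ultimately show ?thesis by (simp add: m_assoc)
    qed
    obtain p where p: "prime p" "card H = p * card M"
      using prime_index_of_normal_maximal[OF step.hyps(1) step.prems(1) nrmM] .
    have "card V dvd card M" by (rule card_subgroup_dvd[OF M step.prems(2) True])
    then obtain k where k: "card M = k * card V" by (metis dvd_def mult.commute)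
    have "n = p * k" using p(2) k step.prems(5) cV by simp
    moreover have "k > 0" using k cM by (cases k) auto
    ultimately have "bigomega n = Suc (bigomega k)" using bigomega_prime_mult p(1) by simp
    moreover have "bigomega k + (if V = {\<one>} then 0 else 1) \<le> t"
    proof (rule step.IH[OF finM step.prems(2) True _ k])
      show "x \<otimes> y \<otimes> inv x \<otimes> inv y \<in> V" if "x \<in> M" "y \<in> M" for x y
        using that MH by (intro step.prems(4)) auto
    qed
    ultimately show ?thesis by simp
  next
    case False
    have "card H * card (M \<inter> V) = card M * card V"
      using card_set_mult_subgroups[OF M step.prems(2) finM finV]
        maximal_in_supplement[OF step.hyps(1) step.prems(2,3) False nrmV] by simp
    then have k: "card M = n * card (M \<inter> V)" using step.prems(5) cV by simp
    have s: "subgroup (M \<inter> V) G" using subgroups_Inter_pair[OF M step.prems(2)] .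
    have "bigomega n + (if M \<inter> V = {\<one>} then 0 else 1) \<le> t"
    proof (rule step.IH[OF finM s _ _ k])
      show "x \<otimes> y \<otimes> inv x \<otimes> inv y \<in> M \<inter> V" if "x \<in> M" "y \<in> M" for x y
      proof
        show "x \<otimes> y \<otimes> inv x \<otimes> inv y \<in> V" using that MH by (intro step.prems(4)) auto
        show "x \<otimes> y \<otimes> inv x \<otimes> inv y \<in> M"
          using that subgroup.m_closed[OF M] subgroup.m_inv_closed[OF M] by simp
      qed
    qed simp
    then show ?thesis by (auto split: if_splits)
  qed
qed

text \<open>
  The dual bound, for a subgroup \<open>T\<close> all of whose subgroups are normalised by \<open>H\<close>: a maximal subgroup
  \<open>M\<close> with \<open>M T = H\<close> meets \<open>T\<close> in a maximal subgroup of \<open>T\<close>, which has prime index; a maximal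
  subgroup containing \<open>T\<close> costs nothing but possibly the distinction between \<open>T\<close> and \<open>H\<close>. This will
  be used for dihedral groups, with \<open>T\<close> the rotations.
\<close>
theorem (in group) steps_ge_hereditarily_normal:
  assumes "steps_to_one G t H" "finite H" "subgroup T G" "T \<subseteq> H"
    and "\<And>S x s. subgroup S G \<Longrightarrow> S \<subseteq> T \<Longrightarrow> x \<in> H \<Longrightarrow> s \<in> S \<Longrightarrow> x \<otimes> s \<otimes> inv x \<in> S"
  shows "bigomega (card T) + (if T = H then 0 else 1) \<le> t"
  using assms
proof (induction arbitrary: T rule: steps_to_one.induct)
  case one
  have "T = {\<one>}" using subgroup.one_closed[OF one.prems(2)] one.prems(3) by blast
  then show ?case by simp
next
  case (step M H t)
  have H: "subgroup H G" and M: "subgroup M G" and MH: "M \<subset> H"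
    and between: "\<And>L. subgroup L G \<Longrightarrow> M \<subseteq> L \<Longrightarrow> L \<subseteq> H \<Longrightarrow> L = M \<or> L = H"
    using step.hyps(1) unfolding maximal_in_def by auto
  note c = subgroup.mem_carrier[OF H]
  note T = step.prems(2,3)
  have finM: "finite M" and finT: "finite T"
    using step.prems(1,3) MH finite_subset by blast+
  show ?case
  proof (cases "T \<subseteq> M")
    case True
    have "bigomega (card T) + (if T = M then 0 else 1) \<le> t"
    proof (rule step.IH[OF finM T(1) True])
      show "x \<otimes> s \<otimes> inv x \<in> S" if "subgroup S G" "S \<subseteq> T" "x \<in> M" "s \<in> S" for S x s
        using step.prems(4)[OF that(1,2) _ that(4)] that(3) MH by blast
    qed
    then show ?thesis using True MH by (auto split: if_splits)
  next
    case False
    have supp: "M <#> T = H"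
      using maximal_in_supplement[OF step.hyps(1) T False] step.prems(4)[OF T(1)] by blast
    have s: "subgroup (M \<inter> T) G" using subgroups_Inter_pair[OF M T(1)] .
    \<comment> \<open>If \<open>S\<close> lies between \<open>M \<inter> T\<close> and \<open>T\<close>, then \<open>M S\<close> lies between \<open>M\<close> and \<open>H\<close>.\<close>
    have "maximal_in G (M \<inter> T) T"
      unfolding maximal_in_def
    proof (intro conjI allI impI)
      show "M \<inter> T \<subset> T" using False by auto
      fix S assume S: "subgroup S G" "M \<inter> T \<subseteq> S" "S \<subseteq> T"
      have sMS: "subgroup (M <#> S) G"
        using subgroup_set_mult_normalised[OF M S(1)] step.prems(4)[OF S(1,3)] MH by blast
      have 1: "M \<subseteq> M <#> S"
        using subgroup.one_closed[OF S(1)] subgroup.mem_carrier[OF M] by (force simp: set_mult_def)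
      have 2: "M <#> S \<subseteq> H"
        using MH S(3) T(2) subgroup.m_closed[OF H] unfolding set_mult_def by blast
      have 3: "S \<subseteq> M <#> S"
        using subgroup.one_closed[OF M] subgroup.mem_carrier[OF S(1)] by (force simp: set_mult_def)
      from between[OF sMS 1 2] show "S = M \<inter> T \<or> S = T"
      proof
        assume "M <#> S = M" then show ?thesis using 3 S by blast
      next
        assume e: "M <#> S = H"
        have "x \<in> S" if x: "x \<in> T" for x
        proof -
          obtain m u where mu: "m \<in> M" "u \<in> S" "x = m \<otimes> u"
            using e x T(2) by (auto simp: set_mult_def)
          have "m = x \<otimes> inv u"
            using mu subgroup.mem_carrier[OF M] subgroup.mem_carrier[OF S(1)] by (simp add: m_assoc)
          then have "m \<in> T" using x mu S(3) subgroup.m_closed[OF T(1)] subgroup.m_inv_closed[OF T(1)] by (metis subsetD)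
          then show ?thesis using mu S(2) subgroup.m_closed[OF S(1)] by auto
        qed
        then show ?thesis using S(3) by blast
      qed
    qed (use s T(1) in auto)
    moreover have "x \<otimes> s \<otimes> inv x \<in> M \<inter> T" if "x \<in> T" "s \<in> M \<inter> T" for x s
      using step.prems(4)[OF s _ _ that(2)] that(1) T(2) by blast
    ultimately obtain p where p: "prime p" "card T = p * card (M \<inter> T)"
      using prime_index_of_normal_maximal[OF _ finT] by metis
    have "card (M \<inter> T) > 0"
      using finM subgroup.one_closed[OF s] by (auto simp: card_gt_0_iff)
    then have "bigomega (card T) = Suc (bigomega (card (M \<inter> T)))"
      using p bigomega_prime_mult by simp
    moreover have "bigomega (card (M \<inter> T)) + (if M \<inter> T = M then 0 else 1) \<le> t"
    proof (rule step.IH[OF finM s])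
      show "x \<otimes> s \<otimes> inv x \<in> S" if "subgroup S G" "S \<subseteq> M \<inter> T" "x \<in> M" "s \<in> S" for S x s
        using step.prems(4)[OF that(1) _ _ that(4)] that(2,3) MH by blast
    qed simp
    moreover have "M \<inter> T = M \<Longrightarrow> T = H"
    proof -
      assume "M \<inter> T = M"
      then have "M \<subseteq> T" by auto
      then have "H \<subseteq> T" using supp subgroup.m_closed[OF T(1)] unfolding set_mult_def by blast
      then show "T = H" using T(2) by blast
    qed
    ultimately show ?thesis by (auto split: if_splits)
  qed
qed

section \<open>Permutation groups in which every nontrivial element fixes one or two points\<close>

abbreviation perm_group :: "('p \<Rightarrow> 'p) set \<Rightarrow> ('p \<Rightarrow> 'p) monoid" where
  "perm_group P \<equiv> \<lparr>carrier = P, monoid.mult = (\<circ>), one = id\<rparr>"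

abbreviation (input) finv :: "('p \<Rightarrow> 'p) \<Rightarrow> 'p \<Rightarrow> 'p" where
  "finv g \<equiv> inv_into UNIV g"

text \<open>
  In the intended action \<open>stab H p\<close> is, in suitable coordinates, a group of upper triangular
  matrices, \<open>unip H p\<close> its unipotent subgroup, \<open>special H\<close> the set of points with nontrivial stabiliser, and \<open>cusps H\<close> the
  set of points fixed by an involution of \<open>H\<close>.
\<close>
definition stab :: "('p \<Rightarrow> 'p) set \<Rightarrow> 'p \<Rightarrow> ('p \<Rightarrow> 'p) set" where
  "stab H p = {h \<in> H. h p = p}"

definition unip :: "('p \<Rightarrow> 'p) set \<Rightarrow> 'p \<Rightarrow> ('p \<Rightarrow> 'p) set" where
  "unip H p = {h \<in> H. h p = p \<and> (\<forall>q. h q = q \<longrightarrow> q \<noteq> p \<longrightarrow> h = id)}"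

lemma unipI: "h \<in> H \<Longrightarrow> h p = p \<Longrightarrow> (\<And>q. h q = q \<Longrightarrow> q \<noteq> p \<Longrightarrow> h = id) \<Longrightarrow> h \<in> unip H p"
  by (simp add: unip_def)

lemma unipD:
  assumes "h \<in> unip H p" shows "h \<in> H" "h p = p" "h q = q \<Longrightarrow> q \<noteq> p \<Longrightarrow> h = id"
  using assms unfolding unip_def by blast+

definition orb :: "('p \<Rightarrow> 'p) set \<Rightarrow> 'p \<Rightarrow> 'p set" where
  "orb H p = (\<lambda>h. h p) ` H"

definition special :: "('p \<Rightarrow> 'p) set \<Rightarrow> 'p set" where
  "special H = {p. \<exists>h\<in>H. h \<noteq> id \<and> h p = p}"

definition cusps :: "('p \<Rightarrow> 'p) set \<Rightarrow> 'p set" where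
  "cusps H = {p. \<exists>h\<in>unip H p. h \<noteq> id}"

text \<open>
  The properties of \<open>SL\<^sub>2\<close> over an algebraically closed field of characteristic 2, acting on the
  projective line, on which the whole analysis of finite subgroups rests. The last two say that a
  stabiliser modulo its unipotent subgroup is abelian, and that the Weyl element inverts the torus.
\<close>
locale one_or_two_fixed_points =
  fixes P :: "('p \<Rightarrow> 'p) set"
  assumes P_bij: "g \<in> P \<Longrightarrow> bij g"
    and P_id: "id \<in> P"
    and P_comp: "g \<in> P \<Longrightarrow> h \<in> P \<Longrightarrow> g \<circ> h \<in> P"
    and P_inv: "g \<in> P \<Longrightarrow> finv g \<in> P"
    and ex_fixed_point: "g \<in> P \<Longrightarrow> \<exists>p. g p = p"
    and three_fixed_points: "g \<in> P \<Longrightarrow> g p = p \<Longrightarrow> g q = q \<Longrightarrow> g r = r \<Longrightarrow>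
        p \<noteq> q \<Longrightarrow> p \<noteq> r \<Longrightarrow> q \<noteq> r \<Longrightarrow> g = id"
    and unip_comp: "u \<in> unip P p \<Longrightarrow> v \<in> unip P p \<Longrightarrow> u \<circ> v \<in> unip P p"
    and unip_square: "u \<in> unip P p \<Longrightarrow> u \<circ> u = id"
    and square_two_fixed_points: "g \<in> P \<Longrightarrow> g p = p \<Longrightarrow> g q = q \<Longrightarrow> p \<noteq> q \<Longrightarrow> g \<circ> g = id \<Longrightarrow> g = id"
    and commutator_unip: "g \<in> stab P p \<Longrightarrow> h \<in> stab P p \<Longrightarrow> g \<circ> h \<circ> finv g \<circ> finv h \<in> unip P p"
    and swap_inverts: "g \<in> P \<Longrightarrow> g p = p \<Longrightarrow> g q = q \<Longrightarrow> p \<noteq> q \<Longrightarrow>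
        s \<in> P \<Longrightarrow> s p = q \<Longrightarrow> s q = p \<Longrightarrow> s \<circ> g \<circ> finv s = finv g"
begin

abbreviation "\<Gamma> \<equiv> perm_group P"

lemma P_inv_apply: "g \<in> P \<Longrightarrow> finv g (g x) = x" "g \<in> P \<Longrightarrow> g (finv g x) = x"
  using P_bij by (simp_all add: bij_is_inj bij_is_surj surj_f_inv_f)

lemma P_inv_comp: "g \<in> P \<Longrightarrow> finv g \<circ> g = id" "g \<in> P \<Longrightarrow> g \<circ> finv g = id"
  using P_inv_apply by (auto simp: fun_eq_iff)

lemma group_\<Gamma>: "group \<Gamma>"
proof (rule groupI)
  show "\<exists>y\<in>carrier \<Gamma>. y \<otimes>\<^bsub>\<Gamma>\<^esub> x = \<one>\<^bsub>\<Gamma>\<^esub>" if "x \<in> carrier \<Gamma>" for x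
    using that P_inv P_inv_comp by auto
qed (auto simp: P_id P_comp comp_assoc)

lemma inv_\<Gamma>: "g \<in> P \<Longrightarrow> inv\<^bsub>\<Gamma>\<^esub> g = finv g"
  using group.inv_equality[OF group_\<Gamma>, of "finv g" g] P_inv P_inv_comp by simp

lemma subgroup_iff:
  "subgroup H \<Gamma> \<longleftrightarrow> H \<subseteq> P \<and> id \<in> H \<and> (\<forall>g\<in>H. \<forall>h\<in>H. g \<circ> h \<in> H) \<and> (\<forall>g\<in>H. finv g \<in> H)"
  using inv_\<Gamma> by (auto simp: subgroup_def subset_iff)

lemma subgroupD:
  assumes "subgroup H \<Gamma>"
  shows "h \<in> H \<Longrightarrow> h \<in> P" "id \<in> H" "g \<in> H \<Longrightarrow> h \<in> H \<Longrightarrow> g \<circ> h \<in> H" "g \<in> H \<Longrightarrow> finv g \<in> H"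
  using assms unfolding subgroup_iff by auto

lemma unip_eq: "H \<subseteq> P \<Longrightarrow> unip H p = H \<inter> unip P p"
  by (auto simp: unip_def)

lemma unip_subset_stab: "unip H p \<subseteq> stab H p"
  by (auto simp: unip_def stab_def)

lemma subgroup_stab: "subgroup H \<Gamma> \<Longrightarrow> subgroup (stab H p) \<Gamma>"
  unfolding subgroup_iff stab_def by auto (metis P_inv_apply(1) subsetD)

lemma inv_unip:
  assumes "u \<in> unip P p" shows "finv u = u"
  by (rule inv_unique_comp[OF unip_square[OF assms] unip_square[OF assms]])

lemma subgroup_unip:
  assumes H: "subgroup H \<Gamma>" shows "subgroup (unip H p) \<Gamma>"
proof -
  have e: "unip H p = H \<inter> unip P p" using unip_eq H unfolding subgroup_iff by blast
  have "id \<in> unip P p" using P_id by (simp add: unip_def)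
  moreover have "finv u \<in> unip P p" if "u \<in> unip P p" for u
    using inv_unip[OF that] that by simp
  ultimately show ?thesis
    unfolding e subgroup_iff
    by (intro conjI ballI) (auto intro: subgroupD[OF H] unip_comp)
qed

lemmas card_subgroup_dvd = group.card_subgroup_dvd[OF group_\<Gamma>]

lemma card_orbit_stabiliser:
  assumes H: "subgroup H \<Gamma>" and fin: "finite H"
  shows "card H = card (stab H p) * card (orb H p)"
  unfolding orb_def
proof (rule card_eq_fibre_card_times_image[OF fin])
  fix y assume "y \<in> (\<lambda>h. h p) ` H"
  then obtain g where g: "g \<in> H" "y = g p" by blast
  note gP = P_inv_apply[OF subgroupD(1)[OF H g(1)]] P_inv_comp[OF subgroupD(1)[OF H g(1)]]
  have "bij_betw ((\<circ>) g) (stab H p) {x \<in> H. x p = y}"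
  proof (rule bij_betwI[where g = "(\<circ>) (finv g)"])
    show "(\<circ>) g \<in> stab H p \<rightarrow> {x \<in> H. x p = y}"
      using g subgroupD(3)[OF H] by (auto simp: stab_def)
    show "(\<circ>) (finv g) \<in> {x \<in> H. x p = y} \<rightarrow> stab H p"
      using g gP subgroupD(3,4)[OF H] by (auto simp: stab_def)
  qed (simp_all add: comp_assoc[symmetric] gP)
  then show "card {x \<in> H. x p = y} = card (stab H p)" by (simp add: bij_betw_same_card)
qed

lemma mem_orb_self: "subgroup H \<Gamma> \<Longrightarrow> p \<in> orb H p"
  unfolding orb_def using image_eqI[of p "\<lambda>h. h p" id H] subgroupD(2)[of H] by simp

lemma orb_trans:
  assumes "subgroup H \<Gamma>" "q \<in> orb H p" shows "orb H q = orb H p"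
proof -
  from assms(2) obtain g where g: "g \<in> H" "q = g p" by (auto simp: orb_def)
  show ?thesis
  proof
    show "orb H q \<subseteq> orb H p"
      using g subgroupD(3)[OF assms(1)] by (auto simp: orb_def image_iff intro!: bexI[of _ "_ \<circ> g"])
    show "orb H p \<subseteq> orb H q"
      using g subgroupD(3,4)[OF assms(1)] P_inv_apply(1)[OF subgroupD(1)[OF assms(1) g(1)]]
      by (auto simp: orb_def image_iff intro!: bexI[of _ "_ \<circ> finv g"])
  qed
qed

lemma orb_disjoint:
  assumes "subgroup H \<Gamma>" "q \<notin> orb H p" shows "orb H p \<inter> orb H q = {}"
  using assms orb_trans mem_orb_self by blast

lemma conj_fixes_iff:
  assumes "g \<in> P" "h \<in> P"
  shows "(g \<circ> h \<circ> finv g) (g p) = g p \<longleftrightarrow> h p = p"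
  using P_inv_apply(1)[OF assms(1)] P_bij[OF assms(1)] by (auto simp: bij_def inj_eq)

lemma conj_eq_id_iff:
  assumes "g \<in> P" "h \<in> P"
  shows "g \<circ> h \<circ> finv g = id \<longleftrightarrow> h = id"
proof
  assume "g \<circ> h \<circ> finv g = id"
  then have "g (h (finv g (g x))) = g x" for x by (simp add: fun_eq_iff)
  then have "h x = x" for x using P_inv_apply(1)[OF assms(1)] P_bij[OF assms(1)] by (simp add: bij_def inj_eq)
  then show "h = id" by auto
qed (use P_inv_comp(2)[OF assms(1)] in simp)

lemma conj_unip:
  assumes H: "subgroup H \<Gamma>" and g: "g \<in> H" and u: "u \<in> unip H p"
  shows "g \<circ> u \<circ> finv g \<in> unip H (g p)"
proof -
  have gP: "g \<in> P" "u \<in> P" and uH: "u \<in> H" using subgroupD(1)[OF H] g u by (auto simp: unip_def)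
  have "g \<circ> u \<circ> finv g = id" if q: "(g \<circ> u \<circ> finv g) q = q" "q \<noteq> g p" for q
  proof -
    have "u (finv g q) = finv g q"
      using conj_fixes_iff[OF gP, of "finv g q"] q(1) P_inv_apply(2)[OF gP(1)] by simp
    moreover have "finv g q \<noteq> p" using q(2) P_inv_apply(2)[OF gP(1), of q] by auto
    ultimately have "u = id" using unipD(3)[OF u] by blast
    then show ?thesis using P_inv_comp(2)[OF gP(1)] by simp
  qed
  moreover have "(g \<circ> u \<circ> finv g) (g p) = g p" using conj_fixes_iff[OF gP] u by (simp add: unip_def)
  moreover have "g \<circ> u \<circ> finv g \<in> H" using g uH subgroupD(3,4)[OF H] by simp
  ultimately show ?thesis unfolding unip_def by blast
qed

lemma card_unip_orb:
  assumes H: "subgroup H \<Gamma>" and q: "q \<in> orb H p"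
  shows "card (unip H q) = card (unip H p)"
proof -
  obtain g where g: "g \<in> H" "q = g p" using q by (auto simp: orb_def)
  note gP = P_inv_apply[OF subgroupD(1)[OF H g(1)]] P_inv_comp[OF subgroupD(1)[OF H g(1)]]
  have ii: "finv (finv g) = g" using P_bij[OF subgroupD(1)[OF H g(1)]] by (simp add: inv_inv_eq)
  have "bij_betw (\<lambda>u. g \<circ> u \<circ> finv g) (unip H p) (unip H q)"
  proof (rule bij_betwI[where g = "\<lambda>u. finv g \<circ> u \<circ> g"])
    show "(\<lambda>u. g \<circ> u \<circ> finv g) \<in> unip H p \<rightarrow> unip H q" using conj_unip[OF H g(1)] g(2) by auto
    show "(\<lambda>u. finv g \<circ> u \<circ> g) \<in> unip H q \<rightarrow> unip H p"
      using conj_unip[OF H subgroupD(4)[OF H g(1)], of _ q] g(2) ii gP(1) by auto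
  qed (auto simp: fun_eq_iff gP)
  then show ?thesis by (simp add: bij_betw_same_card)
qed

lemma card_stab_orb:
  assumes H: "subgroup H \<Gamma>" "finite H" and q: "q \<in> orb H p"
  shows "card (stab H q) = card (stab H p)"
proof -
  have "card (orb H p) > 0" using mem_orb_self[OF H(1)] H(2) by (auto simp: card_gt_0_iff orb_def)
  then show ?thesis
    using card_orbit_stabiliser[OF H, of p] card_orbit_stabiliser[OF H, of q] orb_trans[OF H(1) q] by simp
qed

lemma card_unip_gt_0:
  assumes "subgroup H \<Gamma>" "finite H" shows "card (unip H p) > 0"
proof -
  have "finite (unip H p)" by (rule finite_subset[OF _ assms(2)]) (auto simp: unip_def)
  then show ?thesis using subgroupD(2)[OF subgroup_unip[OF assms(1)], of p] card_gt_0_iff by blast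
qed

lemma card_stab_gt_0: "subgroup H \<Gamma> \<Longrightarrow> finite H \<Longrightarrow> card (stab H p) > 0"
  using subgroupD(2)[OF subgroup_stab, of H p] by (auto simp: card_gt_0_iff stab_def)

text \<open>
  Either way, the number of fixed points plus the number of points at which \<open>g\<close> is unipotent is two;
  this makes the count below uniform.
\<close>
lemma fixed_points_cases:
  assumes "g \<in> P" "g \<noteq> id"
  obtains p where "{q. g q = q} = {p}" "{q. g \<in> unip P q} = {p}"
  | p q where "p \<noteq> q" "{q. g q = q} = {p, q}" "{q. g \<in> unip P q} = {}"
proof -
  obtain p where p: "g p = p" using ex_fixed_point assms by blast
  show thesis
  proof (cases "\<exists>q. g q = q \<and> q \<noteq> p")
    case True
    then obtain q where q: "g q = q" "q \<noteq> p" by blast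
    have "r = p \<or> r = q" if "g r = r" for r
      using three_fixed_points[OF assms(1) p q(1) that] q(2) assms(2) by metis
    then have fx: "{r. g r = r} = {p, q}" using p q(1) by auto
    have "g \<notin> unip P r" for r
      using unipD(3)[of g P r p] unipD(3)[of g P r q] p q assms(2) by metis
    then have "{r. g \<in> unip P r} = {}" by simp
    with fx show ?thesis by (rule that(2)[OF q(2)[symmetric]])
  next
    case False
    then have "g q = q \<longleftrightarrow> q = p" for q using p by metis
    then have "{q. g q = q} = {p}" by simp
    moreover have "g \<in> unip P q \<longleftrightarrow> q = p" for q
      using unipI[of g P p] unipD(2)[of g P q] False p assms(1) by metis
    then have "{q. g \<in> unip P q} = {p}" by simp
    ultimately show ?thesis using that(1) by simp
  qed
qed

lemma finite_special:
  assumes "subgroup H \<Gamma>" "finite H" shows "finite (special H)"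
proof -
  have "special H = (\<Union>g\<in>H - {id}. {p. g p = p})" by (auto simp: special_def)
  moreover have "finite {p. g p = p}" if "g \<in> H - {id}" for g
    by (rule fixed_points_cases[of g]) (use that subgroupD(1)[OF assms(1)] in auto)
  ultimately show ?thesis using assms by auto
qed

lemma cusps_iff: 
  assumes "subgroup H \<Gamma>" "finite H" shows "p \<in> cusps H \<longleftrightarrow> card (unip H p) > 1"
proof -
  have i: "id \<in> unip H p" and f: "finite (unip H p)" using assms subgroupD(2)[OF subgroup_unip[OF assms(1)], of p] by (simp_all add: unip_def)
  show ?thesis
  proof
    assume "p \<in> cusps H"
    then obtain u where "u \<in> unip H p" "u \<noteq> id" by (auto simp: cusps_def)
    then have "card {id, u} \<le> card (unip H p)" using i f by (intro card_mono) auto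
    then show "card (unip H p) > 1" using \<open>u \<noteq> id\<close> by simp
  next
    assume "card (unip H p) > 1"
    then have "\<not> unip H p \<subseteq> {id}" using card_mono[of "{id}" "unip H p"] by auto
    then show "p \<in> cusps H" by (auto simp: cusps_def)
  qed
qed

lemma cusps_subset_special: "cusps H \<subseteq> special H"
  using unipD(1,2)[of _ H] unfolding cusps_def special_def by blast

lemma special_orb:
  assumes "subgroup H \<Gamma>" "p \<in> special H" "q \<in> orb H p" shows "q \<in> special H"
proof -
  obtain g where g: "g \<in> H" "q = g p" using assms(3) by (auto simp: orb_def)
  obtain h where h: "h \<in> H" "h \<noteq> id" "h p = p" using assms(2) by (auto simp: special_def)
  have "(g \<circ> h \<circ> finv g) q = q" "g \<circ> h \<circ> finv g \<noteq> id" "g \<circ> h \<circ> finv g \<in> H"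
    using g h conj_fixes_iff conj_eq_id_iff subgroupD[OF assms(1)] by auto
  then show ?thesis unfolding special_def by blast
qed

text \<open>
  Double counting of pairs \<open>(g, p)\<close> with \<open>g \<noteq> id\<close> and \<open>g p = p\<close>, where pairs with \<open>g\<close> unipotent at
  \<open>p\<close> count twice; then every \<open>g\<close> contributes exactly two.
\<close>
lemma fixed_point_count:
  assumes H: "subgroup H \<Gamma>" and fin: "finite H"
  shows "(\<Sum>p\<in>special H. (card (stab H p) - 1) + (card (unip H p) - 1)) = 2 * (card H - 1)"
proof -
  let ?A = "H - {id}" and ?S = "special H"
  have finS: "finite ?S" using finite_special[OF H fin] .
  have a: "card (stab H p) - 1 = (\<Sum>g | g \<in> ?A \<and> g p = p. 1)" for p
  proof -
    have "{g. g \<in> ?A \<and> g p = p} = stab H p - {id}" by (auto simp: stab_def)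
    then show ?thesis using subgroupD(2)[OF subgroup_stab[OF H], of p] by simp
  qed
  have b: "card (unip H p) - 1 = (\<Sum>g | g \<in> ?A \<and> g \<in> unip P p. 1)" for p
  proof -
    have "{g. g \<in> ?A \<and> g \<in> unip P p} = unip H p - {id}"
      using unip_eq[of H p] subgroupD(1)[OF H] by auto
    then show ?thesis using subgroupD(2)[OF subgroup_unip[OF H], of p] by simp
  qed
  have two: "card {p. p \<in> ?S \<and> g p = p} + card {p. p \<in> ?S \<and> g \<in> unip P p} = 2" if g: "g \<in> ?A" for g
  proof -
    have "{p. p \<in> ?S \<and> g p = p} = {p. g p = p}" using g by (auto simp: special_def)
    moreover have "{p. p \<in> ?S \<and> g \<in> unip P p} = {p. g \<in> unip P p}"
      using g unipD(2)[of g P] by (auto simp: special_def)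
    moreover have "card {p. g p = p} + card {p. g \<in> unip P p} = 2"
      by (rule fixed_points_cases[of g]) (use g subgroupD(1)[OF H] in auto)
    ultimately show ?thesis by simp
  qed
  have "(\<Sum>p\<in>?S. (card (stab H p) - 1) + (card (unip H p) - 1))
      = (\<Sum>p\<in>?S. \<Sum>g | g \<in> ?A \<and> g p = p. 1) + (\<Sum>p\<in>?S. \<Sum>g | g \<in> ?A \<and> g \<in> unip P p. 1)"
    unfolding a b sum.distrib ..
  also have "\<dots> = (\<Sum>g\<in>?A. \<Sum>p | p \<in> ?S \<and> g p = p. 1) + (\<Sum>g\<in>?A. \<Sum>p | p \<in> ?S \<and> g \<in> unip P p. 1)"
    using fin finS
    by (intro arg_cong2[where f = "(+)"] sum.swap_restrict) auto
  also have "\<dots> = (\<Sum>g\<in>?A. card {p. p \<in> ?S \<and> g p = p} + card {p. p \<in> ?S \<and> g \<in> unip P p})"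
    by (simp add: sum.distrib)
  also have "\<dots> = (\<Sum>g\<in>?A. 2)" by (rule sum.cong) (use two in auto)
  also have "\<dots> = 2 * (card H - 1)" using subgroupD(2)[OF H] fin by simp
  finally show ?thesis .
qed

lemma even_card_unip:
  assumes "subgroup H \<Gamma>" "finite H" "p \<in> cusps H" shows "even (card (unip H p))"
proof -
  obtain u where u: "u \<in> unip H p" "u \<noteq> id" using assms(3) by (auto simp: cusps_def)
  have uP: "u \<in> P" using unipD(1)[OF u(1)] subgroupD(1)[OF assms(1)] by blast
  have "u \<in> unip P p" by (rule unipI[OF uP unipD(2,3)[OF u(1)]])
  then have "u \<circ> u = id" "finv u = u" by (rule unip_square, rule inv_unip)
  then have "subgroup {id, u} \<Gamma>"
    using uP P_id by (auto simp: subgroup_iff)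
  moreover have "{id, u} \<subseteq> unip H p" using u subgroupD(2)[OF subgroup_unip[OF assms(1)]] by auto
  ultimately have "card {id, u} dvd card (unip H p)"
    using card_subgroup_dvd[OF subgroup_unip[OF assms(1)]] by blast
  moreover have "card {id, u} = 2" using u(2) by (simp add: card_insert_if)
  ultimately show ?thesis by simp
qed

text \<open>
  A stabiliser that is neither trivial nor contains an involution contains \<open>g\<close> and \<open>g^2\<close>, both
  different from the identity.
\<close>
lemma card_stab_ge_3:
  assumes H: "subgroup H \<Gamma>" "finite H" and p: "p \<in> special H" "p \<notin> cusps H"
  shows "card (stab H p) \<ge> 3"
proof -
  obtain g where g: "g \<in> H" "g \<noteq> id" "g p = p" using p(1) by (auto simp: special_def)
  then have "g \<notin> unip H p" using p(2) by (auto simp: cusps_def)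
  then obtain q where q: "g q = q" "q \<noteq> p" using g unipI[of g H p] by blast
  have gP: "g \<in> P" using subgroupD(1)[OF H(1) g(1)] .
  have "g \<circ> g \<noteq> id" using square_two_fixed_points[OF gP g(3) q(1)] q(2) g(2) by blast
  moreover have "g \<circ> g \<noteq> g"
  proof
    assume "g \<circ> g = g"
    then have "finv g \<circ> (g \<circ> g) = finv g \<circ> g" by simp
    then show False using g(2) P_inv_comp(1)[OF gP] by (simp add: comp_assoc[symmetric])
  qed
  ultimately have "card {id, g, g \<circ> g} = 3" using g(2) by (metis card_3_iff)
  moreover have "{id, g, g \<circ> g} \<subseteq> stab H p"
    using g subgroupD(2,3)[OF H(1)] by (auto simp: stab_def)
  moreover have "finite (stab H p)" using H(2) by (simp add: stab_def)
  ultimately show ?thesis using card_mono by metis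
qed

lemma unip_commute:
  assumes "u \<in> unip P p" "v \<in> unip P p" shows "u \<circ> v = v \<circ> u"
proof -
  have "finv (u \<circ> v) = u \<circ> v" using inv_unip unip_comp assms by blast
  moreover have "finv (u \<circ> v) = finv v \<circ> finv u"
    using assms P_bij by (intro o_inv_distrib) (auto simp: unip_def)
  ultimately show ?thesis using inv_unip assms by simp
qed

text \<open>
  A second fixed point of an element commuting with \<open>u\<close> would be moved by \<open>u\<close> to a third one.
\<close>
lemma centraliser_unip:
  assumes H: "subgroup H \<Gamma>" and u: "u \<in> unip H p" "u \<noteq> id" and g: "g \<in> stab H p"
  shows "g \<circ> u \<circ> finv g = u \<longleftrightarrow> g \<in> unip H p"
proof
  have gP: "g \<in> P" using g subgroupD(1)[OF H] by (auto simp: stab_def)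
  have uP: "u \<in> P" using u subgroupD(1)[OF H] by (auto simp: unip_def)
  { assume "g \<circ> u \<circ> finv g = u"
    then have gu: "g (u x) = u (g x)" for x
      using P_inv_apply(1)[OF gP] by (metis comp_apply)
    have "g = id" if q: "g q = q" "q \<noteq> p" for q
    proof -
      have "g (u q) = u q" using gu q by simp
      moreover have "u q \<noteq> q" using unipD(3)[OF u(1)] u(2) q(2) by blast
      moreover have "u q \<noteq> p"
      proof
        assume "u q = p"
        then have "u q = u p" using u by (simp add: unip_def)
        then show False using P_bij[OF uP] q(2) by (simp add: bij_def inj_eq)
      qed
      ultimately show ?thesis using three_fixed_points[OF gP, of p q "u q"] q g by (auto simp: stab_def)
    qed
    then show "g \<in> unip H p" using g unipI[of g H p] by (auto simp: stab_def)
  }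
  { assume "g \<in> unip H p"
    then have "g \<circ> u = u \<circ> g" using unip_commute u(1) unip_eq[of H p] H by (auto simp: subgroup_iff)
    then have "g \<circ> u \<circ> finv g = u \<circ> (g \<circ> finv g)" by (simp add: comp_assoc)
    then show "g \<circ> u \<circ> finv g = u" using P_inv_comp(2)[OF gP] by simp }
qed

text \<open>
  The stabiliser acts by conjugation on the nontrivial unipotent elements. By \<open>centraliser_unip\<close> all
  its orbits there have the same size \<open>w\<close>, the index of the unipotent subgroup in the stabiliser.
\<close>
lemma card_stab_cusp:
  assumes H: "subgroup H \<Gamma>" "finite H" and p: "p \<in> cusps H"
  obtains w c where "card (stab H p) = card (unip H p) * w" "card (unip H p) - 1 = w * c"
proof -
  let ?U = "unip H p" and ?B = "stab H p"
  have finB: "finite ?B" and finU: "finite ?U" using H(2) by (auto simp: stab_def unip_def)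
  note B = subgroup_stab[OF H(1), of p] and U = subgroup_unip[OF H(1), of p]
  obtain w where w: "card ?B = card ?U * w"
    using card_subgroup_dvd[OF B U unip_subset_stab] by (auto elim: dvdE)
  define cl where "cl u = (\<lambda>g. g \<circ> u \<circ> finv g) ` ?B" for u
  have BP: "g \<in> P" if "g \<in> ?B" for g using that subgroupD(1)[OF B] by blast
  have cl_sub: "cl u \<subseteq> ?U - {id}" if u: "u \<in> ?U - {id}" for u
  proof
    fix v assume "v \<in> cl u"
    then obtain g where g: "g \<in> ?B" "v = g \<circ> u \<circ> finv g" by (auto simp: cl_def)
    have "v \<in> ?U" using conj_unip[OF H(1), of g u p] g u by (auto simp: stab_def)
    moreover have "v \<noteq> id" using conj_eq_id_iff[OF BP[OF g(1)], of u] g(2) u subgroupD(1)[OF U] by auto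
    ultimately show "v \<in> ?U - {id}" by blast
  qed
  have conj_conj: "g \<circ> (h \<circ> u \<circ> finv h) \<circ> finv g = (g \<circ> h) \<circ> u \<circ> finv (g \<circ> h)" if "g \<in> P" "h \<in> P" for g h u
    using o_inv_distrib[OF P_bij P_bij, OF that] by (simp add: comp_assoc)
  have card_cl: "card (cl u) = w" if u: "u \<in> ?U - {id}" for u
  proof -
    have "card ?B = card ?U * card (cl u)"
      unfolding cl_def
    proof (rule card_eq_fibre_card_times_image[OF finB])
      fix y assume "y \<in> (\<lambda>g. g \<circ> u \<circ> finv g) ` ?B"
      then obtain g where g: "g \<in> ?B" "y = g \<circ> u \<circ> finv g" by blast
      note gi = P_inv_comp[OF BP[OF g(1)]]
      have ii: "finv (finv g) = g" using P_bij[OF BP[OF g(1)]] by (simp add: inv_inv_eq)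
      have "bij_betw ((\<circ>) g) ?U {x \<in> ?B. x \<circ> u \<circ> finv x = y}"
      proof (rule bij_betwI[where g = "(\<circ>) (finv g)"])
        show "(\<circ>) g \<in> ?U \<rightarrow> {x \<in> ?B. x \<circ> u \<circ> finv x = y}"
        proof
          fix v assume v: "v \<in> ?U"
          have vB: "v \<in> ?B" by (rule subsetD[OF unip_subset_stab v])
          have "g \<circ> v \<circ> u \<circ> finv (g \<circ> v) = g \<circ> (v \<circ> u \<circ> finv v) \<circ> finv g"
            using conj_conj[OF BP[OF g(1)] BP[OF vB]] by simp
          also have "\<dots> = y" using centraliser_unip[OF H(1) _ _ vB, of u] u v g(2) by auto
          finally show "g \<circ> v \<in> {x \<in> ?B. x \<circ> u \<circ> finv x = y}"
            using subgroupD(3)[OF B g(1) vB] by simp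
        qed
        show "(\<circ>) (finv g) \<in> {x \<in> ?B. x \<circ> u \<circ> finv x = y} \<rightarrow> ?U"
        proof
          fix x assume x: "x \<in> {x \<in> ?B. x \<circ> u \<circ> finv x = y}"
          have gx: "finv g \<circ> x \<in> ?B" using subgroupD(3,4)[OF B] g x by blast
          have "(finv g \<circ> x) \<circ> u \<circ> finv (finv g \<circ> x) = finv g \<circ> y \<circ> g"
            using conj_conj[of "finv g" x u] x BP g P_inv ii by auto
          also have "\<dots> = (finv g \<circ> g) \<circ> u \<circ> (finv g \<circ> g)" unfolding g(2) by (simp add: comp_assoc)
          also have "\<dots> = u" by (simp add: gi)
          finally show "finv g \<circ> x \<in> ?U" using centraliser_unip[OF H(1) _ _ gx, of u] u by auto
        qed
      qed (simp_all add: comp_assoc[symmetric] gi)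
      then show "card {x \<in> ?B. x \<circ> u \<circ> finv x = y} = card ?U" by (simp add: bij_betw_same_card)
    qed
    then show ?thesis using w card_unip_gt_0[OF H, of p] by simp
  qed
  have self: "u \<in> cl u" for u
    unfolding cl_def using subgroupD(2)[OF B] by (intro image_eqI[of _ _ id]) auto
  have cl_eq: "cl v = cl u" if v: "v \<in> cl u" for u v
  proof -
    obtain g where g: "g \<in> ?B" "v = g \<circ> u \<circ> finv g" using v unfolding cl_def by blast
    have gi: "finv g \<in> ?B" "finv (finv g) = g" using subgroupD(4)[OF B g(1)] P_bij[OF BP[OF g(1)]] by (simp_all add: inv_inv_eq)
    have u: "u = finv g \<circ> v \<circ> finv (finv g)"
      unfolding g(2) gi(2) using P_inv_apply[OF BP[OF g(1)]] by (simp add: fun_eq_iff)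
    show ?thesis
    proof
      show "cl v \<subseteq> cl u"
        unfolding cl_def[of v] g(2) using conj_conj BP g(1) subgroupD(3)[OF B _ g(1)]
        by (auto simp: cl_def)
      show "cl u \<subseteq> cl v"
      proof
        fix z assume "z \<in> cl u"
        then obtain x where x: "x \<in> ?B" "z = x \<circ> u \<circ> finv x" unfolding cl_def by blast
        have "z = x \<circ> (finv g \<circ> v \<circ> finv (finv g)) \<circ> finv x" by (simp only: x(2) u[symmetric])
        also have "\<dots> = (x \<circ> finv g) \<circ> v \<circ> finv (x \<circ> finv g)"
          by (rule conj_conj[OF BP[OF x(1)] BP[OF gi(1)]])
        finally show "z \<in> cl v" using subgroupD(3)[OF B x(1) gi(1)] unfolding cl_def by blast
      qed
    qed
  qed
  have "w * card (cl ` (?U - {id})) = card (\<Union> (cl ` (?U - {id})))"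
  proof (rule card_partition)
    show "finite (\<Union> (cl ` (?U - {id})))" using finite_subset[OF _ finU] cl_sub by blast
    show "c1 \<inter> c2 = {}" if "c1 \<in> cl ` (?U - {id})" "c2 \<in> cl ` (?U - {id})" "c1 \<noteq> c2" for c1 c2
      using that cl_eq by blast
  qed (use finU card_cl in auto)
  moreover have "\<Union> (cl ` (?U - {id})) = ?U - {id}" using cl_sub self by blast
  moreover have "card (?U - {id}) = card ?U - 1" using subgroupD(2)[OF U] by simp
  ultimately show thesis using that w by metis
qed

end

section \<open>The trichotomy for finite subgroups\<close>

text \<open>
  The arithmetic core of the trichotomy. The unknowns are the size \<open>N\<close> of the orbit of cusps, the
  orders \<open>e w\<close> and \<open>e\<close> of a cusp stabiliser and of its unipotent subgroup, and the order \<open>n\<close> of the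
  stabilisers in the only other special orbit. The hypotheses leave \<open>c n\<close> no room except \<open>e + 1\<close>; as
  \<open>c\<close> also divides \<open>e - 1\<close>, parity will then force \<open>c = 1\<close>.
\<close>
lemma sl2_parameters:
  fixes N e w c n :: int
  assumes N: "N \<ge> 3" and e: "e \<ge> 4" and pos: "w > 0" and wc: "e - 1 = w * c"
    and eq: "n * (N * (e - 2) + 2) = N * e * w"
  shows "c * n = e + 1" and "N = e + 1"
proof -
  have "c * n * (N * (e - 2) + 2) = c * (N * e * w)" using eq by (simp add: mult.assoc)
  also have "\<dots> = N * e * (w * c)" by (simp add: mult_ac)
  finally have eq': "c * n * (N * (e - 2) + 2) = N * e * (e - 1)" using wc by simp
  have pos': "N * (e - 2) + 2 > 0" using N e by (intro add_nonneg_pos mult_nonneg_nonneg) auto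
  have "\<not> c * n \<le> e"
  proof
    assume "c * n \<le> e"
    then have "c * n * (N * (e - 2) + 2) \<le> e * (N * (e - 2) + 2)"
      using pos' by (intro mult_right_mono) auto
    then have "e * (N * (e - 1)) \<le> e * (N * (e - 2) + 2)" using eq' by (simp add: mult_ac)
    then have "N * (e - 1) \<le> N * (e - 2) + 2" using e by simp
    then show False using N by (simp add: algebra_simps)
  qed
  moreover have "\<not> c * n \<ge> e + 2"
  proof
    assume "c * n \<ge> e + 2"
    then have "(e + 2) * (N * (e - 2) + 2) \<le> c * n * (N * (e - 2) + 2)"
      using pos' by (intro mult_right_mono) auto
    then have "(e + 2) * (N * (e - 2) + 2) \<le> N * e * (e - 1)" using eq' by simp
    then have "2 * (e + 2) \<le> N * (4 - e)" by (simp add: algebra_simps)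
    moreover have "N * (4 - e) \<le> 0" using N e by (simp add: mult_nonneg_nonpos)
    ultimately show False using e by simp
  qed
  ultimately show cn: "c * n = e + 1" by simp
  have "(e + 1) * (N * (e - 2) + 2) = N * e * (e - 1)" using eq' cn by simp
  then show "N = e + 1" by (simp add: algebra_simps)
qed

context one_or_two_fixed_points
begin

text \<open>
  The parameters of \<open>SL\<^sub>2(e)\<close> for even \<open>e\<close>: its cusps are the points of the projective line over the
  field of \<open>e\<close> elements, and the other special points are those over the quadratic extension, where
  the stabilisers are the nonsplit tori.
\<close>
definition linear_type :: "('p \<Rightarrow> 'p) set \<Rightarrow> nat \<Rightarrow> bool" where
  "linear_type H e \<longleftrightarrow> subgroup H \<Gamma> \<and> finite H \<and> 4 \<le> e \<and> even e \<and>
     card H = (e + 1) * (e * (e - 1)) \<and> card (cusps H) = e + 1 \<and>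
     (\<forall>p\<in>cusps H. card (unip H p) = e \<and> card (stab H p) = e * (e - 1)) \<and>
     card (special H - cusps H) = e * (e - 1) \<and>
     (\<forall>p\<in>special H - cusps H. card (stab H p) = e + 1)"

lemma orb_weight:
  assumes H: "subgroup H \<Gamma>" and fin: "finite H"
  shows "(\<Sum>q\<in>orb H p. int ((card (stab H q) - 1) + (card (unip H q) - 1)))
    = int (card H) + int (card (orb H p)) * (int (card (unip H p)) - 2)"
proof -
  have "(\<Sum>q\<in>orb H p. int ((card (stab H q) - 1) + (card (unip H q) - 1)))
      = (\<Sum>q\<in>orb H p. int ((card (stab H p) - 1) + (card (unip H p) - 1)))"
    using card_unip_orb[OF H] card_stab_orb[OF H fin] by (intro sum.cong) auto
  also have "\<dots> = int (card (orb H p)) * (int (card (stab H p)) + int (card (unip H p)) - 2)"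
    using card_unip_gt_0[OF H fin, of p] card_stab_gt_0[OF H fin, of p]
    by (simp add: of_nat_diff algebra_simps)
  also have "\<dots> = int (card H) + int (card (orb H p)) * (int (card (unip H p)) - 2)"
    using card_orbit_stabiliser[OF H fin, of p] by (simp add: algebra_simps)
  finally show ?thesis .
qed

lemma orb_eq_self_imp_fixed:
  assumes "subgroup H \<Gamma>" "finite H" "card (orb H p) = 1" "h \<in> H"
  shows "h p = p"
proof -
  obtain x where "orb H p = {x}" using assms(3) card_1_singletonE by blast
  moreover have "h p \<in> orb H p" using assms(4) by (auto simp: orb_def)
  ultimately show ?thesis using mem_orb_self[OF assms(1), of p] by auto
qed

text \<open>
  Write \<open>W p\<close> for the contribution of the orbit of \<open>p\<close> to the fixed-point count. The total is
  \<open>2 \<bar>H\<bar> - 2\<close>, an orbit of cusps contributes at least \<open>\<bar>H\<bar>\<close> and every other special orbit at least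
  \<open>2 \<bar>H\<bar> / 3\<close>. So there are at most two special orbits, and at most one of them consists of cusps.
  In particular a group of odd order fixes a point.
\<close>
theorem finite_subgroup_cases:
  assumes H: "subgroup H \<Gamma>" and fin: "finite H" and nontriv: "H \<noteq> {id}"
  obtains
    (fixed) p where "\<And>h. h \<in> H \<Longrightarrow> h p = p"
  | (pair) q where "card (orb H q) = 2" "card (unip H q) = 1" "card (stab H q) \<ge> 3"
  | (linear) e where "linear_type H e"
proof -
  define S where "S = special H"
  define k e N where "k p = card (stab H p)" and "e p = card (unip H p)" and "N p = card (orb H p)" for p
  define f where "f q = int ((k q - 1) + (e q - 1))" for q
  define W where "W p = int (card H) + int (N p) * (int (e p) - 2)" for p
  let ?h = "int (card H)"
  note defs = S_def k_def e_def N_def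
  have finS: "finite S" using finite_special[OF H fin] by (simp add: S_def)
  have e0: "e p > 0" and k0: "k p > 0" for p
    using card_unip_gt_0[OF H fin] card_stab_gt_0[OF H fin] by (auto simp: defs)
  have finorb: "finite (orb H p)" for p using fin by (simp add: orb_def)
  have N0: "N p > 0" for p
    using mem_orb_self[OF H, of p] finorb by (auto simp: N_def card_gt_0_iff)
  have hkN: "card H = k p * N p" for p using card_orbit_stabiliser[OF H fin] by (simp add: defs)
  have f_nonneg: "f q \<ge> 0" for q by (simp add: f_def)
  have h2: "?h \<ge> 2"
  proof -
    have "\<not> H \<subseteq> {id}" using nontriv subgroupD(2)[OF H] by blast
    then obtain g where "g \<in> H" "g \<noteq> id" by blast
    then have "card {id, g} \<le> card H" using subgroupD(2)[OF H] fin by (intro card_mono) auto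
    then show ?thesis using \<open>g \<noteq> id\<close> by (simp add: card_insert_if split: if_splits)
  qed
  have total: "sum f S = 2 * ?h - 2"
  proof -
    have "sum f S = int (\<Sum>p\<in>S. (k p - 1) + (e p - 1))" by (simp add: f_def)
    also have "\<dots> = int (2 * (card H - 1))" unfolding defs using fixed_point_count[OF H fin] by simp
    finally show ?thesis using h2 by simp
  qed
  have Wsum: "sum f (orb H p) = W p" for p
    unfolding f_def W_def defs by (rule orb_weight[OF H fin])
  have orbS: "orb H p \<subseteq> S" if "p \<in> S" for p using special_orb[OF H] that by (auto simp: S_def)
  have W_cusp: "W p \<ge> ?h" if "e p \<noteq> 1" for p
    using that e0[of p] N0[of p] by (simp add: W_def)
  have cusp_iff: "p \<in> cusps H \<longleftrightarrow> e p \<noteq> 1" for p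
    using cusps_iff[OF H fin, of p] e0[of p] by (simp add: e_def) linarith
  have k3: "k p \<ge> 3" if "p \<in> S" "e p = 1" for p
    using card_stab_ge_3[OF H fin] that cusp_iff by (simp add: defs)
  have W_noncusp: "W p = ?h - int (N p)" if "e p = 1" for p using that by (simp add: W_def)
  have N3: "3 * int (N p) \<le> ?h" if "p \<in> S" "e p = 1" for p
  proof -
    have "3 * N p \<le> k p * N p" using k3[OF that] by (intro mult_right_mono) auto
    then show ?thesis using hkN[of p] by linarith
  qed
  have W23: "3 * W p \<ge> 2 * ?h" if "p \<in> S" for p
    using N3[OF that] W_noncusp[of p] W_cusp[of p] h2 by (cases "e p = 1") auto
  have one: "W p = 2 * ?h - 2" if "p \<in> S" "orb H p = S" for p
    using Wsum[of p] total that by simp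
  have disj: "orb H p \<inter> orb H q = {}" if "q \<notin> orb H p" for p q using orb_disjoint[OF H that] .
  have two_sum: "sum f (orb H p \<union> orb H q) = W p + W q" if "q \<notin> orb H p" for p q
    using sum.union_disjoint[OF finorb finorb disj[OF that], of f] Wsum by simp
  have three: "W p + W q + W r \<le> 2 * ?h - 2"
    if "p \<in> S" "q \<in> S" "r \<in> S" "q \<notin> orb H p" "r \<notin> orb H p \<union> orb H q" for p q r
  proof -
    have "sum f ((orb H p \<union> orb H q) \<union> orb H r) = W p + W q + W r"
      using two_sum[OF that(4)] Wsum[of r] disj[of r p] disj[of r q] that(5) finorb
      by (subst sum.union_disjoint) auto
    moreover have "sum f ((orb H p \<union> orb H q) \<union> orb H r) \<le> sum f S"
      using orbS that(1-3) f_nonneg finS by (intro sum_mono2) auto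
    ultimately show ?thesis using total by simp
  qed
  \<comment> \<open>Two orbits whose weights leave no room for a third exhaust the special points.\<close>
  have two: "S = orb H p \<union> orb H q \<and> W p + W q = 2 * ?h - 2"
    if p: "p \<in> S" and q: "q \<in> S" "q \<notin> orb H p"
      and no3: "\<And>r. r \<in> S \<Longrightarrow> W p + W q + W r > 2 * ?h - 2" for p q
  proof -
    have "S \<subseteq> orb H p \<union> orb H q"
    proof
      fix r assume r: "r \<in> S"
      show "r \<in> orb H p \<union> orb H q"
      proof (rule ccontr)
        assume "r \<notin> orb H p \<union> orb H q"
        then show False using three[OF p q(1) r q(2)] no3[OF r] by simp
      qed
    qed
    then have "S = orb H p \<union> orb H q" using orbS p q by blast
    then show ?thesis using two_sum[OF q(2)] total by metis
  qed
  have fixed': thesis if "N p = 1" for p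
    by (rule fixed, rule orb_eq_self_imp_fixed[OF H fin]) (use that in \<open>simp_all add: N_def\<close>)
  show thesis
  proof (cases "\<exists>p\<in>S. e p \<noteq> 1")
    case False
    then have e1: "e p = 1" if "p \<in> S" for p using that by blast
    obtain g where g: "g \<in> H" "g \<noteq> id" using nontriv subgroupD(2)[OF H] by blast
    then obtain p where "g p = p" using ex_fixed_point subgroupD(1)[OF H] by blast
    then have p: "p \<in> S" using g by (auto simp: S_def special_def)
    have "orb H p \<noteq> S" using one[OF p] W_noncusp[OF e1[OF p]] h2 N0[of p] by auto
    then obtain q where q: "q \<in> S" "q \<notin> orb H p" using orbS[OF p] by blast
    have "W p + W q = 2 * ?h - 2"
    proof -
      have "W p + W q + W r > 2 * ?h - 2" if "r \<in> S" for r
        using W23[OF p] W23[OF q(1)] W23[OF that] by linarith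
      then show ?thesis using two[OF p q] by blast
    qed
    then have "N p = 1" using W_noncusp[OF e1[OF p]] W_noncusp[OF e1[OF q(1)]] N0[of p] N0[of q] by linarith
    then show thesis by (rule fixed')
  next
    case True
    then obtain p where p: "p \<in> S" "e p \<noteq> 1" by blast
    have cusp: "p \<in> cusps H" using p cusp_iff by simp
    obtain w c where w: "k p = e p * w" and c: "e p - 1 = w * c"
      using card_stab_cusp[OF H fin cusp] by (auto simp: defs)
    have ev: "even (e p)" using even_card_unip[OF H fin cusp] by (simp add: e_def)
    have w0: "w > 0" using w k0[of p] by (cases w) auto
    have hN: "?h = int (N p) * (int (e p) * int w)"
      using hkN[of p] w by (metis mult.commute of_nat_mult)
    show thesis
    proof (cases "orb H p = S")
      case True
      have e2: "int (e p) \<ge> 2" using p(2) e0[of p] by linarith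
      have "?h = int (N p) * (int (e p) - 2) + 2" using one[OF p(1) True] by (simp add: W_def)
      then have eq: "int (N p) * (int (e p) * int w - int (e p) + 2) = 2"
        using hN by (simp add: algebra_simps)
      have "w = 1"
      proof (rule ccontr)
        assume "w \<noteq> 1"
        then have "int w \<ge> 2" using w0 by linarith
        then have "int (e p) * int w \<ge> int (e p) * 2" using e2 by (intro mult_left_mono) auto
        then have "int (e p) * int w - int (e p) + 2 \<ge> 4" using e2 by linarith
        then have "1 * 4 \<le> int (N p) * (int (e p) * int w - int (e p) + 2)"
          using N0[of p] by (intro mult_mono) auto
        then show False using eq by simp
      qed
      then have "N p = 1" using eq by simp
      then show thesis by (rule fixed')
    next
      case False
      then obtain q where q: "q \<in> S" "q \<notin> orb H p" using orbS[OF p(1)] by blast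
      have Wp: "W p \<ge> ?h" using W_cusp p(2) .
      have SU: "S = orb H p \<union> orb H q" and sum2: "W p + W q = 2 * ?h - 2"
      proof -
        have "W p + W q + W r > 2 * ?h - 2" if "r \<in> S" for r
          using W23[OF q(1)] W23[OF that] Wp h2 by linarith
        then show "S = orb H p \<union> orb H q" "W p + W q = 2 * ?h - 2" using two[OF p(1) q] by blast+
      qed
      have eq1: "e q = 1"
      proof (rule ccontr)
        assume "e q \<noteq> 1" then show False using W_cusp[of q] Wp sum2 by linarith
      qed
      have Nq: "int (N q) = int (N p) * (int (e p) - 2) + 2"
        using sum2 W_noncusp[OF eq1] by (simp add: W_def)
      have "e p \<noteq> 3" using ev by auto
      then consider "e p = 2" | "e p \<ge> 4" using p(2) e0[of p] by linarith
      then show thesis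
      proof cases
        case 1
        then have "N q = 2" using Nq by simp
        then show thesis using pair[of q] eq1 k3[OF q(1) eq1] by (simp add: defs)
      next
        case 2
        show thesis
        proof (cases "N p = 1")
          case True then show thesis by (rule fixed')
        next
          case N1: False
          \<comment> \<open>A nontrivial unipotent element at \<open>p\<close> would fix the only other point of the orbit.\<close>
          have "N p \<noteq> 2"
          proof
            assume "N p = 2"
            then have "card (orb H p) = 2" by (simp add: N_def)
            then obtain x y where xy: "orb H p = {x, y}" "x \<noteq> y" by (auto simp: card_2_iff)
            then obtain p' where p': "orb H p = {p, p'}" "p' \<noteq> p"
              using mem_orb_self[OF H, of p] by auto
            obtain u where u: "u \<in> unip H p" "u \<noteq> id" using cusp by (auto simp: cusps_def)
            have uH: "u \<in> H" "u p = p" using unipD(1,2)[OF u(1)] .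
            have "u p' \<in> orb H p'" using uH(1) by (auto simp: orb_def)
            then have "u p' \<in> {p, p'}" using orb_trans[OF H, of p' p] p'(1) by auto
            moreover have "u p' \<noteq> p"
              using uH P_bij[OF subgroupD(1)[OF H uH(1)]] p'(2) by (metis bij_pointE)
            ultimately show False using unipD(3)[OF u(1), of p'] p'(2) u(2) by blast
          qed
          then have N3': "int (N p) \<ge> 3" using N1 N0[of p] by linarith
          have kq: "int (k q) * (int (N p) * (int (e p) - 2) + 2) = int (N p) * int (e p) * int w"
            using hkN[of q] hN Nq by (metis mult.assoc of_nat_mult)
          have e4: "int (e p) \<ge> 4" using 2 by linarith
          have wc: "int (e p) - 1 = int w * int c"
            using c 2 by (metis One_nat_def le_trans numeral_le_iff of_nat_1 of_nat_diff of_nat_mult one_le_numeral)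
          have w0': "int w > 0" using w0 by simp
          note par = sl2_parameters[OF N3' e4 w0' wc kq]
          have "int c dvd 2"
          proof -
            have "int c dvd int (e p) - 1" "int c dvd int (e p) + 1"
              using wc par(1) by (metis dvd_triv_right, metis dvd_triv_left)
            then have "int c dvd (int (e p) + 1) - (int (e p) - 1)" by (rule dvd_diff[rotated])
            then show ?thesis by simp
          qed
          \<comment> \<open>Since \<open>e\<close> is even, so that \<open>w c = e - 1\<close> is odd, this forces \<open>c = 1\<close>.\<close>
          then have "c dvd 2" by presburger
          then have "c \<le> 2" "c \<noteq> 0"
            by (auto dest: dvd_imp_le) (metis dvd_0_left_iff zero_neq_numeral neq0_conv)
          moreover have "odd (w * c)"
            unfolding c[symmetric] using ev 2 by (metis Suc_diff_1 even_Suc less_le_trans zero_less_numeral)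
          ultimately have c1: "c = 1" by (cases "c = 2") auto
          have k_q: "k q = e p + 1" using par(1) c1 by simp
          have N_p: "N p = e p + 1" using par(2) by simp
          have w_p: "w = e p - 1" using c c1 by simp
          have cusps_orb: "cusps H = orb H p"
          proof
            show "orb H p \<subseteq> cusps H"
              using cusp_iff card_unip_orb[OF H] p(2) by (auto simp: e_def)
            show "cusps H \<subseteq> orb H p"
            proof
              fix r assume r: "r \<in> cusps H"
              then have "r \<in> S" unfolding S_def by (rule subsetD[OF cusps_subset_special])
              moreover have "r \<notin> orb H q"
                using card_unip_orb[OF H, of r q] eq1 r cusp_iff by (auto simp: e_def)
              ultimately show "r \<in> orb H p" using SU by blast
            qed
          qed
          have rest: "special H - cusps H = orb H q"
            using SU disj[OF q(2)] cusps_orb by (auto simp: S_def)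
          have "N q = (e p) * (e p - 1)"
          proof -
            have "int (N q) = int (e p) * (int (e p) - 1)"
              using Nq N_p by (simp add: algebra_simps)
            also have "\<dots> = int ((e p) * (e p - 1))" using 2 by (simp add: of_nat_diff)
            finally show ?thesis by linarith
          qed
          moreover have "card H = (e p + 1) * (e p * (e p - 1))"
            using hkN[of p] w w_p N_p by (simp add: mult_ac)
          ultimately have "linear_type H (e p)"
            unfolding linear_type_def rest
            unfolding cusps_orb
            using H fin 2 ev N_p k_q w w_p card_unip_orb[OF H, of _ p] card_stab_orb[OF H fin, of _ p]
              card_stab_orb[OF H fin, of _ q] by (auto simp: defs)
          then show thesis by (rule linear)
        qed
      qed
    qed
  qed
qed

end

section \<open>Maximal and normal subgroups of groups of linear type\<close>

context one_or_two_fixed_points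
begin

context
  fixes H e
  assumes lt: "linear_type H e"
begin

lemma linD:
  "subgroup H \<Gamma>" "finite H" "4 \<le> e" "even e" "card H = (e + 1) * (e * (e - 1))"
  "card (cusps H) = e + 1"
  "p \<in> cusps H \<Longrightarrow> card (unip H p) = e" "p \<in> cusps H \<Longrightarrow> card (stab H p) = e * (e - 1)"
  "card (special H - cusps H) = e * (e - 1)"
  "p \<in> special H \<Longrightarrow> p \<notin> cusps H \<Longrightarrow> card (stab H p) = e + 1"
  using lt unfolding linear_type_def by auto

lemma linear_in_P: "h \<in> H \<Longrightarrow> h \<in> P"
  using subgroupD(1)[OF linD(1)] .

lemma e_bounds: "e * (e - 1) \<ge> 12"
proof -
  have "4 * 3 \<le> e * (e - 1)" using linD(3) by (intro mult_mono) auto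
  then show ?thesis by simp
qed

lemma finite_cusps: "finite (cusps H)"
  using linD(6) by (intro card_ge_0_finite) simp

lemma ex_cusp: obtains p where "p \<in> cusps H"
  using linD(6) by (metis card.empty equals0I add_is_0 one_neq_zero)

lemma cusps_orb_iff: "q \<in> orb H p \<Longrightarrow> q \<in> cusps H \<longleftrightarrow> p \<in> cusps H"
  using card_unip_orb[OF linD(1)] cusps_iff[OF linD(1,2)] by simp

lemma orb_cusp: assumes p: "p \<in> cusps H" shows "orb H p = cusps H"
proof (rule card_subset_eq[OF finite_cusps])
  show "orb H p \<subseteq> cusps H" using cusps_orb_iff p by blast
  have "(e * (e - 1)) * card (orb H p) = (e * (e - 1)) * (e + 1)"
    using card_orbit_stabiliser[OF linD(1,2), of p] unfolding linD(5) linD(8)[OF p]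
    by (metis mult.commute)
  moreover have "e * (e - 1) > 0" using e_bounds by linarith
  ultimately have "card (orb H p) = e + 1" using nat_mult_eq_cancel1 by blast
  then show "card (orb H p) = card (cusps H)" using linD(6) by simp
qed

lemma orb_noncusp:
  assumes p: "p \<in> special H" "p \<notin> cusps H" shows "orb H p = special H - cusps H"
proof (rule card_subset_eq)
  show "finite (special H - cusps H)" using finite_special[OF linD(1,2)] by simp
  show "orb H p \<subseteq> special H - cusps H" using cusps_orb_iff special_orb[OF linD(1)] p by blast
  have "(e + 1) * card (orb H p) = (e + 1) * (e * (e - 1))"
    using card_orbit_stabiliser[OF linD(1,2), of p] linD(5) linD(10)[OF p] by (simp add: mult_ac)
  then have "card (orb H p) = e * (e - 1)" using mult_cancel1[of "e + 1"] by simp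
  then show "card (orb H p) = card (special H - cusps H)" using linD(9) by simp
qed

lemma card_orb_ge_3:
  assumes "p \<in> special H" shows "card (orb H p) \<ge> 3"
proof (cases "p \<in> cusps H")
  case True then show ?thesis using orb_cusp linD(3,6) by simp
next
  case False then show ?thesis using orb_noncusp[OF assms False] linD(9) e_bounds by simp
qed

lemma stab_not_special: "p \<notin> special H \<Longrightarrow> stab H p = {id}"
  using subgroupD(2)[OF linD(1)] unfolding special_def stab_def by auto

lemma stab_neq: "stab H p \<noteq> H"
proof
  assume eq: "stab H p = H"
  have large: "card H \<ge> 5 * 12" unfolding linD(5) using e_bounds linD(3) by (intro mult_mono) auto
  then have "H \<noteq> {id}" by auto
  then have "p \<in> special H" using eq stab_not_special by blast
  moreover have "orb H p \<subseteq> {p}" using eq by (auto simp: orb_def stab_def)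
  then have "card (orb H p) \<le> 1" using card_mono[of "{p}"] by simp
  ultimately show False using card_orb_ge_3 by fastforce
qed

text \<open>
  The unipotent subgroup acts freely on the remaining cusps and has the same cardinality, so it acts
  regularly on them.
\<close>
lemma unip_transitive:
  assumes p: "p \<in> cusps H" and q: "q \<in> cusps H" "q \<noteq> p" and r: "r \<in> cusps H" "r \<noteq> p"
  obtains u where "u \<in> unip H p" "u q = r"
proof -
  have "(\<lambda>u. u q) ` unip H p = cusps H - {p}"
  proof (rule card_subset_eq)
    show "(\<lambda>u. u q) ` unip H p \<subseteq> cusps H - {p}"
    proof clarify
      fix u assume u: "u \<in> unip H p"
      have "u q \<in> cusps H" using orb_cusp[OF q(1)] unipD(1)[OF u] by (auto simp: orb_def)
      moreover have "u q \<noteq> p" using unipD(2)[OF u] P_bij[OF linear_in_P[OF unipD(1)[OF u]]] q(2) by (metis bij_pointE)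
      ultimately show "u q \<in> cusps H - {p}" by simp
    qed
    have "inj_on (\<lambda>u. u q) (unip H p)"
    proof (rule inj_onI)
      fix u v assume uv: "u \<in> unip H p" "v \<in> unip H p" "u q = v q"
      have vP: "v \<in> P" using linear_in_P[OF unipD(1)[OF uv(2)]] .
      note U = subgroup_unip[OF linD(1), of p]
      have "finv v \<circ> u \<in> unip H p" by (rule subgroupD(3)[OF U subgroupD(4)[OF U uv(2)] uv(1)])
      moreover have "(finv v \<circ> u) q = q" using uv(3) P_inv_apply(1)[OF vP] by simp
      ultimately have "finv v \<circ> u = id" using unipD(3)[of "finv v \<circ> u" H p q] q(2) by blast
      then have "v \<circ> (finv v \<circ> u) = v" by simp
      then show "u = v" using P_inv_comp(2)[OF vP] by (simp add: comp_assoc[symmetric])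
    qed
    then show "card ((\<lambda>u. u q) ` unip H p) = card (cusps H - {p})"
      using linD(6) linD(7)[OF p] p finite_cusps by (simp add: card_image)
  qed (use finite_cusps in simp)
  then have "r \<in> (\<lambda>u. u q) ` unip H p" using r by blast
  then show thesis using that by blast
qed

text \<open>
  Some \<open>g\<close> takes \<open>p\<close> to \<open>q\<close>; a unipotent element at \<open>q\<close> then corrects the image of \<open>q\<close>.
\<close>
lemma swap_cusps:
  assumes p: "p \<in> cusps H" and q: "q \<in> cusps H" "q \<noteq> p"
  obtains s where "s \<in> H" "s p = q" "s q = p"
proof -
  obtain g where g: "g \<in> H" "q = g p" using orb_cusp[OF p] q(1) by (auto simp: orb_def)
  have gq: "g q \<in> cusps H" "g q \<noteq> q"
  proof -
    show "g q \<in> cusps H" using orb_cusp[OF q(1)] g(1) by (auto simp: orb_def)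
    show "g q \<noteq> q" using g q(2) P_bij[OF linear_in_P[OF g(1)]] by (metis bij_pointE)
  qed
  obtain u where u: "u \<in> unip H q" "u (g q) = p"
    using unip_transitive[OF q(1) gq p q(2)[symmetric]] .
  have "u \<circ> g \<in> H" using subgroupD(3)[OF linD(1) unipD(1)[OF u(1)] g(1)] .
  moreover have "(u \<circ> g) p = q" using g(2) unipD(2)[OF u(1)] by simp
  ultimately show thesis using that u(2) by force
qed

lemma card_two_cusp_stab:
  assumes p: "p \<in> cusps H" and q: "q \<in> cusps H" "q \<noteq> p"
  shows "card (stab (stab H p) q) = e - 1"
proof -
  note B = subgroup_stab[OF linD(1), of p]
  have fB: "finite (stab H p)" using linD(2) by (simp add: stab_def)
  have "orb (stab H p) q = cusps H - {p}"
  proof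
    show "orb (stab H p) q \<subseteq> cusps H - {p}"
    proof
      fix r assume "r \<in> orb (stab H p) q"
      then obtain h where h: "h \<in> H" "h p = p" "r = h q" by (auto simp: orb_def stab_def)
      have "r \<in> cusps H" using h orb_cusp[OF q(1)] by (auto simp: orb_def)
      moreover have "r \<noteq> p" using h q(2) P_bij[OF linear_in_P[OF h(1)]] by (metis bij_pointE)
      ultimately show "r \<in> cusps H - {p}" by simp
    qed
    show "cusps H - {p} \<subseteq> orb (stab H p) q"
    proof
      fix r assume r: "r \<in> cusps H - {p}"
      obtain u where u: "u \<in> unip H p" "u q = r" using unip_transitive[OF p q] r by blast
      have "u \<in> stab H p" by (rule subsetD[OF unip_subset_stab u(1)])
      then show "r \<in> orb (stab H p) q" using u(2) by (auto simp: orb_def)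
    qed
  qed
  then have "card (orb (stab H p) q) = e" using linD(6) p finite_cusps by simp
  then have "e * (e - 1) = card (stab (stab H p) q) * e"
    using card_orbit_stabiliser[OF B fB, of q] linD(8)[OF p] by simp
  then show ?thesis using linD(3) by (simp add: mult.commute)
qed

text \<open>
  At a special point \<open>p\<close> that is not a cusp the stabiliser is abelian, so it preserves the fixed
  points \<open>{p, q}\<close> of any of its nontrivial elements. The point \<open>q\<close> cannot be a cusp, as \<open>e + 1\<close> does
  not divide \<open>e (e - 1)\<close>; hence it lies in the orbit of \<open>p\<close>.
\<close>
lemma noncusp_partner:
  assumes p: "p \<in> special H" "p \<notin> cusps H"
  obtains q s where "q \<noteq> p" "stab H p = stab H q" "s \<in> H" "s p = q" "s q = p"
proof -
  note B = subgroup_stab[OF linD(1)]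
  have stabP: "stab H p \<subseteq> stab P p" using linear_in_P by (auto simp: stab_def)
  obtain g where g: "g \<in> H" "g \<noteq> id" "g p = p" using p(1) by (auto simp: special_def)
  then have "g \<notin> unip H p" using p(2) by (auto simp: cusps_def)
  then obtain q where q: "g q = q" "q \<noteq> p" using g unipI[of g H p] by blast
  have gs: "g \<in> stab H p" using g by (simp add: stab_def)
  have fixg: "r = p \<or> r = q" if "g r = r" for r
    using three_fixed_points[OF linear_in_P[OF g(1)] g(3) q(1) that] q(2) g(2) by metis
  have sub: "stab H p \<subseteq> stab H q"
  proof
    fix h assume h: "h \<in> stab H p"
    have hP: "h \<in> P" and hp: "h p = p" and hH: "h \<in> H" using h linear_in_P by (auto simp: stab_def)
    have "h \<circ> g \<circ> finv h \<circ> finv g \<in> unip P p" using commutator_unip h gs stabP by blast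
    moreover have hgH: "h \<circ> g \<circ> finv h \<circ> finv g \<in> H"
      using hH g(1) subgroupD(3,4)[OF linD(1)] by simp
    ultimately have "h \<circ> g \<circ> finv h \<circ> finv g \<in> unip H p"
      by (intro unipI[OF hgH]) (auto dest: unipD)
    then have c: "h \<circ> g \<circ> finv h \<circ> finv g = id" using p(2) unfolding cusps_def by blast
    have "h (g x) = g (h x)" for x
      using fun_cong[OF c, of "g (h x)"] P_inv_apply(1)[OF hP] P_inv_apply(1)[OF linear_in_P[OF g(1)]] by simp
    then have "g (h q) = h q" using q(1) by metis
    moreover have "h q \<noteq> p" using hp q(2) P_bij[OF hP] by (metis bij_pointE)
    ultimately have "h q = q" using fixg by blast
    then show "h \<in> stab H q" using hH by (simp add: stab_def)
  qed
  have qs: "q \<in> special H" using g(1,2) q(1) by (auto simp: special_def)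
  have qc: "q \<notin> cusps H"
  proof
    assume "q \<in> cusps H"
    then have "e + 1 dvd e * (e - 1)"
      using card_subgroup_dvd[OF B B sub] linD(8)[of q] linD(10)[OF p] by simp
    moreover have "e * (e - 1) = (e + 1) * (e - 2) + 2"
    proof -
      obtain k where "e = k + 2" using linD(3) by (metis add.commute le_Suc_ex numeral_Bit0 add.assoc)
      then show ?thesis by (simp add: algebra_simps)
    qed
    ultimately have "e + 1 dvd 2" by (metis dvd_add_right_iff dvd_triv_left)
    then have "e + 1 \<le> 2" by (rule dvd_imp_le) simp
    then show False using linD(3) by simp
  qed
  have eq: "stab H p = stab H q"
    by (rule card_subset_eq[OF _ sub]) (use linD(2) linD(10)[OF p] linD(10)[OF qs qc] in \<open>simp_all add: stab_def\<close>)
  have "q \<in> orb H p" using orb_noncusp[OF p] qs qc by blast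
  then obtain s where s: "s \<in> H" "s p = q" by (auto simp: orb_def)
  have sP: "s \<in> P" using linear_in_P s by blast
  have "finv s \<circ> g \<circ> s \<in> stab H p"
    using s g q(1) subgroupD(3,4)[OF linD(1)] P_inv_apply(1)[OF sP, of p] by (simp add: stab_def)
  then have "finv s \<circ> g \<circ> s \<in> stab H q" using eq by blast
  then have "finv s (g (s q)) = q" by (simp add: stab_def)
  then have "g (s q) = s q" using P_inv_apply(2)[OF sP] by metis
  moreover have "s q \<noteq> q" using s(2) q(2) P_bij[OF sP] by (metis bij_pointE)
  ultimately have "s q = p" using fixg by blast
  then show thesis using that q(2) eq s by blast
qed

text \<open>
  The normaliser of a torus: the dihedral groups of order \<open>2 (e - 1)\<close> and \<open>2 (e + 1)\<close>.
\<close>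
definition pair_stab where
  "pair_stab p q = {h \<in> H. (h p = p \<and> h q = q) \<or> (h p = q \<and> h q = p)}"

lemma pair_stab_facts:
  assumes pq: "p \<noteq> q" and s: "s \<in> H" "s p = q" "s q = p"
  shows "subgroup (pair_stab p q) \<Gamma>" "card (pair_stab p q) = 2 * card (stab (stab H p) q)"
proof -
  have inv: "finv h \<in> pair_stab p q" if "h \<in> pair_stab p q" for h
  proof -
    have h: "h \<in> H" "finv h \<in> H" using that subgroupD(4)[OF linD(1)] by (auto simp: pair_stab_def)
    have "finv h (h p) = p" "finv h (h q) = q" using P_inv_apply(1)[OF linear_in_P[OF h(1)]] by blast+
    moreover have "(h p = p \<and> h q = q) \<or> (h p = q \<and> h q = p)"
      using that by (simp add: pair_stab_def)
    ultimately have "(finv h p = p \<and> finv h q = q) \<or> (finv h p = q \<and> finv h q = p)" by metis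
    then show ?thesis using h(2) by (simp add: pair_stab_def)
  qed
  show D: "subgroup (pair_stab p q) \<Gamma>"
    unfolding subgroup_iff
  proof (intro conjI ballI)
    show "g \<circ> h \<in> pair_stab p q" if "g \<in> pair_stab p q" "h \<in> pair_stab p q" for g h
      using that subgroupD(3)[OF linD(1)] by (auto simp: pair_stab_def)
  qed (use inv linear_in_P subgroupD(2)[OF linD(1)] in \<open>auto simp: pair_stab_def\<close>)
  have fin: "finite (pair_stab p q)" using linD(2) by (simp add: pair_stab_def)
  have "stab (pair_stab p q) p = stab (stab H p) q"
    using pq by (auto simp: stab_def pair_stab_def)
  moreover have "orb (pair_stab p q) p = {p, q}"
  proof
    show "orb (pair_stab p q) p \<subseteq> {p, q}" by (auto simp: orb_def pair_stab_def)
    have "s \<in> pair_stab p q" using s by (simp add: pair_stab_def)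
    then show "{p, q} \<subseteq> orb (pair_stab p q) p" using mem_orb_self[OF D, of p] s(2) by (auto simp: orb_def)
  qed
  ultimately show "card (pair_stab p q) = 2 * card (stab (stab H p) q)"
    using card_orbit_stabiliser[OF D fin, of p] pq by (simp add: mult.commute)
qed

lemma pair_stab_neq:
  assumes "p \<noteq> q" "s \<in> H" "s p = q" "s q = p" "card (stab (stab H p) q) \<le> e + 1"
  shows "pair_stab p q \<noteq> H"
proof
  assume "pair_stab p q = H"
  then have "card H \<le> 2 * (e + 1)" using pair_stab_facts(2)[OF assms(1-4)] assms(5) by simp
  moreover have "card H \<ge> (e + 1) * 12" unfolding linD(5) using e_bounds by (intro mult_left_mono) auto
  ultimately show False by simp
qed

lemma two_point_stab_normal:
  assumes pq: "p \<noteq> q" and S: "subgroup S \<Gamma>" "S \<subseteq> stab (stab H p) q"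
    and x: "x \<in> pair_stab p q" and s: "s \<in> S"
  shows "x \<circ> s \<circ> finv x \<in> S"
proof -
  have s': "s \<in> P" "s p = p" "s q = q" using S s linear_in_P by (auto simp: stab_def)
  have xP: "x \<in> P" using x linear_in_P by (auto simp: pair_stab_def)
  consider "x p = p" "x q = q" | "x p = q" "x q = p" using x by (auto simp: pair_stab_def)
  then show ?thesis
  proof cases
    case 1
    have "x \<circ> s \<circ> finv x \<circ> finv s \<in> unip P p"
      using commutator_unip[of x p s] s' xP 1 by (simp add: stab_def)
    moreover have "(x \<circ> s \<circ> finv x \<circ> finv s) q = q"
      using s'(3) 1(2) P_inv_apply(1)[OF s'(1), of q] P_inv_apply(1)[OF xP, of q] by simp
    ultimately have c: "x \<circ> s \<circ> finv x \<circ> finv s = id" using unipD(3) pq by metis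
    have "x \<circ> s \<circ> finv x = (x \<circ> s \<circ> finv x \<circ> finv s) \<circ> s"
      using P_inv_comp(1)[OF s'(1)] by (simp add: comp_assoc)
    then show ?thesis using c s by simp
  next
    case 2
    have "x \<circ> s \<circ> finv x = finv s"
      using swap_inverts[OF s'(1,2,3) pq xP 2(1,2)] .
    then show ?thesis using subgroupD(4)[OF S(1) s] by simp
  qed
qed

text \<open>
  By the trichotomy a maximal subgroup fixes a point, swaps two points or is again of linear type. In
  the first case it is the full stabiliser of a cusp, since the stabiliser of any other point is
  properly contained in a dihedral group; in the second case it is the full dihedral group.
\<close>
theorem maximal_of_linear_type:
  assumes mx: "maximal_in \<Gamma> M H" and t: "steps_to_one \<Gamma> t M"
  shows "(\<exists>e'. linear_type M e') \<or> bigomega (e - 1) < t \<or> bigomega (e + 1) < t"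
proof -
  interpret G: group \<Gamma> by (rule group_\<Gamma>)
  have M: "subgroup M \<Gamma>" and MH: "M \<subset> H"
    and between: "\<And>L. subgroup L \<Gamma> \<Longrightarrow> M \<subseteq> L \<Longrightarrow> L \<subseteq> H \<Longrightarrow> L \<noteq> H \<Longrightarrow> L = M"
    using mx unfolding maximal_in_def by blast+
  have finM: "finite M" using MH linD(2) finite_subset by blast
  have MP: "h \<in> P" if "h \<in> M" for h using that MH linear_in_P by blast
  have nontriv: "M \<noteq> {id}"
  proof
    assume M1: "M = {id}"
    obtain p where p: "p \<in> cusps H" by (rule ex_cusp)
    have "stab H p = M"
      by (rule between[OF subgroup_stab[OF linD(1)]])
        (use M1 stab_neq subgroupD(2)[OF linD(1)] in \<open>auto simp: stab_def\<close>)
    then show False using M1 linD(8)[OF p] e_bounds by simp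
  qed
  show ?thesis
  proof (rule finite_subgroup_cases[OF M finM nontriv])
    fix p assume fx: "\<And>h. h \<in> M \<Longrightarrow> h p = p"
    have Ms: "stab H p = M"
      by (rule between[OF subgroup_stab[OF linD(1)]]) (use stab_neq fx MH in \<open>auto simp: stab_def\<close>)
    have sp: "p \<in> special H" using stab_not_special nontriv Ms by blast
    show ?thesis
    proof (cases "p \<in> cusps H")
      case True
      have V: "subgroup (unip H p) \<Gamma>" using subgroup_unip[OF linD(1)] .
      have VM: "unip H p \<subseteq> M" unfolding Ms[symmetric] by (rule unip_subset_stab)
      have "unip H p \<noteq> {id}" using True by (auto simp: cusps_def)
      moreover have "bigomega (e - 1) + (if unip H p = {\<one>\<^bsub>\<Gamma>\<^esub>} then 0 else 1) \<le> t"
      proof (rule G.steps_ge_abelian_quotient[OF t finM V VM])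
        show "card M = (e - 1) * card (unip H p)"
          using linD(7)[OF True] linD(8)[OF True] Ms by simp
        fix x y assume xy: "x \<in> M" "y \<in> M"
        have "x \<circ> y \<circ> finv x \<circ> finv y \<in> unip P p"
          using commutator_unip[of x p y] xy fx MP by (simp add: stab_def)
        moreover have "x \<circ> y \<circ> finv x \<circ> finv y \<in> H"
          using xy MH subgroupD(3,4)[OF M] by (meson psubsetD)
        ultimately have "x \<circ> y \<circ> finv x \<circ> finv y \<in> unip H p" by (auto intro!: unipI dest: unipD)
        then show "x \<otimes>\<^bsub>\<Gamma>\<^esub> y \<otimes>\<^bsub>\<Gamma>\<^esub> inv\<^bsub>\<Gamma>\<^esub> x \<otimes>\<^bsub>\<Gamma>\<^esub> inv\<^bsub>\<Gamma>\<^esub> y \<in> unip H p"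
          using inv_\<Gamma> MP xy by simp
      qed
      ultimately show ?thesis by simp
    next
      case False
      obtain q s where qs: "q \<noteq> p" "stab H p = stab H q" "s \<in> H" "s p = q" "s q = p"
        using noncusp_partner[OF sp False] .
      have "stab (stab H p) q = stab H p" using qs(2) by (auto simp: stab_def)
      then have c: "card (stab (stab H p) q) = e + 1" using linD(10)[OF sp False] by simp
      have pq: "p \<noteq> q" using qs(1) by simp
      have "pair_stab p q = M"
      proof (rule between[OF pair_stab_facts(1)[OF pq qs(3-5)]])
        show "M \<subseteq> pair_stab p q" using Ms qs(2) by (auto simp: pair_stab_def stab_def)
        show "pair_stab p q \<noteq> H" using pair_stab_neq[OF pq qs(3-5)] c by simp
      qed (auto simp: pair_stab_def)
      moreover have "s \<in> pair_stab p q" using qs by (simp add: pair_stab_def)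
      ultimately have "s p = p" using fx by blast
      then show ?thesis using qs by simp
    qed
  next
    fix p assume orb2: "card (orb M p) = 2" and s3: "card (stab M p) \<ge> 3"
    obtain x y where "orb M p = {x, y}" "x \<noteq> y" using orb2 by (auto simp: card_2_iff)
    then obtain q where q: "orb M p = {p, q}" "q \<noteq> p" using mem_orb_self[OF M, of p] by auto
    have pq: "p \<noteq> q" using q(2) by simp
    have orbq: "orb M q = {p, q}" using orb_trans[OF M, of q p] q(1) by simp
    have Mpq: "m p \<in> {p, q}" "m q \<in> {p, q}" "m p \<noteq> m q" if "m \<in> M" for m
    proof -
      show "m p \<in> {p, q}" using q(1) that by (auto simp: orb_def)
      show "m q \<in> {p, q}" using orbq that by (auto simp: orb_def)
      show "m p \<noteq> m q" using pq P_bij[OF MP[OF that]] by (metis bij_pointE)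
    qed
    have "q \<in> orb M p" using q(1) by simp
    then obtain s where s: "s \<in> M" "s p = q" by (auto simp: orb_def)
    have s': "s \<in> H" "s p = q" "s q = p" using s MH Mpq[OF s(1)] by auto
    let ?T = "stab (stab H p) q" and ?D = "pair_stab p q"
    have "\<not> stab M p \<subseteq> {id}" using s3 card_mono[of "{id}" "stab M p"] by auto
    then obtain m where m: "m \<in> M" "m p = p" "m \<noteq> id" by (auto simp: stab_def)
    have mq: "m q = q" using Mpq[OF m(1)] m(2) by auto
    have sp: "p \<in> special H" using m MH by (auto simp: special_def)
    have T: "card ?T = e - 1 \<or> card ?T = e + 1"
    proof (cases "p \<in> cusps H")
      case True
      then have "q \<in> cusps H" using orb_cusp[OF True] s' by (auto simp: orb_def)
      then show ?thesis using card_two_cusp_stab[OF True _ q(2)] by blast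
    next
      case False
      obtain q' s'' where q': "q' \<noteq> p" "stab H p = stab H q'"
        using noncusp_partner[OF sp False] by metis
      have "m \<in> stab H q'" using m MH q'(2) by (auto simp: stab_def)
      then have "m q' = q'" by (simp add: stab_def)
      then have "q' = q" using three_fixed_points[OF MP[OF m(1)] m(2) mq] m(3) q(2) q'(1) by metis
      then have "?T = stab H p" using q'(2) by (auto simp: stab_def)
      then show ?thesis using linD(10)[OF sp False] by simp
    qed
    have D: "subgroup ?D \<Gamma>" by (rule pair_stab_facts(1)[OF pq s'])
    have "?D = M"
    proof (rule between[OF D])
      show "M \<subseteq> ?D"
      proof
        fix m assume m: "m \<in> M"
        then show "m \<in> ?D" using Mpq[OF m] MH by (simp add: pair_stab_def psubsetD) metis
      qed
      have "card ?T \<le> e + 1" using T by linarith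
      then show "?D \<noteq> H" by (rule pair_stab_neq[OF pq s'])
    qed (auto simp: pair_stab_def)
    have sT: "subgroup ?T \<Gamma>" using subgroup_stab linD(1) by blast
    have TM: "?T \<subseteq> M" unfolding \<open>?D = M\<close>[symmetric] by (auto simp: pair_stab_def stab_def)
    have "?T \<noteq> M" using s pq by (auto simp: stab_def)
    moreover have "bigomega (card ?T) + (if ?T = M then 0 else 1) \<le> t"
    proof (rule G.steps_ge_hereditarily_normal[OF t finM sT TM])
      fix S x u assume a: "subgroup S \<Gamma>" "S \<subseteq> ?T" "x \<in> M" "u \<in> S"
      have "x \<circ> u \<circ> finv x \<in> S"
        by (rule two_point_stab_normal[OF pq a(1,2) _ a(4)]) (use a(3) \<open>?D = M\<close> in blast)
      then show "x \<otimes>\<^bsub>\<Gamma>\<^esub> u \<otimes>\<^bsub>\<Gamma>\<^esub> inv\<^bsub>\<Gamma>\<^esub> x \<in> S" using inv_\<Gamma> MP a(3) by simp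
    qed
    ultimately show ?thesis using T by auto
  next
    fix e' assume "linear_type M e'"
    then show ?thesis by blast
  qed
qed

text \<open>
  The trichotomy for \<open>N\<close>, in a form that the whole group has to respect. A fixed point of \<open>N\<close> has an
  orbit of at least three points under \<open>H\<close>, all fixed by \<open>N\<close>. If \<open>N\<close> swaps two points, then its
  orbits of size two have stabilisers of index two that meet trivially for different orbits, so
  there is only one such orbit, and \<open>H\<close> would preserve it. Finally the cusps of \<open>N\<close> are
  permuted by \<open>H\<close>, hence are all cusps of \<open>H\<close>, and comparing orders gives \<open>N = H\<close>.
\<close>
theorem normal_subgroup_of_linear_type:
  assumes N: "subgroup N \<Gamma>" "N \<subseteq> H" and nrm: "\<And>h n. h \<in> H \<Longrightarrow> n \<in> N \<Longrightarrow> h \<circ> n \<circ> finv h \<in> N"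
    and nontriv: "N \<noteq> {id}"
  shows "N = H"
proof -
  interpret G: group \<Gamma> by (rule group_\<Gamma>)
  have finN: "finite N" using N(2) linD(2) finite_subset by blast
  have nrm': "finv h \<circ> n \<circ> h \<in> N" if "h \<in> H" "n \<in> N" for h n
  proof -
    have "finv (finv h) = h" using P_bij[OF linear_in_P[OF that(1)]] by (simp add: inv_inv_eq)
    then show ?thesis using nrm[OF subgroupD(4)[OF linD(1) that(1)] that(2)] by simp
  qed
  show ?thesis
  proof (rule finite_subgroup_cases[OF N(1) finN nontriv])
    fix p assume fx: "\<And>h. h \<in> N \<Longrightarrow> h p = p"
    obtain n where n: "n \<in> N" "n \<noteq> id" using nontriv subgroupD(2)[OF N(1)] by blast
    have "p \<in> special H" using n N(2) fx by (auto simp: special_def)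
    then have 3: "card (orb H p) \<ge> 3" by (rule card_orb_ge_3)
    have "orb H p \<subseteq> {q. n q = q}"
    proof
      fix q assume "q \<in> orb H p"
      then obtain h where h: "h \<in> H" "q = h p" by (auto simp: orb_def)
      have "finv h (n (h p)) = p" using fx[OF nrm'[OF h(1) n(1)]] by simp
      then have "n q = q" using h(2) P_inv_apply(2)[OF linear_in_P[OF h(1)]] by metis
      then show "q \<in> {q. n q = q}" by simp
    qed
    moreover have "finite {q. n q = q} \<and> card {q. n q = q} \<le> 2"
      by (rule fixed_points_cases[of n]) (use n linear_in_P N(2) in \<open>auto simp: card_insert_if\<close>)
    ultimately have "card (orb H p) \<le> 2" using card_mono by (meson le_trans)
    then show ?thesis using 3 by simp
  next
    fix p assume orb2: "card (orb N p) = 2" and s3: "card (stab N p) \<ge> 3"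
    obtain x y where "orb N p = {x, y}" "x \<noteq> y" using orb2 by (auto simp: card_2_iff)
    then obtain q where q: "orb N p = {p, q}" "q \<noteq> p" using mem_orb_self[OF N(1), of p] by auto
    have orbq: "orb N q = {p, q}" using orb_trans[OF N(1), of q p] q(1) by simp
    have fixq: "m q = q" if "m \<in> stab N p" for m
    proof -
      have "m q \<in> orb N q" using that by (auto simp: orb_def stab_def)
      moreover have "m q \<noteq> p"
        using that q(2) P_bij[OF linear_in_P] N(2) by (auto simp: stab_def) (metis bij_pointE subsetD)
      ultimately show ?thesis using orbq by auto
    qed
    have cN: "card N = 2 * card (stab N p)"
      using card_orbit_stabiliser[OF N(1) finN, of p] orb2 by simp
    have "orb H p \<subseteq> orb N p"
    proof
      fix r assume "r \<in> orb H p"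
      then obtain h where h: "h \<in> H" "r = h p" by (auto simp: orb_def)
      show "r \<in> orb N p"
      proof (rule ccontr)
        assume r: "r \<notin> orb N p"
        have hP: "h \<in> P" using linear_in_P h(1) .
        have "orb N r = h ` orb N p"
        proof
          show "orb N r \<subseteq> h ` orb N p"
          proof
            fix z assume "z \<in> orb N r"
            then obtain n where n: "n \<in> N" "z = n (h p)" using h(2) by (auto simp: orb_def)
            have "z = h ((finv h \<circ> n \<circ> h) p)" using n(2) P_inv_apply(2)[OF hP] by simp
            then show "z \<in> h ` orb N p" using nrm'[OF h(1) n(1)] unfolding orb_def by blast
          qed
          show "h ` orb N p \<subseteq> orb N r"
          proof
            fix z assume "z \<in> h ` orb N p"
            then obtain n where n: "n \<in> N" "z = h (n p)" by (auto simp: orb_def)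
            have "z = (h \<circ> n \<circ> finv h) r" using n(2) h(2) P_inv_apply(1)[OF hP] by simp
            then show "z \<in> orb N r" using nrm[OF h(1) n(1)] unfolding orb_def by blast
          qed
        qed
        moreover have "inj_on h (orb N p)" using P_bij[OF hP] by (meson bij_is_inj inj_on_subset subset_UNIV)
        ultimately have "card (orb N r) = 2" using orb2 by (simp add: card_image)
        then have cr: "card (stab N r) = card (stab N p)"
          using card_orbit_stabiliser[OF N(1) finN, of r] cN by simp
        note sub = subgroup_stab[OF N(1)]
        have fs: "finite (stab N z)" for z using finN by (simp add: stab_def)
        have "stab N p \<inter> stab N r = {id}"
        proof -
          have "m = id" if m: "m \<in> stab N p" "m \<in> stab N r" for m
            using three_fixed_points[of m p q r] fixq[OF m(1)] m r q linear_in_P N(2) by (auto simp: stab_def)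
          then show ?thesis using subgroupD(2)[OF sub] by blast
        qed
        then have "card (stab N p <#>\<^bsub>\<Gamma>\<^esub> stab N r) = card (stab N p) * card (stab N p)"
          using G.card_set_mult_subgroups[OF sub sub fs fs, of p r] cr by simp
        moreover have "stab N p <#>\<^bsub>\<Gamma>\<^esub> stab N r \<subseteq> N"
          using subgroupD(3)[OF N(1)] by (auto simp: set_mult_def stab_def)
        then have "card (stab N p <#>\<^bsub>\<Gamma>\<^esub> stab N r) \<le> card N" using finN card_mono by blast
        ultimately have "card (stab N p) * card (stab N p) \<le> 2 * card (stab N p)" using cN by simp
        then show False using s3 by simp
      qed
    qed
    then have "card (orb H p) \<le> 2" using orb2 q(1) by (metis card_mono finite.emptyI finite.insertI)
    moreover have "\<not> stab N p \<subseteq> {id}" using s3 card_mono[of "{id}" "stab N p"] by auto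
    then have "p \<in> special H" using N(2) by (auto simp: special_def stab_def)
    ultimately show ?thesis using card_orb_ge_3 by fastforce
  next
    fix e' assume lt': "linear_type N e'"
    then have N': "card (cusps N) = e' + 1" "card N = (e' + 1) * (e' * (e' - 1))"
      by (auto simp: linear_type_def)
    obtain p where p: "p \<in> cusps N" using N'(1) by (metis card.empty equals0I add_is_0 one_neq_zero)
    have unipN: "unip N p \<subseteq> unip H p" for p using N(2) unfolding unip_def by blast
    have cuspsN: "cusps N \<subseteq> cusps H" using unipN unfolding cusps_def by blast
    have "cusps H \<subseteq> cusps N"
    proof
      fix r assume "r \<in> cusps H"
      then have "r \<in> orb H p" using orb_cusp p cuspsN by blast
      then obtain h where h: "h \<in> H" "r = h p" by (auto simp: orb_def)
      obtain u where u: "u \<in> unip N p" "u \<noteq> id" using p by (auto simp: cusps_def)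
      have uH: "u \<in> unip H p" using u(1) unipN by blast
      have "h \<circ> u \<circ> finv h \<in> unip H r" using conj_unip[OF linD(1) h(1) uH] h(2) by simp
      moreover have "h \<circ> u \<circ> finv h \<in> N" using nrm[OF h(1) unipD(1)[OF u(1)]] .
      ultimately have "h \<circ> u \<circ> finv h \<in> unip N r" by (auto intro!: unipI dest: unipD)
      moreover have "h \<circ> u \<circ> finv h \<noteq> id"
        using conj_eq_id_iff[OF linear_in_P[OF h(1)], of u] u(2) linear_in_P unipD(1)[OF uH] by blast
      ultimately show "r \<in> cusps N" by (auto simp: cusps_def)
    qed
    then have "cusps N = cusps H" using cuspsN by blast
    then have "e' = e" using N'(1) linD(6) by simp
    then show "N = H" using card_subset_eq[OF linD(2) N(2)] N'(2) linD(5) by simp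
  qed
qed

lemma linear_type_not_commutative:
  obtains g h where "g \<in> H" "h \<in> H" "g \<circ> h \<noteq> h \<circ> g"
proof -
  obtain p where p: "p \<in> cusps H" by (rule ex_cusp)
  obtain u where u: "u \<in> unip H p" "u \<noteq> id" using p by (auto simp: cusps_def)
  have "stab H p \<subset> H" using stab_neq[of p] by (auto simp: stab_def)
  then obtain h where h: "h \<in> H" "h p \<noteq> p" by (auto simp: stab_def)
  have "u \<circ> h \<noteq> h \<circ> u"
  proof
    assume "u \<circ> h = h \<circ> u"
    then have "u (h p) = h p" using unipD(2)[OF u(1)] by (metis comp_apply)
    then show False using unipD(3)[OF u(1)] h(2) u(2) by blast
  qed
  then show thesis using that unipD(1)[OF u(1)] h(1) by blast
qed

end

end

section \<open>Moebius transformations over an algebraically closed field of characteristic two\<close>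

text \<open>
  It is enough to split off one linear factor at a time: the quotient inherits separability and does
  not vanish at the root that was removed.
\<close>
lemma card_roots_separable:
  fixes p :: "'k::alg_closed_field poly"
  assumes "p \<noteq> 0" "\<And>x. poly p x = 0 \<Longrightarrow> poly (pderiv p) x \<noteq> 0"
  shows "card {x. poly p x = 0} = degree p"
  using assms
proof (induction "degree p" arbitrary: p)
  case 0
  then obtain c where "p = [:c:]" by (metis degree_eq_zeroE)
  with 0 show ?case by simp
next
  case (Suc n)
  obtain a where a: "poly p a = 0" using alg_closed_imp_poly_has_root[of p] Suc.hyps(2) by auto
  then obtain q where q: "p = [:-a, 1:] * q" using poly_eq_0_iff_dvd by (metis dvdE)
  have q0: "q \<noteq> 0" using q Suc.prems(1) by auto
  have deg: "degree p = Suc (degree q)" unfolding q using q0 by (subst degree_mult_eq) auto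
  have pd: "poly (pderiv p) x = poly q x + (x - a) * poly (pderiv q) x" for x
    unfolding q pderiv_mult by (simp add: pderiv_pCons algebra_simps)
  have "poly (pderiv p) a \<noteq> 0" using Suc.prems(2) a .
  then have qa: "poly q a \<noteq> 0" using pd[of a] by simp
  have "card {x. poly q x = 0} = degree q"
  proof (rule Suc.hyps(1))
    show "poly (pderiv q) x \<noteq> 0" if "poly q x = 0" for x
      using Suc.prems(2)[of x] pd[of x] that q by auto
  qed (use Suc.hyps(2) deg q0 in auto)
  moreover have "{x. poly p x = 0} = insert a {x. poly q x = 0}" using q by auto
  moreover have "finite {x. poly q x = 0}" using q0 by (rule poly_roots_finite)
  ultimately show ?case using qa deg by simp
qed

lemma two_power_minus_one_dvd_imp_dvd:
  assumes "(2::nat) ^ m - 1 dvd 2 ^ n - 1" "m > 0"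
  shows "m dvd n"
  using assms(1)
proof (induction n rule: less_induct)
  case (less n)
  show ?case
  proof (cases "n < m")
    case True
    then have "(2::nat) ^ n - 1 < 2 ^ m - 1" by (intro diff_less_mono) auto
    then have "(2::nat) ^ n - 1 = 0" using less.prems by (meson dvd_imp_le leD neq0_conv)
    then have "n = 0" using less_exp[of n] by linarith
    then show ?thesis by simp
  next
    case False
    define k where "k = n - m"
    have n: "n = m + k" using False by (simp add: k_def)
    have "(2::nat) ^ n - 1 = 2 ^ k * (2 ^ m - 1) + (2 ^ k - 1)"
      unfolding n by (simp add: power_add algebra_simps)
    then have "(2::nat) ^ m - 1 dvd 2 ^ k - 1" using less.prems by (metis dvd_add_right_iff dvd_triv_right)
    moreover have "k < n" using assms(2) n by simp
    ultimately show ?thesis using less.IH n by simp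
  qed
qed

text \<open>
  The point of the projective line with homogeneous coordinates \<open>(x : y)\<close>; the point at infinity is
  \<open>None\<close>. Working with homogeneous coordinates avoids case distinctions in compositions.
\<close>
definition pt :: "'k::field \<Rightarrow> 'k \<Rightarrow> 'k option" where
  "pt x y = (if y = 0 then None else Some (x / y))"

definition mob :: "'k::field \<Rightarrow> 'k \<Rightarrow> 'k \<Rightarrow> 'k \<Rightarrow> 'k option \<Rightarrow> 'k option" where
  "mob a b c d z = (case z of None \<Rightarrow> pt a c | Some x \<Rightarrow> pt (a * x + b) (c * x + d))"

definition Moebius :: "('k::field option \<Rightarrow> 'k option) set" where
  "Moebius = {mob a b c d | a b c d. a * d - b * c \<noteq> 0}"

lemma MoebiusI: "a * d - b * c \<noteq> 0 \<Longrightarrow> mob a b c d \<in> Moebius"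
  unfolding Moebius_def by blast

lemma MoebiusE:
  assumes "g \<in> Moebius"
  obtains a b c d where "g = mob a b c d" "a * d - b * c \<noteq> 0"
  using assms unfolding Moebius_def by blast

lemma mob_None: "mob a b c d None = pt a c" and mob_Some: "mob a b c d (Some x) = pt (a * x + b) (c * x + d)"
  by (simp_all add: mob_def)

lemma pt_scale: "t \<noteq> 0 \<Longrightarrow> pt (t * x) (t * y) = pt x y"
  by (simp add: pt_def)

lemma mob_scale: "t \<noteq> 0 \<Longrightarrow> mob (t * a) (t * b) (t * c) (t * d) = mob a b c d"
proof -
  assume t: "t \<noteq> 0"
  have "t * a * x + t * b = t * (a * x + b)" for a b x by (simp add: algebra_simps)
  then show ?thesis using t by (auto simp: fun_eq_iff mob_def pt_scale split: option.split)
qed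

lemma mob_pt:
  assumes "x \<noteq> 0 \<or> y \<noteq> 0"
  shows "mob a b c d (pt x y) = pt (a * x + b * y) (c * x + d * y)"
proof (cases "y = 0")
  case True
  then show ?thesis using assms pt_scale[of x a c] by (simp add: mob_None pt_def mult.commute)
next
  case False
  have "mob a b c d (pt x y) = pt (a * (x / y) + b) (c * (x / y) + d)"
    using False by (simp add: pt_def mob_Some)
  also have "\<dots> = pt (y * (a * (x / y) + b)) (y * (c * (x / y) + d))" using pt_scale[OF False] by simp
  also have "\<dots> = pt (a * x + b * y) (c * x + d * y)"
    using False by (intro arg_cong2[where f = pt]) (simp_all add: field_simps)
  finally show ?thesis .
qed

lemma mob_nonzero:
  fixes a :: "'k::field"
  assumes "a * d - b * c \<noteq> 0" shows "a * x + b \<noteq> 0 \<or> c * x + d \<noteq> 0" "a \<noteq> 0 \<or> c \<noteq> 0"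
proof -
  have "a * (c * x + d) - c * (a * x + b) = a * d - b * c" by (simp add: algebra_simps)
  then show "a * x + b \<noteq> 0 \<or> c * x + d \<noteq> 0" using assms by auto
  show "a \<noteq> 0 \<or> c \<noteq> 0" using assms by auto
qed

lemma mob_comp:
  assumes "a' * d' - b' * c' \<noteq> 0"
  shows "mob a b c d \<circ> mob a' b' c' d'
    = mob (a * a' + b * c') (a * b' + b * d') (c * a' + d * c') (c * b' + d * d')"
proof
  fix z
  show "(mob a b c d \<circ> mob a' b' c' d') z
    = mob (a * a' + b * c') (a * b' + b * d') (c * a' + d * c') (c * b' + d * d') z"
  proof (cases z)
    case None
    then show ?thesis using mob_nonzero(2)[OF assms] by (simp add: mob_None mob_pt)
  next
    case (Some x)
    show ?thesis unfolding Some comp_def mob_Some mob_pt[OF mob_nonzero(1)[OF assms]]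
      by (rule arg_cong2[where f = pt]) (simp_all add: algebra_simps)
  qed
qed

abbreviation aff :: "'k::field \<Rightarrow> 'k \<Rightarrow> 'k option \<Rightarrow> 'k option" where
  "aff a b \<equiv> mob a b 0 1"

lemma aff_apply [simp]: "aff a b None = None" "aff a b (Some x) = Some (a * x + b)"
  by (simp_all add: mob_def pt_def)

lemma aff_1_0: "aff 1 0 = id"
proof
  show "aff 1 0 z = id z" for z by (cases z) simp_all
qed

lemma aff_comp: "aff a b \<circ> aff a' b' = aff (a * a') (a * b' + b)"
proof
  show "(aff a b \<circ> aff a' b') z = aff (a * a') (a * b' + b) z" for z
    by (cases z) (simp_all add: algebra_simps)
qed

lemma aff_Moebius: "a \<noteq> 0 \<Longrightarrow> aff a b \<in> Moebius"
  by (rule MoebiusI) simp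

lemma Moebius_id: "id \<in> Moebius"
  using aff_Moebius[of 1 0] by (simp add: aff_1_0)

lemma Moebius_comp:
  assumes "g \<in> Moebius" "h \<in> Moebius" shows "g \<circ> h \<in> Moebius"
proof -
  obtain a b c d where g: "g = mob a b c d" "a * d - b * c \<noteq> 0" using assms(1) by (rule MoebiusE)
  obtain a' b' c' d' where h: "h = mob a' b' c' d'" "a' * d' - b' * c' \<noteq> 0" using assms(2) by (rule MoebiusE)
  have "(a * a' + b * c') * (c * b' + d * d') - (a * b' + b * d') * (c * a' + d * c')
      = (a * d - b * c) * (a' * d' - b' * c')" by (simp add: algebra_simps)
  then show ?thesis unfolding g(1) h(1) mob_comp[OF h(2)] using g(2) h(2) by (intro MoebiusI) simp
qed

lemma Moebius_inverse:
  assumes "g \<in> Moebius"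
  obtains h where "h \<in> Moebius" "g \<circ> h = id" "h \<circ> g = id"
proof -
  obtain a b c d where g: "g = mob a b c d" "a * d - b * c \<noteq> 0" using assms by (rule MoebiusE)
  let ?t = "a * d - b * c"
  have det: "d * a - (- b) * (- c) \<noteq> 0" using g(2) by (simp add: mult.commute)
  have id: "mob ?t 0 0 ?t = id"
    using mob_scale[of ?t 1 0 0 1] g(2) aff_1_0 by simp
  show thesis
  proof
    show "mob d (- b) (- c) a \<in> Moebius" by (rule MoebiusI[OF det])
    have "g \<circ> mob d (- b) (- c) a = mob ?t 0 0 ?t"
      unfolding g(1) mob_comp[OF det] by (rule arg_cong2[where f = "\<lambda>x y. mob x 0 0 y", THEN trans[rotated]]) (simp_all add: mult.commute)
    then show "g \<circ> mob d (- b) (- c) a = id" using id by simp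
    have "mob d (- b) (- c) a \<circ> g = mob ?t 0 0 ?t"
      unfolding g(1) mob_comp[OF g(2)] by (simp add: mult.commute)
    then show "mob d (- b) (- c) a \<circ> g = id" using id by simp
  qed
qed

lemma Moebius_bij: "g \<in> Moebius \<Longrightarrow> bij g"
  using Moebius_inverse o_bij by metis

lemma Moebius_inv: "g \<in> Moebius \<Longrightarrow> finv g \<in> Moebius"
  using Moebius_inverse inv_unique_comp by metis

lemma Moebius_fix_None:
  assumes "g \<in> Moebius" "g None = None"
  obtains a b where "a \<noteq> 0" "g = aff a b"
proof -
  obtain a b c d where g: "g = mob a b c d" "a * d - b * c \<noteq> 0" using assms(1) by (rule MoebiusE)
  have c: "c = 0" using assms(2) g(1) by (simp add: mob_None pt_def split: if_splits)
  then have ad: "a \<noteq> 0" "d \<noteq> 0" using g(2) by auto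
  have "mob (d * (a / d)) (d * (b / d)) (d * 0) (d * 1) = aff (a / d) (b / d)"
    by (rule mob_scale[OF ad(2)])
  then have "g = aff (a / d) (b / d)" using g(1) c ad by simp
  moreover have "a / d \<noteq> 0" using ad by simp
  ultimately show thesis using that by blast
qed

text \<open>
  Statements about arbitrary points are reduced to statements about infinity, 0 and 1 by conjugation
  with a coordinate system \<open>k\<close>, a Moebius transformation taking these points to the given ones.
\<close>
definition conj_by :: "('p \<Rightarrow> 'p) \<Rightarrow> ('p \<Rightarrow> 'p) \<Rightarrow> 'p \<Rightarrow> 'p" where
  "conj_by k f = k \<circ> f \<circ> finv k"

context
  fixes k :: "'p \<Rightarrow> 'p"
  assumes k: "bij k"
begin

lemma k_inv: "finv k (k x) = x" "k (finv k x) = x"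
  using k by (simp_all add: bij_is_inj bij_is_surj surj_f_inv_f)

lemma conj_by_apply: "conj_by k f (k x) = k (f x)"
  by (simp add: conj_by_def k_inv)

lemma conj_by_comp: "conj_by k f \<circ> conj_by k g = conj_by k (f \<circ> g)"
  by (simp add: conj_by_def fun_eq_iff k_inv)

lemma conj_by_id: "conj_by k id = id"
  by (simp add: conj_by_def fun_eq_iff k_inv)

lemma conj_by_inv: "bij f \<Longrightarrow> finv (conj_by k f) = conj_by k (finv f)"
  by (rule inv_unique_comp)
    (simp_all add: conj_by_comp surj_iff[THEN iffD1, OF bij_is_surj] inj_iff[THEN iffD1, OF bij_is_inj] conj_by_id)

lemma conj_by_pullback: "conj_by k (finv k \<circ> g \<circ> k) = g"
  by (simp add: conj_by_def fun_eq_iff k_inv)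

lemma conj_by_eq_iff: "conj_by k f = conj_by k g \<longleftrightarrow> f = g"
proof
  assume "conj_by k f = conj_by k g"
  then have "k (f x) = k (g x)" for x using conj_by_apply by metis
  then show "f = g" using k by (auto simp: bij_def inj_eq)
qed simp

lemma fixes_conj: "g (k x) = k x \<Longrightarrow> (finv k \<circ> g \<circ> k) x = x"
  by (simp add: k_inv)

end

lemma Moebius_conj: "k \<in> Moebius \<Longrightarrow> g \<in> Moebius \<Longrightarrow> conj_by k g \<in> Moebius"
  unfolding conj_by_def using Moebius_comp Moebius_inv by blast

lemma Moebius_transitive: obtains k where "k \<in> Moebius" "k None = p"
proof (cases p)
  case None then show thesis using that[of id] Moebius_id by simp
next
  case (Some x)
  have "mob x 1 1 0 \<in> Moebius" by (rule MoebiusI) simp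
  moreover have "mob x 1 1 0 None = p" by (simp add: Some mob_None pt_def)
  ultimately show thesis using that by blast
qed

lemma Moebius_2_transitive:
  assumes "p \<noteq> q" obtains k where "k \<in> Moebius" "k None = p" "k (Some 0) = q"
proof -
  obtain k where k: "k \<in> Moebius" "k None = p" by (rule Moebius_transitive)
  note ki = k_inv[OF Moebius_bij[OF k(1)]]
  obtain y where y: "finv k q = Some y" using assms ki(2)[of q] k(2) by (metis not_None_eq)
  have "k \<circ> aff 1 y \<in> Moebius" by (rule Moebius_comp[OF k(1) aff_Moebius]) simp
  moreover have "(k \<circ> aff 1 y) None = p" "(k \<circ> aff 1 y) (Some 0) = q"
    using k(2) ki(2)[of q] y by simp_all
  ultimately show thesis using that by blast
qed

lemma Moebius_3_transitive:
  assumes "p \<noteq> q" "p \<noteq> r" "q \<noteq> r"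
  obtains k where "k \<in> Moebius" "k None = p" "k (Some 0) = q" "k (Some 1) = r"
proof -
  obtain k where k: "k \<in> Moebius" "k None = p" "k (Some 0) = q" by (rule Moebius_2_transitive[OF assms(1)])
  note ki = k_inv[OF Moebius_bij[OF k(1)]]
  obtain y where y: "finv k r = Some y" using assms ki(2)[of r] k(2) by (metis not_None_eq)
  have "y \<noteq> 0" using y ki(2)[of r] k(3) assms(3) by auto
  then have "k \<circ> aff y 0 \<in> Moebius" by (rule Moebius_comp[OF k(1) aff_Moebius])
  moreover have "(k \<circ> aff y 0) None = p" "(k \<circ> aff y 0) (Some 0) = q" "(k \<circ> aff y 0) (Some 1) = r"
    using k ki(2)[of r] y by simp_all
  ultimately show thesis using that by blast
qed

lemma Moebius_fix_two:
  assumes k: "k \<in> Moebius" and g: "g \<in> Moebius" "g (k None) = k None" "g (k (Some 0)) = k (Some 0)"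
  obtains a where "a \<noteq> 0" "g = conj_by k (aff a 0)"
proof -
  note bij_k = Moebius_bij[OF k]
  let ?g = "finv k \<circ> g \<circ> k"
  have "?g \<in> Moebius" by (rule Moebius_comp[OF Moebius_comp[OF Moebius_inv[OF k] g(1)] k])
  then obtain a b where ab: "a \<noteq> 0" "?g = aff a b"
    using Moebius_fix_None fixes_conj[OF bij_k, of g None] g(2) by blast
  have "b = 0" using fixes_conj[OF bij_k, of g "Some 0"] g(3) unfolding ab(2) by simp
  then have "g = conj_by k (aff a 0)" using conj_by_pullback[OF bij_k, of g] ab(2) by simp
  then show thesis using that ab(1) by blast
qed

lemma Moebius_stab_iff:
  assumes k: "k \<in> Moebius"
  shows "g \<in> stab Moebius (k None) \<longleftrightarrow> (\<exists>a b. a \<noteq> 0 \<and> g = conj_by k (aff a b))"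
proof
  note bij_k = Moebius_bij[OF k]
  assume g: "g \<in> stab Moebius (k None)"
  then have g': "g \<in> Moebius" "g (k None) = k None" by (auto simp: stab_def)
  have "finv k \<circ> g \<circ> k \<in> Moebius" by (rule Moebius_comp[OF Moebius_comp[OF Moebius_inv[OF k] g'(1)] k])
  moreover have "(finv k \<circ> g \<circ> k) None = None" using fixes_conj[OF bij_k, of g None] g'(2) by simp
  ultimately obtain a b where "a \<noteq> 0" "finv k \<circ> g \<circ> k = aff a b" using Moebius_fix_None by blast
  then show "\<exists>a b. a \<noteq> 0 \<and> g = conj_by k (aff a b)" using conj_by_pullback[OF bij_k, of g] by metis
next
  assume "\<exists>a b. a \<noteq> 0 \<and> g = conj_by k (aff a b)"
  then show "g \<in> stab Moebius (k None)"
    using Moebius_conj[OF k] aff_Moebius conj_by_apply[OF Moebius_bij[OF k]] by (auto simp: stab_def)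
qed

text \<open>
  In the coordinates \<open>k\<close>, the elements fixing only infinity are the translations: a map
  \<open>x \<mapsto> a x + b\<close> with \<open>a \<noteq> 1\<close> also fixes \<open>b / (1 - a)\<close>.
\<close>
lemma Moebius_unip_iff:
  assumes k: "k \<in> Moebius"
  shows "g \<in> unip Moebius (k None) \<longleftrightarrow> (\<exists>b. g = conj_by k (aff 1 b))"
proof
  note bij_k = Moebius_bij[OF k]
  assume g: "g \<in> unip Moebius (k None)"
  then have "g \<in> stab Moebius (k None)" by (auto simp: stab_def dest: unipD)
  then obtain a b where ab: "a \<noteq> 0" "g = conj_by k (aff a b)" using Moebius_stab_iff[OF k] by blast
  show "\<exists>b. g = conj_by k (aff 1 b)"
  proof (cases "a = 1")
    case False
    define x where "x = b / (1 - a)"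
    have "a * x + b = x" using False by (simp add: x_def field_simps)
    then have "g (k (Some x)) = k (Some x)" unfolding ab(2) conj_by_apply[OF bij_k] by simp
    moreover have "k (Some x) \<noteq> k None" using bij_k by (metis bij_pointE option.distinct(1))
    ultimately have "g = id" using unipD(3)[OF g] by blast
    then have "g = conj_by k (aff 1 0)" using conj_by_id[OF bij_k] by (simp add: aff_1_0)
    then show ?thesis by blast
  qed (use ab in blast)
next
  note bij_k = Moebius_bij[OF k]
  assume "\<exists>b. g = conj_by k (aff 1 b)"
  then obtain b where b: "g = conj_by k (aff 1 b)" by blast
  show "g \<in> unip Moebius (k None)"
  proof (rule unipI)
    show "g \<in> Moebius" unfolding b by (rule Moebius_conj[OF k aff_Moebius]) simp
    show "g (k None) = k None" unfolding b conj_by_apply[OF bij_k] by simp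
    fix q assume q: "g q = q" "q \<noteq> k None"
    obtain x where x: "q = k (Some x)" using q(2) k_inv(2)[OF bij_k, of q] by (metis not_None_eq)
    have "aff 1 b (Some x) = Some x" using q(1) unfolding x b conj_by_apply[OF bij_k] using bij_k by (metis bij_pointE)
    then have "b = 0" by simp
    then show "g = id" using b conj_by_id[OF bij_k] by (simp add: aff_1_0)
  qed
qed

lemma aff_inverse: "(a::'k::field) \<noteq> 0 \<Longrightarrow> finv (aff a b) = aff (1 / a) (- b / a)"
  by (rule inv_unique_comp) (simp_all add: aff_comp aff_1_0 flip: aff_1_0)

lemma Moebius_ex_fixed_point:
  assumes "(g :: 'k::alg_closed_field option \<Rightarrow> 'k option) \<in> Moebius" shows "\<exists>p. g p = p"
proof -
  obtain a b c d where g: "g = mob a b c d" "a * d - b * c \<noteq> 0" using assms by (rule MoebiusE)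
  show ?thesis
  proof (cases "c = 0")
    case True
    then have "g None = None" by (simp add: g(1) mob_None pt_def)
    then show ?thesis by blast
  next
    case False
    then have "degree [:- b, d - a, c:] > 0" by simp
    then obtain z where "poly [:- b, d - a, c:] z = 0" using alg_closed_imp_poly_has_root by blast
    then have z: "a * z + b = z * (c * z + d)" by (simp add: algebra_simps)
    then have "c * z + d \<noteq> 0" using mob_nonzero(1)[OF g(2), of z] by auto
    then have "g (Some z) = Some z" using z by (simp add: g(1) mob_Some pt_def)
    then show ?thesis by blast
  qed
qed

theorem Moebius_one_or_two_fixed_points:
  assumes char2: "(1::'k::alg_closed_field) + 1 = 0"
  shows "one_or_two_fixed_points (Moebius :: ('k option \<Rightarrow> 'k option) set)"
proof
  have dbl: "x + x = 0" for x :: 'k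
    using char2 by (metis distrib_left mult.right_neutral mult_zero_right)
  show "g \<in> Moebius \<Longrightarrow> bij g" for g :: "'k option \<Rightarrow> 'k option" by (rule Moebius_bij)
  show "id \<in> (Moebius :: ('k option \<Rightarrow> 'k option) set)" by (rule Moebius_id)
  show "g \<in> Moebius \<Longrightarrow> h \<in> Moebius \<Longrightarrow> g \<circ> h \<in> Moebius" for g h :: "'k option \<Rightarrow> 'k option"
    by (rule Moebius_comp)
  show "g \<in> Moebius \<Longrightarrow> finv g \<in> Moebius" for g :: "'k option \<Rightarrow> 'k option" by (rule Moebius_inv)
  show "g \<in> Moebius \<Longrightarrow> \<exists>p. g p = p" for g :: "'k option \<Rightarrow> 'k option" by (rule Moebius_ex_fixed_point)
  fix g h s :: "'k option \<Rightarrow> 'k option" and p q r :: "'k option"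
  { assume g: "g \<in> Moebius" "g p = p" "g q = q" "g r = r" and ne: "p \<noteq> q" "p \<noteq> r" "q \<noteq> r"
    obtain k where k: "k \<in> Moebius" "k None = p" "k (Some 0) = q" "k (Some 1) = r"
      using Moebius_3_transitive[OF ne] .
    note bij_k = Moebius_bij[OF k(1)]
    obtain a where a: "g = conj_by k (aff a 0)" using Moebius_fix_two[OF k(1) g(1)] g k by metis
    have "g (k (Some 1)) = k (aff a 0 (Some 1))" unfolding a conj_by_apply[OF bij_k] ..
    then have "k (Some 1) = k (Some a)" using g(4) k(4) by simp
    then have "a = 1" using bij_k by (metis bij_pointE option.inject)
    then show "g = id" using a conj_by_id[OF bij_k] by (simp add: aff_1_0) }
  obtain k where k: "k \<in> Moebius" "k None = p" using Moebius_transitive .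
  note bij_k = Moebius_bij[OF k(1)]
  { assume "g \<in> unip Moebius p" "h \<in> unip Moebius p"
    then obtain b c where "g = conj_by k (aff 1 b)" "h = conj_by k (aff 1 c)"
      using Moebius_unip_iff[OF k(1)] k(2) by metis
    then have "g \<circ> h = conj_by k (aff 1 (c + b))" by (simp add: conj_by_comp[OF bij_k] aff_comp)
    then show "g \<circ> h \<in> unip Moebius p" using Moebius_unip_iff[OF k(1)] k(2) by blast }
  { assume "g \<in> unip Moebius p"
    then obtain b where "g = conj_by k (aff 1 b)" using Moebius_unip_iff[OF k(1)] k(2) by metis
    then have "g \<circ> g = conj_by k (aff 1 (b + b))" by (simp add: conj_by_comp[OF bij_k] aff_comp)
    then show "g \<circ> g = id" using conj_by_id[OF bij_k] by (simp add: dbl aff_1_0) }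
  { assume "g \<in> stab Moebius p" "h \<in> stab Moebius p"
    then obtain a b c d where gh: "a \<noteq> 0" "g = conj_by k (aff a b)" "c \<noteq> 0" "h = conj_by k (aff c d)"
      using Moebius_stab_iff[OF k(1)] k(2) by metis
    have "finv g = conj_by k (aff (1 / a) (- b / a))" "finv h = conj_by k (aff (1 / c) (- d / c))"
      using gh conj_by_inv[OF bij_k Moebius_bij[OF aff_Moebius]] aff_inverse by metis+
    then have "\<exists>x. g \<circ> h \<circ> finv g \<circ> finv h = conj_by k (aff 1 x)"
      using gh by (simp add: conj_by_comp[OF bij_k] aff_comp) blast
    then show "g \<circ> h \<circ> finv g \<circ> finv h \<in> unip Moebius p" using Moebius_unip_iff[OF k(1)] k(2) by metis }
  { assume g: "g \<in> Moebius" "g p = p" "g q = q" and ne: "p \<noteq> q"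
    obtain k where k: "k \<in> Moebius" "k None = p" "k (Some 0) = q"
      using Moebius_2_transitive[OF ne] .
    note bij_k = Moebius_bij[OF k(1)]
    obtain a where a: "a \<noteq> 0" "g = conj_by k (aff a 0)" using Moebius_fix_two[OF k(1) g(1)] g k by metis
    { assume "g \<circ> g = id"
      then have "conj_by k (aff (a * a) 0) = conj_by k (aff 1 0)"
        using a conj_by_id[OF bij_k] by (simp add: conj_by_comp[OF bij_k] aff_comp aff_1_0)
      then have "aff (a * a) 0 (Some 1) = aff 1 0 (Some 1)" using conj_by_eq_iff[OF bij_k] by metis
      then have "a * a = 1" by simp
      then have "(a + 1) * (a + 1) = 0" using dbl[of a] char2 by (simp add: algebra_simps)
      then have "a + 1 = 0" by simp
      then have "a = 1" using char2 by (metis add_right_cancel)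
      then show "g = id" using a conj_by_id[OF bij_k] by (simp add: aff_1_0) }
    { assume s: "s \<in> Moebius" "s p = q" "s q = p"
      let ?s = "finv k \<circ> s \<circ> k"
      have "?s \<in> Moebius" by (rule Moebius_comp[OF Moebius_comp[OF Moebius_inv[OF k(1)] s(1)] k(1)])
      then obtain x y z w where m: "?s = mob x y z w" "x * w - y * z \<noteq> 0" by (rule MoebiusE)
      have "?s None = Some 0" "?s (Some 0) = None" using s k k_inv(1)[OF bij_k] by (metis comp_apply)+
      then have "x = 0" "w = 0" "z \<noteq> 0"
        unfolding m(1) by (auto simp: mob_None mob_Some pt_def split: if_splits)
      then have sm: "?s = mob 0 y z 0" and yz: "y \<noteq> 0" "z \<noteq> 0" using m by auto
      have "?s \<circ> aff a 0 = mob 0 y (z * a) 0" unfolding sm using a(1) by (subst mob_comp) auto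
      also have "\<dots> = mob (a * 0) (a * (y / a)) (a * z) (a * 0)" using a(1) by (simp add: mult.commute)
      also have "\<dots> = mob 0 (y / a) z 0" by (rule mob_scale[OF a(1)])
      also have "\<dots> = aff (1 / a) 0 \<circ> ?s" unfolding sm using yz by (subst mob_comp) auto
      finally have c: "?s \<circ> aff a 0 = aff (1 / a) 0 \<circ> ?s" .
      have ig: "finv g = conj_by k (aff (1 / a) 0)"
        using a conj_by_inv[OF bij_k Moebius_bij[OF aff_Moebius[OF a(1)]], of 0] aff_inverse[OF a(1), of 0] by simp
      have "s \<circ> g = conj_by k ?s \<circ> conj_by k (aff a 0)" using conj_by_pullback[OF bij_k, of s] a(2) by simp
      also have "\<dots> = conj_by k (aff (1 / a) 0) \<circ> conj_by k ?s" using c by (simp only: conj_by_comp[OF bij_k])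
      also have "\<dots> = finv g \<circ> s" using conj_by_pullback[OF bij_k, of s] ig by simp
      finally have "s \<circ> g \<circ> finv s = finv g \<circ> (s \<circ> finv s)" by (simp add: comp_assoc)
      then show "s \<circ> g \<circ> finv s = finv g"
        using surj_iff[THEN iffD1, OF bij_is_surj[OF Moebius_bij[OF s(1)]]] by simp } }
qed

section \<open>Fields of definition and the depth of groups of linear type\<close>

text \<open>
  For a power \<open>n\<close> of the characteristic of an algebraically closed field this is its subfield with
  \<open>n\<close> elements.
\<close>
abbreviation gf :: "nat \<Rightarrow> 'k::field set" where
  "gf n \<equiv> {x. x ^ n = x}"

lemma gf_power_subset: "gf n \<subseteq> gf (n ^ i)"
proof
  fix x assume "x \<in> gf n"
  then show "x \<in> gf (n ^ i)" by (induction i) (simp_all add: power_mult)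
qed

lemma gf_poly:
  fixes p :: "'k::field poly"
  assumes "n > 1" and p_def: "p = monom 1 n - monom 1 1"
  shows "degree p = n" "p \<noteq> 0" "{x. poly p x = 0} = gf n"
proof -
  have "degree (- monom 1 1 :: 'k poly) < degree (monom 1 n :: 'k poly)"
    using assms(1) by (simp add: degree_monom_eq)
  from degree_add_eq_left[OF this] show deg: "degree p = n" by (simp add: p_def degree_monom_eq)
  then show "p \<noteq> 0" using assms(1) by auto
  show "{x. poly p x = 0} = gf n" by (simp add: p_def poly_monom)
qed

lemma
  assumes "n > 1"
  shows finite_gf: "finite (gf n :: 'k::field set)" and card_gf_le: "card (gf n :: 'k set) \<le> n"
proof -
  define p :: "'k poly" where "p = monom 1 n - monom 1 1"
  note gp = gf_poly[OF assms p_def]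
  show "finite (gf n :: 'k set)" unfolding gp(3)[symmetric] by (rule poly_roots_finite[OF gp(2)])
  show "card (gf n :: 'k set) \<le> n"
    using card_poly_roots_bound[OF gp(2)] unfolding gp(1,3) .
qed

lemma two_power_gt_1: "m > 0 \<Longrightarrow> (2::nat) ^ m > 1"
  by (rule one_less_power) simp_all

context
  assumes char2: "(1::'k::alg_closed_field) + 1 = 0"
begin

interpretation M: one_or_two_fixed_points "Moebius :: ('k option \<Rightarrow> 'k option) set"
  by (rule Moebius_one_or_two_fixed_points[OF char2])

lemma double_eq_0: "x + x = (0::'k)"
  using char2 by (metis distrib_left mult.right_neutral mult_zero_right)

lemma frobenius_add: "(x + y :: 'k) ^ (2 ^ n) = x ^ (2 ^ n) + y ^ (2 ^ n)"
proof (induction n)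
  case (Suc n)
  have sq: "(u + v) ^ 2 = u ^ 2 + v ^ 2" for u v :: 'k
  proof -
    have "(u + v) ^ 2 = u ^ 2 + v ^ 2 + (u * v + u * v)" by (simp add: power2_eq_square algebra_simps)
    then show ?thesis using double_eq_0 by simp
  qed
  have pw: "u ^ (2 ^ Suc n) = (u ^ (2 ^ n)) ^ 2" for u :: 'k by (simp add: mult.commute flip: power_mult)
  have "(x + y) ^ (2 ^ Suc n) = ((x + y) ^ (2 ^ n)) ^ 2" by (rule pw)
  also have "\<dots> = (x ^ (2 ^ n)) ^ 2 + (y ^ (2 ^ n)) ^ 2" using Suc sq by simp
  also have "\<dots> = x ^ (2 ^ Suc n) + y ^ (2 ^ Suc n)" by (simp only: pw)
  finally show ?case .
qed simp

text \<open>
  In characteristic 2 the polynomial \<open>X^(2^m) - X\<close> has derivative \<open>-1\<close>, so it is separable.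
\<close>
lemma card_gf:
  assumes "m > 0" shows "card (gf (2 ^ m) :: 'k set) = 2 ^ m"
proof -
  define p :: "'k poly" where "p = monom 1 (2 ^ m) - monom 1 1"
  have m2: "(2::nat) ^ m > 1" using assms by (rule two_power_gt_1)
  note gp = gf_poly[OF m2 p_def]
  have "(2::'k) = 0" using char2 by simp
  then have "of_nat (2 ^ m) = (0::'k)" using assms by simp
  then have pd: "poly (pderiv p) x = - 1" for x
    by (simp add: p_def pderiv_diff pderiv_monom poly_monom)
  have "card {x. poly p x = 0} = 2 ^ m"
    using card_roots_separable[OF gp(2)] pd gp(1) by simp
  then show ?thesis using gp(3) by simp
qed

lemma gf_closed:
  fixes x y :: 'k
  assumes "x \<in> gf (2 ^ m)" "y \<in> gf (2 ^ m)"
  shows "x + y \<in> gf (2 ^ m)" "x * y \<in> gf (2 ^ m)" "x / y \<in> gf (2 ^ m)"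
  using assms by (simp_all add: frobenius_add power_mult_distrib power_divide)

text \<open>
  If the coordinate system \<open>k\<close> takes infinity, 0 and 1 to cusps of \<open>H\<close>, then the coordinates of the
  remaining cusps form a field. It is closed under addition and multiplication because \<open>H\<close> contains the
  corresponding translations and scalings, as cardinalities force.
\<close>
definition coords :: "('k option \<Rightarrow> 'k option) set \<Rightarrow> ('k option \<Rightarrow> 'k option) \<Rightarrow> 'k set" where
  "coords H k = {x. k (Some x) \<in> cusps H}"

context
  fixes H e k
  assumes lt: "M.linear_type H e" and k: "k \<in> Moebius"
    and c: "k None \<in> cusps H" "k (Some 0) \<in> cusps H" "k (Some 1) \<in> cusps H"
begin

lemma bij_k: "bij k" using Moebius_bij[OF k] .

lemma k_eq_iff: "k x = k y \<longleftrightarrow> x = y"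
  using bij_k by (auto simp: bij_def inj_eq)

lemma card_coords: "card (coords H k) = e"
proof -
  have "k ` (insert None (Some ` coords H k)) = cusps H"
  proof
    show "k ` (insert None (Some ` coords H k)) \<subseteq> cusps H" using c by (auto simp: coords_def)
    show "cusps H \<subseteq> k ` (insert None (Some ` coords H k))"
    proof
      fix p assume p: "p \<in> cusps H"
      show "p \<in> k ` (insert None (Some ` coords H k))"
      proof (cases "finv k p")
        case None then show ?thesis using k_inv(2)[OF bij_k, of p] by force
      next
        case (Some x)
        then have "k (Some x) = p" using k_inv(2)[OF bij_k, of p] by simp
        then show ?thesis using p by (auto simp: coords_def)
      qed
    qed
  qed
  moreover have "inj k" using bij_k by (rule bij_is_inj)
  ultimately have "card (insert None (Some ` coords H k)) = e + 1"
    using M.linD(6)[OF lt] card_image[OF inj_on_subset[OF _ subset_UNIV], of k "insert None (Some ` coords H k)"]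
    by simp
  moreover have "finite (coords H k)"
  proof -
    have "finite (insert None (Some ` coords H k))" using calculation by (intro card_ge_0_finite) simp
    then show ?thesis by (simp add: finite_image_iff)
  qed
  ultimately show ?thesis by (simp add: card_image card_insert_if image_iff)
qed

lemma coords_mem: "x \<in> coords H k \<longleftrightarrow> k (Some x) \<in> cusps H"
  by (simp add: coords_def)

lemma unip_k: "u \<in> unip H (k None) \<longleftrightarrow> (\<exists>b. u \<in> H \<and> u = conj_by k (aff 1 b))"
proof -
  have "unip H (k None) = H \<inter> unip Moebius (k None)"
    using M.unip_eq[of H "k None"] M.linear_in_P[OF lt] by blast
  then show ?thesis using Moebius_unip_iff[OF k] by auto
qed

lemma translation_mem:
  assumes x: "x \<in> coords H k" shows "conj_by k (aff 1 x) \<in> H"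
proof -
  have ne: "k (Some 0) \<noteq> k None" "k (Some x) \<noteq> k None" by (simp_all add: k_eq_iff)
  obtain u where u: "u \<in> unip H (k None)" "u (k (Some 0)) = k (Some x)"
    using M.unip_transitive[OF lt c(1,2) ne(1) _ ne(2)] x coords_mem by blast
  then obtain b where b: "u \<in> H" "u = conj_by k (aff 1 b)" using unip_k by blast
  have "k (Some b) = k (Some x)" using u(2) unfolding b(2) conj_by_apply[OF bij_k] by simp
  then show ?thesis using b k_eq_iff by simp
qed

text \<open>
  The stabiliser of infinity and 0 has \<open>e - 1\<close> elements. They are scalings by nonzero coordinates of
  cusps, and there are only \<open>e - 1\<close> of these, so all of them occur.
\<close>
lemma scaling_mem:
  assumes x: "x \<in> coords H k" "x \<noteq> 0" shows "conj_by k (aff x 0) \<in> H"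
proof -
  let ?T = "stab (stab H (k None)) (k (Some 0))"
  have ne: "k (Some 0) \<noteq> k None" by (simp add: k_eq_iff)
  have T: "\<exists>a. a \<noteq> 0 \<and> a \<in> coords H k \<and> h = conj_by k (aff a 0)" if h: "h \<in> ?T" for h
  proof -
    have h': "h \<in> H" "h (k None) = k None" "h (k (Some 0)) = k (Some 0)" using h by (auto simp: stab_def)
    obtain a where a: "a \<noteq> 0" "h = conj_by k (aff a 0)" using Moebius_fix_two[OF k M.linear_in_P[OF lt h'(1)] h'(2,3)] .
    have "h (k (Some 1)) \<in> cusps H" using M.orb_cusp[OF lt c(3)] h'(1) by (auto simp: orb_def)
    then have "a \<in> coords H k" unfolding a(2) conj_by_apply[OF bij_k] coords_mem by simp
    then show ?thesis using a by blast
  qed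
  have "?T \<subseteq> (\<lambda>a. conj_by k (aff a 0)) ` (coords H k - {0})" using T by blast
  moreover have fin: "finite (coords H k)" using card_coords M.linD(3)[OF lt] by (intro card_ge_0_finite) simp
  moreover have "card ((\<lambda>a. conj_by k (aff a 0)) ` (coords H k - {0})) \<le> card ?T"
  proof -
    have "card ((\<lambda>a. conj_by k (aff a 0)) ` (coords H k - {0})) \<le> card (coords H k - {0})"
      using fin by (intro card_image_le) simp
    also have "\<dots> = e - 1" using card_coords c(2) fin by (simp add: coords_mem)
    also have "\<dots> = card ?T" using M.card_two_cusp_stab[OF lt c(1,2) ne] by simp
    finally show ?thesis .
  qed
  ultimately have "?T = (\<lambda>a. conj_by k (aff a 0)) ` (coords H k - {0})"
    by (intro card_seteq) auto
  then have "conj_by k (aff x 0) \<in> ?T" using x by blast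
  then show ?thesis by (simp add: stab_def)
qed

lemma cusps_invariant: "h \<in> H \<Longrightarrow> p \<in> cusps H \<Longrightarrow> h p \<in> cusps H"
  using M.orb_cusp[OF lt, of p] by (auto simp: orb_def)

lemma coords_closed:
  assumes "x \<in> coords H k" "y \<in> coords H k"
  shows "x + y \<in> coords H k" "x * y \<in> coords H k"
proof -
  have "conj_by k (aff 1 x) (k (Some y)) \<in> cusps H"
    using cusps_invariant translation_mem[OF assms(1)] assms(2) coords_mem by blast
  then show "x + y \<in> coords H k" unfolding conj_by_apply[OF bij_k] coords_mem by (simp add: add.commute)
  show "x * y \<in> coords H k"
  proof (cases "x = 0")
    case True then show ?thesis using c(2) by (simp add: coords_mem)
  next
    case False
    have "conj_by k (aff x 0) (k (Some y)) \<in> cusps H"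
      using cusps_invariant scaling_mem[OF assms(1) False] assms(2) coords_mem by blast
    then show ?thesis unfolding conj_by_apply[OF bij_k] coords_mem by simp
  qed
qed

text \<open>
  The nonzero coordinates are closed under multiplication, so they are roots of unity of order
  \<open>e - 1\<close>, and there are as many coordinates as the polynomial \<open>X^e - X\<close> can have roots.
\<close>
lemma coords_eq_gf: "coords H k = gf e"
proof -
  let ?A = "coords H k - {0}"
  have e4: "4 \<le> e" using M.linD(3)[OF lt] .
  have fin: "finite (coords H k)" using card_coords e4 by (intro card_ge_0_finite) simp
  have zero: "0 \<in> coords H k" using c(2) by (simp add: coords_mem)
  have cA: "card ?A = e - 1" using card_coords zero fin by simp
  have "x ^ e = x" if x: "x \<in> coords H k" for x
  proof (cases "x = 0")
    case False
    have inj: "inj_on ((*) x) ?A" using False by (auto intro: inj_onI)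
    have "(*) x ` ?A = ?A"
      using fin coords_closed(2)[OF x] False inj
      by (intro card_subset_eq) (auto simp: card_image)
    then have "\<Prod>?A = (\<Prod>a\<in>?A. x * a)"
      using prod.reindex[OF inj, of "\<lambda>a. a"] by simp
    also have "\<dots> = x ^ (e - 1) * \<Prod>?A" using cA by (simp add: prod.distrib)
    finally have "x ^ (e - 1) * \<Prod>?A = 1 * \<Prod>?A" by simp
    moreover have "\<Prod>?A \<noteq> 0" using fin by simp
    ultimately have "x ^ (e - 1) = 1" by (metis mult_cancel_right)
    then have "x * x ^ (e - 1) = x" by simp
    then show ?thesis using e4 by (simp flip: power_Suc)
  qed (use e4 in simp)
  then have sub: "coords H k \<subseteq> gf e" by blast
  have e1: "e > 1" using e4 by simp
  show ?thesis
  proof (rule card_seteq[OF _ sub])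
    show "finite (gf e :: 'k set)" by (rule finite_gf[OF e1])
    show "card (gf e :: 'k set) \<le> card (coords H k)"
      using card_gf_le[OF e1] card_coords by simp
  qed
qed

end

text \<open>
  The elements of \<open>H\<close> defined over the field of \<open>n\<close> elements, in the coordinates \<open>k\<close>.
\<close>
definition preserving :: "('k option \<Rightarrow> 'k option) set \<Rightarrow> ('k option \<Rightarrow> 'k option) \<Rightarrow> nat \<Rightarrow> ('k option \<Rightarrow> 'k option) set" where
  "preserving H k n = {h \<in> H. h ` (k ` insert None (Some ` gf n)) = k ` insert None (Some ` gf n)}"

lemma subgroup_preserving:
  assumes H: "subgroup H M.\<Gamma>" shows "subgroup (preserving H k n) M.\<Gamma>"
proof -
  obtain Om where iff: "g \<in> preserving H k n \<longleftrightarrow> g \<in> H \<and> g ` Om = Om" for g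
    unfolding preserving_def by blast
  show ?thesis
    unfolding M.subgroup_iff
  proof (intro conjI ballI)
    fix g assume "g \<in> preserving H k n"
    then have gH: "g \<in> H" "g ` Om = Om" by (simp_all add: iff)
    have "finv g ` Om = finv g ` g ` Om" using gH(2) by simp
    also have "\<dots> = Om" using M.P_inv_comp(1)[OF M.subgroupD(1)[OF H gH(1)]] by (simp add: image_comp)
    finally show "finv g \<in> preserving H k n" using M.subgroupD(4)[OF H gH(1)] by (simp add: iff)
    fix h assume "h \<in> preserving H k n"
    then show "g \<circ> h \<in> preserving H k n"
      using gH M.subgroupD(3)[OF H gH(1)] image_comp[of g h Om] by (simp add: iff)
  qed (use M.subgroupD[OF H] in \<open>auto simp: iff\<close>)
qed

lemma preservingI:
  assumes k: "k \<in> Moebius" and n: "n > 1" and h: "conj_by k f \<in> H" and f: "f \<in> Moebius"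
    and into: "\<And>z. z \<in> insert None (Some ` gf n) \<Longrightarrow> f z \<in> insert None (Some ` gf n)"
  shows "conj_by k f \<in> preserving H k n"
proof -
  define Om where "Om = insert None (Some ` (gf n :: 'k set))"
  have "finite Om" by (simp add: Om_def finite_gf[OF n])
  moreover have "f ` Om \<subseteq> Om" unfolding Om_def by (intro image_subsetI into)
  moreover have "inj_on f Om" using inj_on_subset[OF bij_is_inj[OF Moebius_bij[OF f]] subset_UNIV] .
  ultimately have "f ` Om = Om" by (rule endo_inj_surj)
  then have "k ` f ` Om = k ` Om" by simp
  then have "conj_by k f ` k ` Om = k ` Om"
    using conj_by_apply[OF Moebius_bij[OF k], of f] by (simp add: image_image)
  then show ?thesis using h unfolding preserving_def Om_def by blast
qed

lemma scaling_preserving: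
  assumes k: "k \<in> Moebius" and a: "a \<in> gf (2 ^ m)" "a \<noteq> 0" and m: "m > 0" and h: "conj_by k (aff a 0) \<in> H"
  shows "conj_by k (aff a 0) \<in> preserving H k (2 ^ m)"
proof (rule preservingI[OF k _ h aff_Moebius[OF a(2)]])
  fix z :: "'k option" assume "z \<in> insert None (Some ` gf (2 ^ m))"
  then show "aff a 0 z \<in> insert None (Some ` gf (2 ^ m))"
    using gf_closed(2)[OF a(1)] by (elim insertE imageE) (simp_all del: mem_Collect_eq)
qed (use two_power_gt_1[OF m] in simp)

lemma translation_preserving:
  assumes k: "k \<in> Moebius" and a: "a \<in> gf (2 ^ m)" and m: "m > 0" and h: "conj_by k (aff 1 a) \<in> H"
  shows "conj_by k (aff 1 a) \<in> preserving H k (2 ^ m)"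
proof (rule preservingI[OF k _ h])
  show "aff 1 a \<in> Moebius" by (rule aff_Moebius) simp
  fix z :: "'k option" assume "z \<in> insert None (Some ` gf (2 ^ m))"
  then show "aff 1 a z \<in> insert None (Some ` gf (2 ^ m))"
    using gf_closed(1)[OF _ a] by (elim insertE imageE) (simp_all del: mem_Collect_eq)
qed (use two_power_gt_1[OF m] in simp)

lemma inversion_preserving:
  assumes k: "k \<in> Moebius" and a: "a \<in> gf (2 ^ m)" "a \<noteq> 0" and m: "m > 0" and h: "conj_by k (mob 0 a 1 0) \<in> H"
  shows "conj_by k (mob 0 a 1 0) \<in> preserving H k (2 ^ m)"
proof (rule preservingI[OF k _ h])
  show "mob 0 a 1 0 \<in> Moebius" by (rule MoebiusI) (use a(2) in simp)
  fix z :: "'k option" assume z: "z \<in> insert None (Some ` gf (2 ^ m))"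
  have zero: "(0::'k) \<in> gf (2 ^ m)" by simp
  show "mob 0 a 1 0 z \<in> insert None (Some ` gf (2 ^ m))"
    using z
  proof (elim insertE imageE)
    assume "z = None"
    then show ?thesis using zero by (simp add: mob_None pt_def del: mem_Collect_eq)
  next
    fix x assume x: "z = Some x" "x \<in> gf (2 ^ m)"
    show ?thesis using gf_closed(3)[OF a(1) x(2)] by (simp add: x(1) mob_Some pt_def del: mem_Collect_eq)
  qed
qed (use two_power_gt_1[OF m] in simp)

text \<open>
  Choose coordinates with infinity, 0 and 1 among the cusps of \<open>N\<close>. Then \<open>N\<close> and \<open>H\<close> have fields of
  coordinates with \<open>e'\<close> and \<open>2^(3^b)\<close> elements. By comparing orders of unipotent
  subgroups and of tori, \<open>e'\<close> is \<open>2^(3^b')\<close> for some \<open>b' < b\<close>. If \<open>b' + 1 < b\<close>, then the elements of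
  \<open>H\<close> defined over the field with \<open>2^(3^(b'+1))\<close> elements would lie strictly between \<open>N\<close> and \<open>H\<close>.
\<close>
theorem maximal_linear_subgroup:
  assumes lt: "M.linear_type H (2 ^ 3 ^ b)" and mx: "maximal_in M.\<Gamma> N H" and lt': "M.linear_type N e'"
  obtains b' where "e' = 2 ^ 3 ^ b'" "b = Suc b'"
proof -
  let ?e = "2 ^ 3 ^ b :: nat"
  have N: "subgroup N M.\<Gamma>" and NH: "N \<subset> H"
    and between: "\<And>L. subgroup L M.\<Gamma> \<Longrightarrow> N \<subseteq> L \<Longrightarrow> L \<subseteq> H \<Longrightarrow> L = N \<or> L = H"
    using mx unfolding maximal_in_def by blast+
  note H = M.linD(1)[OF lt]
  have unipN: "unip N p \<subseteq> unip H p" for p using NH unfolding unip_def by blast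
  have cuspsN: "cusps N \<subseteq> cusps H" using unipN unfolding cusps_def by blast
  have "card (cusps N) \<ge> 3" using M.linD(3,6)[OF lt'] by simp
  then obtain S where "S \<subseteq> cusps N" "card S = 3" by (meson obtain_subset_with_card_n)
  then obtain p q r where pqr: "p \<in> cusps N" "q \<in> cusps N" "r \<in> cusps N" "p \<noteq> q" "p \<noteq> r" "q \<noteq> r"
    by (auto simp: card_3_iff)
  obtain k where k: "k \<in> Moebius" "k None = p" "k (Some 0) = q" "k (Some 1) = r"
    using Moebius_3_transitive[OF pqr(4-6)] .
  note bij_k = Moebius_bij[OF k(1)]
  have cN: "k None \<in> cusps N" "k (Some 0) \<in> cusps N" "k (Some 1) \<in> cusps N" using k pqr by auto
  have cH: "k None \<in> cusps H" "k (Some 0) \<in> cusps H" "k (Some 1) \<in> cusps H" using cN cuspsN by auto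
  have AN: "coords N k = gf e'" by (rule coords_eq_gf[OF lt' k(1) cN])
  have AH: "coords H k = gf ?e" by (rule coords_eq_gf[OF lt k(1) cH])
  have "e' dvd ?e"
    using M.card_subgroup_dvd[OF M.subgroup_unip[OF H] M.subgroup_unip[OF N] unipN[of "k None"]]
      M.linD(7)[OF lt' cN(1)] M.linD(7)[OF lt cH(1)] by simp
  then obtain m where m: "e' = 2 ^ m" using divides_primepow_nat[OF two_is_prime_nat] by blast
  have m0: "m > 0" using M.linD(3)[OF lt'] m by (cases m) auto
  have "stab (stab N p) q \<subseteq> stab (stab H p) q" for p q using NH by (auto simp: stab_def)
  then have "e' - 1 dvd ?e - 1"
    using M.card_subgroup_dvd[OF M.subgroup_stab[OF M.subgroup_stab[OF H]] M.subgroup_stab[OF M.subgroup_stab[OF N]]]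
      M.card_two_cusp_stab[OF lt' cN(1,2)] M.card_two_cusp_stab[OF lt cH(1,2)] pqr(4) k(2,3) by metis
  then have "m dvd 3 ^ b" using two_power_minus_one_dvd_imp_dvd m m0 by blast
  then obtain b' where b': "b' \<le> b" "m = 3 ^ b'"
    using divides_primepow_nat[of 3] by (auto simp: prime_nat_numeral_eq)
  have "b' \<noteq> b"
  proof
    assume "b' = b"
    then have "card N = card H" using M.linD(5)[OF lt] M.linD(5)[OF lt'] m b' by simp
    then show False using NH M.linD(2)[OF lt] by (simp add: psubset_card_mono less_not_refl3)
  qed
  have "\<not> b' + 1 < b"
  proof
    assume lt_b: "b' + 1 < b"
    define n where "n = (3::nat) ^ (b' + 1)"
    have n0: "n > 0" by (simp add: n_def)
    define L where "L = preserving H k (2 ^ n)"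
    have pow: "(2::nat) ^ 3 ^ j = (2 ^ 3 ^ i) ^ 3 ^ (j - i)" if "i \<le> j" for i j
      using that by (simp flip: power_mult power_add)
    have sub1: "gf e' \<subseteq> (gf (2 ^ n) :: 'k set)"
      using gf_power_subset[of e' "3 ^ (b' + 1 - b')"] pow[of b' "b' + 1"] m b'(2) by (simp only: n_def)
    have sub2: "gf (2 ^ n) \<subseteq> (gf ?e :: 'k set)"
      using gf_power_subset[of "2 ^ n" "3 ^ (b - (b' + 1))"] pow[of "b' + 1" b] lt_b by (simp only: n_def)
    have card1: "card (gf e' :: 'k set) < card (gf (2 ^ n) :: 'k set)"
      using card_gf[OF n0] card_gf[OF m0] m b'(2) by (simp add: n_def)
    have "n < 3 ^ b" unfolding n_def using lt_b by (intro power_strict_increasing) auto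
    then have card2: "card (gf (2 ^ n) :: 'k set) < card (gf ?e :: 'k set)"
      using card_gf[OF n0] card_gf[of "3 ^ b"] by simp
    have sL: "subgroup L M.\<Gamma>" unfolding L_def by (rule subgroup_preserving[OF H])
    have ninH: "g \<in> N \<Longrightarrow> g \<in> H" for g using NH by blast
    have tau: "conj_by k (aff 1 x) \<in> N \<inter> L" if "x \<in> gf e'" for x
    proof -
      have "conj_by k (aff 1 x) \<in> N" using translation_mem[OF lt' k(1) cN] AN that by blast
      then show ?thesis unfolding L_def using translation_preserving[OF k(1) _ n0] ninH that sub1 by blast
    qed
    have scl: "conj_by k (aff x 0) \<in> L" if "conj_by k (aff x 0) \<in> N" "x \<noteq> 0" for x
    proof -
      have "conj_by k (aff x 0) (k (Some 1)) \<in> cusps N" by (rule cusps_invariant[OF lt' k(1) cN that(1) cN(3)])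
      then have "x \<in> coords N k" by (simp add: conj_by_apply[OF bij_k] coords_def)
      then have "x \<in> gf (2 ^ n)" using AN sub1 by blast
      then show ?thesis unfolding L_def using scaling_preserving[OF k(1) _ that(2) n0] ninH that(1) by blast
    qed
    obtain s where s: "s \<in> N" "s (k None) = k (Some 0)" "s (k (Some 0)) = k None"
      using M.swap_cusps[OF lt' cN(1,2)] pqr(4) k(2,3) by metis
    have sL': "s \<in> L"
    proof -
      have "finv k \<circ> s \<circ> k \<in> Moebius"
        by (rule Moebius_comp[OF Moebius_comp[OF Moebius_inv[OF k(1)] M.linear_in_P[OF lt' s(1)]] k(1)])
      then obtain x y z w where w: "finv k \<circ> s \<circ> k = mob x y z w" "x * w - y * z \<noteq> 0" by (rule MoebiusE)
      have "(finv k \<circ> s \<circ> k) None = Some 0" "(finv k \<circ> s \<circ> k) (Some 0) = None"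
        using s k_inv(1)[OF bij_k] by simp_all
      then have "x = 0" "w = 0" "z \<noteq> 0"
        unfolding w(1) by (auto simp: mob_None mob_Some pt_def split: if_splits)
      then have "finv k \<circ> s \<circ> k = mob (z * 0) (z * (y / z)) (z * 1) (z * 0)" using w(1) by simp
      also have "\<dots> = mob 0 (y / z) 1 0" by (rule mob_scale) fact
      finally have sm: "s = conj_by k (mob 0 (y / z) 1 0)" using conj_by_pullback[OF bij_k, of s] by simp
      have yz: "y / z \<noteq> 0" using w(2) \<open>x = 0\<close> \<open>z \<noteq> 0\<close> by auto
      have "s (k (Some 1)) \<in> cusps N" by (rule cusps_invariant[OF lt' k(1) cN s(1) cN(3)])
      then have "y / z \<in> coords N k" by (simp add: sm conj_by_apply[OF bij_k] coords_def mob_Some pt_def)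
      then have "y / z \<in> gf (2 ^ n)" using AN sub1 by blast
      then show ?thesis
        unfolding L_def sm using inversion_preserving[OF k(1) _ yz n0] ninH s(1) sm by blast
    qed
    have trans: "\<exists>l \<in> N \<inter> L. l (k None) = t" if t: "t \<in> cusps N" for t
    proof (cases "t = k None")
      case True
      then show ?thesis using M.subgroupD(2)[OF N] M.subgroupD(2)[OF sL] by (intro bexI[of _ id]) auto
    next
      case False
      then obtain x where x: "t = k (Some x)" using k_inv(2)[OF bij_k, of t] by (metis not_None_eq)
      then have "x \<in> gf e'" using t AN by (auto simp: coords_def)
      then have "conj_by k (aff 1 x) \<circ> s \<in> N \<inter> L"
        using tau s(1) sL' M.subgroupD(3)[OF N] M.subgroupD(3)[OF sL] by blast
      moreover have "(conj_by k (aff 1 x) \<circ> s) (k None) = t" using s(2) x by (simp add: conj_by_apply[OF bij_k])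
      ultimately show ?thesis by blast
    qed
    \<comment> \<open>Multiply \<open>g\<close> by elements of \<open>N \<inter> L\<close> until it fixes infinity and 0; then it is a scaling.\<close>
    have "N \<subseteq> L"
    proof
      fix g assume g: "g \<in> N"
      have "g (k None) \<in> cusps N" by (rule cusps_invariant[OF lt' k(1) cN g cN(1)])
      then obtain l where l: "l \<in> N" "l \<in> L" "l (k None) = g (k None)" using trans by blast
      have lP: "l \<in> Moebius" using M.linear_in_P[OF lt' l(1)] .
      define f where "f = finv l \<circ> g"
      have f: "f \<in> N" "f (k None) = k None"
        using M.subgroupD(3,4)[OF N] l g M.P_inv_apply(1)[OF lP] by (auto simp: f_def) metis
      have "f (k (Some 0)) \<in> cusps N" by (rule cusps_invariant[OF lt' k(1) cN f(1) cN(2)])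
      moreover have "f (k (Some 0)) \<noteq> k None"
      proof
        assume "f (k (Some 0)) = k None"
        then have "f (k (Some 0)) = f (k None)" using f(2) by simp
        then show False using Moebius_bij[OF M.linear_in_P[OF lt' f(1)]] bij_k by (metis bij_pointE option.distinct(1))
      qed
      ultimately obtain x where x: "f (k (Some 0)) = k (Some x)" "x \<in> gf e'"
        using k_inv(2)[OF bij_k, of "f (k (Some 0))"] AN by (metis (no_types, lifting) coords_def mem_Collect_eq not_None_eq)
      define h where "h = conj_by k (aff 1 x) \<circ> f"
      have hN: "h \<in> N" using M.subgroupD(3)[OF N] tau[OF x(2)] f(1) by (simp add: h_def)
      have "h (k None) = k None" "h (k (Some 0)) = k (Some 0)"
        using f(2) x(1) by (simp_all add: h_def conj_by_apply[OF bij_k] double_eq_0)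
      then obtain a where a: "a \<noteq> 0" "h = conj_by k (aff a 0)" using Moebius_fix_two[OF k(1) M.linear_in_P[OF lt' hN]] by blast
      have hL: "h \<in> L" using scl a hN by simp
      have "conj_by k (aff 1 x) \<circ> conj_by k (aff 1 x) = id"
        by (simp add: conj_by_comp[OF bij_k] aff_comp double_eq_0 aff_1_0 conj_by_id[OF bij_k])
      then have "f = conj_by k (aff 1 x) \<circ> h" by (simp add: h_def comp_assoc[symmetric])
      then have "f \<in> L" using M.subgroupD(3)[OF sL] tau[OF x(2)] hL by simp
      moreover have "g = l \<circ> f" using M.P_inv_comp(2)[OF lP] by (simp add: f_def comp_assoc[symmetric])
      ultimately show "g \<in> L" using M.subgroupD(3)[OF sL l(2)] by simp
    qed
    moreover have "L \<subseteq> H" by (auto simp: L_def preserving_def)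
    ultimately consider "L = N" | "L = H" using between[OF sL] by blast
    then show False
    proof cases
      case 1
      have "finite (gf e' :: 'k set)" unfolding m by (rule finite_gf[OF two_power_gt_1[OF m0]])
      then have "\<not> gf (2 ^ n) \<subseteq> (gf e' :: 'k set)" using card1 card_mono leD by blast
      then obtain x :: 'k where x: "x \<in> gf (2 ^ n)" "x \<notin> gf e'" by blast
      have "conj_by k (aff 1 x) \<in> H" using translation_mem[OF lt k(1) cH] AH x(1) sub2 by blast
      then have "conj_by k (aff 1 x) \<in> N" using 1 translation_preserving[OF k(1) x(1) n0, of H] by (simp add: L_def)
      then have "conj_by k (aff 1 x) (k (Some 0)) \<in> cusps N" using cusps_invariant[OF lt' k(1) cN] cN(2) by blast
      then have "x \<in> coords N k" by (simp add: conj_by_apply[OF bij_k] coords_def)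
      then show False using AN x(2) by blast
    next
      case 2
      have "finite (gf (2 ^ n) :: 'k set)" by (rule finite_gf[OF two_power_gt_1[OF n0]])
      then have "\<not> gf ?e \<subseteq> (gf (2 ^ n) :: 'k set)" using card2 card_mono leD by blast
      then obtain x :: 'k where x: "x \<in> gf ?e" "x \<notin> gf (2 ^ n)" by blast
      have "conj_by k (aff 1 x) \<in> L" using translation_mem[OF lt k(1) cH] AH x(1) 2 by blast
      moreover have "k (Some 0) \<in> k ` insert None (Some ` gf (2 ^ n))" by simp
      ultimately have "conj_by k (aff 1 x) (k (Some 0)) \<in> k ` insert None (Some ` gf (2 ^ n))"
        unfolding L_def preserving_def by blast
      then have "k (Some x) \<in> k ` insert None (Some ` gf (2 ^ n))" by (simp add: conj_by_apply[OF bij_k])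
      then show False using x(2) bij_k by (auto simp: bij_def inj_eq)
    qed
  qed
  then have "b = Suc b'" using b'(1) \<open>b' \<noteq> b\<close> by linarith
  then show thesis using that m b'(2) by blast
qed

text \<open>
  Replacing \<open>q\<close> by \<open>q^3\<close> multiplies \<open>q - 1\<close> by \<open>q^2 + q + 1\<close> and \<open>q + 1\<close> by \<open>q^2 - q + 1\<close>.
\<close>
lemma bigomega_tower: "b \<le> bigomega (2 ^ 3 ^ b - 1)" "b \<le> bigomega (2 ^ 3 ^ b + 1)"
proof -
  have pos: "bigomega n \<ge> 1" if n: "n > 1" for n :: nat
  proof -
    have "n \<noteq> 1" using n by simp
    then obtain p where "prime p" "p dvd n" using prime_factor_nat by blast
    then obtain m where "n = p * m" by auto
    then show ?thesis using \<open>prime p\<close> n bigomega_prime_mult[of p m] by (cases m) auto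
  qed
  have mult: "bigomega (m * n) = bigomega m + bigomega n" if "m > 0" "n > 0" for m n :: nat
    using that by (simp add: prime_factorization_mult)
  show "b \<le> bigomega (2 ^ 3 ^ b - 1)"
  proof (induction b)
    case (Suc b)
    define q where "q = (2::nat) ^ 3 ^ b"
    have q: "q \<ge> 2" using self_le_power[of 2 "3 ^ b"] by (simp add: q_def)
    have "(2::nat) ^ 3 ^ Suc b = q ^ 3" by (simp add: q_def mult.commute flip: power_mult)
    moreover have "q ^ 3 - 1 = (q - 1) * (q * q + q + 1)"
      using q by (simp add: power3_eq_cube algebra_simps)
    ultimately have "bigomega (2 ^ 3 ^ Suc b - 1) = bigomega ((q - 1) * (q * q + q + 1))" by metis
    also have "\<dots> = bigomega (q - 1) + bigomega (q * q + q + 1)"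
      by (rule mult) (use q in auto)
    finally have "bigomega (2 ^ 3 ^ Suc b - 1) = bigomega (q - 1) + bigomega (q * q + q + 1)" .
    then show ?case using Suc pos[of "q * q + q + 1"] q by (simp add: q_def)
  qed simp
  show "b \<le> bigomega (2 ^ 3 ^ b + 1)"
  proof (induction b)
    case (Suc b)
    define q where "q = (2::nat) ^ 3 ^ b"
    have q: "q \<ge> 2" using self_le_power[of 2 "3 ^ b"] by (simp add: q_def)
    then obtain r where r: "q = r + 2" by (metis add.commute le_Suc_ex)
    have "(2::nat) ^ 3 ^ Suc b = q ^ 3" by (simp add: q_def mult.commute flip: power_mult)
    moreover have "q ^ 3 + 1 = (q + 1) * (q * q + 1 - q)"
      unfolding r by (simp add: power3_eq_cube algebra_simps)
    moreover have big: "q * q + 1 - q > 1" unfolding r by (simp add: algebra_simps)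
    ultimately have "bigomega (2 ^ 3 ^ Suc b + 1) = bigomega (q + 1) + bigomega (q * q + 1 - q)"
      using mult[of "q + 1" "q * q + 1 - q"] by simp
    then show ?case using Suc pos[OF big] by (simp add: q_def)
  qed simp
qed

theorem depth_linear_type:
  assumes "steps_to_one M.\<Gamma> t H" "M.linear_type H (2 ^ 3 ^ b)"
  shows "b + 2 \<le> t"
  using assms
proof (induction arbitrary: b rule: steps_to_one.induct)
  case one
  then have "card {id :: 'k option \<Rightarrow> 'k option} \<ge> 5 * 12"
    using M.linD(3,5)[of _ "2 ^ 3 ^ b"] M.e_bounds[of _ "2 ^ 3 ^ b"] by (metis mult_le_mono add_le_mono1 numeral_plus_one semiring_norm(5) monoid.select_convs(2))
  then show ?case by simp
next
  case (step N H t)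
  from M.maximal_of_linear_type[OF step.prems step.hyps]
  consider e' where "M.linear_type N e'" | "bigomega (2 ^ 3 ^ b - 1) < t" | "bigomega (2 ^ 3 ^ b + 1) < t"
    by blast
  then show ?case
  proof cases
    case 1
    obtain b' where b': "e' = 2 ^ 3 ^ b'" "b = Suc b'"
      using maximal_linear_subgroup[OF step.prems step.hyps(1) 1] .
    then show ?thesis using step.IH[of b'] 1 by simp
  qed (use bigomega_tower[of b] in simp_all)
qed

text \<open>
  The group is the stabiliser of the projective line over the field \<open>F\<close> of \<open>2^(3^b)\<close> elements.
  Translations and the inversion \<open>x \<mapsto> 1 / x\<close> make all its orbits larger than two points, which
  leaves only the third case of the trichotomy, and its cusps are the points over \<open>F\<close>.
\<close>
theorem ex_linear_type:
  assumes b: "b > 0"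
  obtains H where "M.linear_type H (2 ^ 3 ^ b)"
proof -
  define n :: nat where "n = 3 ^ b"
  define F where "F = (gf (2 ^ n) :: 'k set)"
  define Om where "Om = insert None (Some ` F)"
  define H where "H = preserving Moebius id (2 ^ n)"
  have n3: "n \<ge> 3" using b self_le_power[of 3 b] by (simp add: n_def)
  then have n0: "n > 0" by simp
  have cF: "card F = 2 ^ n" unfolding F_def by (rule card_gf[OF n0])
  have finF: "finite F" using cF by (intro card_ge_0_finite) simp
  have F8: "card F \<ge> 8" using power_increasing[of 3 n "2::nat"] n3 cF by simp
  have sM: "subgroup Moebius M.\<Gamma>"
    using M.subgroup_iff[of Moebius] Moebius_id Moebius_comp Moebius_inv by blast
  have sH: "subgroup H M.\<Gamma>" unfolding H_def by (rule subgroup_preserving[OF sM])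
  have H_iff: "h \<in> H \<longleftrightarrow> h \<in> Moebius \<and> h ` Om = Om" for h
    by (simp add: H_def preserving_def Om_def F_def)
  have finOm: "finite Om" and cOm: "card Om = 2 ^ n + 1"
    using finF cF by (auto simp: Om_def card_image card_insert_if)
  have zero: "0 \<in> F" and one: "1 \<in> F" by (simp_all add: F_def)
  have conj_by_id': "conj_by id f = f" for f :: "'k option \<Rightarrow> 'k option" by (simp add: conj_by_def)
  have tau: "aff 1 a \<in> H" if "a \<in> F" for a
    using translation_preserving[OF Moebius_id _ n0, of a Moebius] that aff_Moebius[of 1 a]
    by (simp add: conj_by_id' H_def F_def)
  have iota: "mob 0 1 1 0 \<in> H"
  proof -
    have "mob 0 1 1 0 \<in> (Moebius :: ('k option \<Rightarrow> 'k option) set)" by (rule MoebiusI) simp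
    then show ?thesis
      using inversion_preserving[OF Moebius_id _ _ n0, of 1 Moebius] by (simp add: conj_by_id' H_def)
  qed
  have iota_None: "mob 0 1 1 0 None = Some (0::'k)" by (simp add: mob_None pt_def)
  \<comment> \<open>A Moebius transformation is determined by its values at infinity, 0 and 1.\<close>
  have finH: "finite H"
  proof -
    let ?f = "\<lambda>h. (h None, h (Some 0), h (Some 1))"
    have "inj_on ?f H"
    proof (rule inj_onI)
      fix g h assume gh: "g \<in> H" "h \<in> H" "?f g = ?f h"
      have P: "g \<in> Moebius" "h \<in> Moebius" using gh H_iff by auto
      have "finv h \<circ> g = id"
        by (rule M.three_fixed_points[of _ None "Some 0" "Some 1"])
          (use gh(3) P Moebius_comp[OF Moebius_inv[OF P(2)] P(1)] M.P_inv_apply(1)[OF P(2)] in auto)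
      then have "h \<circ> (finv h \<circ> g) = h" by simp
      then show "g = h" using M.P_inv_comp(2)[OF P(2)] by (simp add: comp_assoc[symmetric])
    qed
    moreover have "?f ` H \<subseteq> Om \<times> Om \<times> Om"
    proof
      fix z assume "z \<in> ?f ` H"
      then obtain h where h: "h \<in> H" "z = ?f h" by blast
      have "None \<in> Om" "Some 0 \<in> Om" "Some 1 \<in> Om" using zero one by (auto simp: Om_def)
      then have "h None \<in> Om" "h (Some 0) \<in> Om" "h (Some 1) \<in> Om"
        using h(1) H_iff by blast+
      then show "z \<in> Om \<times> Om \<times> Om" using h(2) by simp
    qed
    ultimately show ?thesis using finOm by (meson finite_SigmaI finite_imageD finite_subset)
  qed
  have tau1: "aff 1 1 \<noteq> (id :: 'k option \<Rightarrow> 'k option)"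
    by (metis aff_apply(2) add_0 id_apply mult_zero_right option.inject zero_neq_one)
  have nontriv: "H \<noteq> {id}" using tau[OF one] tau1 by blast
  have orbNone: "Om \<subseteq> orb H None"
  proof
    fix z assume "z \<in> Om"
    then consider "z = None" | x where "z = Some x" "x \<in> F" by (auto simp: Om_def)
    then show "z \<in> orb H None"
    proof cases
      case 1 then show ?thesis using M.mem_orb_self[OF sH] by simp
    next
      case 2
      have "(aff 1 x \<circ> mob 0 1 1 0) None = z" using 2 iota_None by simp
      then show ?thesis unfolding orb_def
        by (rule image_eqI[OF sym M.subgroupD(3)[OF sH tau[OF 2(2)] iota]])
    qed
  qed
  have orb_large: "card (orb H z) > 2" for z
  proof -
    have "card F \<le> card (orb H z)"
    proof (cases z)
      case None
      have "card F \<le> card Om" using cF cOm by simp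
      also have "\<dots> \<le> card (orb H z)" using orbNone finH None by (intro card_mono) (auto simp: orb_def)
      finally show ?thesis .
    next
      case (Some x)
      have "inj_on (\<lambda>a. Some (x + a)) F" by (auto intro: inj_onI)
      moreover have "(\<lambda>a. Some (x + a)) ` F \<subseteq> orb H z"
      proof
        fix w assume "w \<in> (\<lambda>a. Some (x + a)) ` F"
        then obtain a where a: "a \<in> F" "w = aff 1 a z" using Some by auto
        then show "w \<in> orb H z" using tau unfolding orb_def by blast
      qed
      moreover have "finite (orb H z)" using finH by (simp add: orb_def)
      ultimately show ?thesis by (metis card_inj_on_le)
    qed
    then show ?thesis using F8 by simp
  qed
  show thesis
  proof (rule M.finite_subgroup_cases[OF sH finH nontriv])
    fix p assume "\<And>h. h \<in> H \<Longrightarrow> h p = p"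
    then have "orb H p \<subseteq> {p}" by (auto simp: orb_def)
    then have "card (orb H p) \<le> 1" using card_mono[of "{p}"] by simp
    then show thesis using orb_large[of p] by simp
  next
    fix q assume "card (orb H q) = 2"
    then show thesis using orb_large[of q] by simp
  next
    fix e' assume lt: "M.linear_type H e'"
    have "aff 1 1 \<in> unip H None"
    proof (rule unipI[OF tau[OF one]])
      fix q assume "aff 1 1 q = q" "q \<noteq> (None :: 'k option)"
      then show "aff 1 1 = (id :: 'k option \<Rightarrow> 'k option)" by auto
    qed simp
    then have "None \<in> cusps H" using tau1 by (auto simp: cusps_def)
    then have "cusps H = orb H None" using M.orb_cusp[OF lt] by simp
    moreover have "orb H None \<subseteq> Om"
    proof
      fix z assume "z \<in> orb H None"
      then obtain h where h: "h \<in> H" "z = h None" by (auto simp: orb_def)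
      have "None \<in> Om" by (simp add: Om_def)
      then show "z \<in> Om" using h H_iff by blast
    qed
    ultimately have "cusps H = Om" using orbNone by blast
    then have "e' = 2 ^ n" using M.linD(6)[OF lt] cOm by simp
    then show thesis using that lt by (simp add: n_def)
  qed
qed

end

section \<open>Length, depth and isomorphism; the main result\<close>

lemma (in group) ex_unrefinable_chain:
  assumes fin: "finite (carrier G)"
  shows "\<exists>t C. unrefinable_chain G t C"
proof -
  have "\<exists>t C. C 0 = K \<and> C t = {\<one>} \<and> (\<forall>i\<le>t. subgroup (C i) G) \<and>
      (\<forall>i<t. maximal_subgroup (C (Suc i)) (G\<lparr>carrier := C i\<rparr>))" if "subgroup K G" for K
    using that
  proof (induction "card K" arbitrary: K rule: less_induct)
    case less
    show ?case
    proof (cases "K = {\<one>}")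
      case True
      then show ?thesis using less.prems by (intro exI[of _ 0] exI[of _ "\<lambda>_. K"]) simp
    next
      case False
      have KG: "K \<subseteq> carrier G" using subgroup.subset[OF less.prems] .
      have finK: "finite K" using KG fin finite_subset by blast
      define S where "S = {L. subgroup L G \<and> L \<subset> K}"
      have "finite S" using finK by (intro finite_subset[of S "Pow K"]) (auto simp: S_def)
      moreover have "{\<one>} \<in> S"
        using False subgroup.one_closed[OF less.prems] triv_subgroup by (auto simp: S_def)
      ultimately obtain M where M: "M \<in> S" and top: "\<And>L. L \<in> S \<Longrightarrow> M \<subseteq> L \<Longrightarrow> L = M"
        using finite_has_maximal[of S] by (metis empty_iff)
      have mx: "maximal_subgroup M (G\<lparr>carrier := K\<rparr>)"
        unfolding maximal_subgroup_def
      proof (intro conjI allI impI)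
        show "subgroup M (G\<lparr>carrier := K\<rparr>)" using M less.prems subgroup_incl by (auto simp: S_def)
        show "M \<noteq> carrier (G\<lparr>carrier := K\<rparr>)" using M by (auto simp: S_def)
        fix L assume L: "subgroup L (G\<lparr>carrier := K\<rparr>)" "M \<subseteq> L"
        have "subgroup L G" "L \<subseteq> K"
          using incl_subgroup[OF less.prems L(1)] subgroup.subset[OF L(1)] by simp_all
        then show "L = M \<or> L = carrier (G\<lparr>carrier := K\<rparr>)" using top[of L] L(2) by (auto simp: S_def)
      qed
      have "card M < card K" using M finK by (auto simp: S_def psubset_card_mono)
      then obtain t C where C: "C 0 = M" "C t = {\<one>}" "\<forall>i\<le>t. subgroup (C i) G"
        "\<forall>i<t. maximal_subgroup (C (Suc i)) (G\<lparr>carrier := C i\<rparr>)"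
        using less.hyps[of M] M by (auto simp: S_def)
      show ?thesis
        by (rule exI[of _ "Suc t"], rule exI[of _ "\<lambda>i. case i of 0 \<Rightarrow> K | Suc j \<Rightarrow> C j"])
          (use C mx less.prems in \<open>auto split: nat.split\<close>)
    qed
  qed
  from this[OF subgroup_self] show ?thesis unfolding unrefinable_chain_def by simp
qed

lemma (in group) unrefinable_chain_imp_descending_chain:
  assumes "unrefinable_chain G t C" shows "descending_chain G t C"
  using assms maximal_subgroup_imp_maximal_in
  unfolding unrefinable_chain_def descending_chain_def maximal_in_def by (metis less_imp_le)

lemma (in group) descending_chain_bound:
  assumes fin: "finite (carrier G)" and C: "descending_chain G t C"
  shows "2 ^ t \<le> order G"
proof -
  have c: "C 0 = carrier G" "\<And>i. i \<le> t \<Longrightarrow> subgroup (C i) G" "\<And>i. i < t \<Longrightarrow> C (Suc i) \<subset> C i"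
    using C unfolding descending_chain_def by auto
  have "2 ^ i * card (C i) \<le> order G" if "i \<le> t" for i
    using that
  proof (induction i)
    case 0 then show ?case using c(1) by (simp add: Coset.order_def)
  next
    case (Suc i)
    have s: "subgroup (C i) G" "subgroup (C (Suc i)) G" "C (Suc i) \<subset> C i" using c(2,3) Suc.prems by auto
    have finC: "finite (C i)" using subgroup.subset[OF s(1)] fin finite_subset by blast
    have "card (C (Suc i)) dvd card (C i)" using card_subgroup_dvd[OF s(1,2)] s(3) by blast
    then obtain d where d: "card (C i) = card (C (Suc i)) * d" by (auto elim: dvdE)
    have "card (C (Suc i)) < card (C i)" using s(3) finC by (rule psubset_card_mono[rotated])
    then have "d \<ge> 2" using d by (cases "d = 0 \<or> d = 1") auto
    then have "card (C (Suc i)) * 2 \<le> card (C i)" unfolding d by (rule mult_le_mono2)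
    then have "2 ^ i * (card (C (Suc i)) * 2) \<le> 2 ^ i * card (C i)" by (rule mult_le_mono2)
    also have "\<dots> \<le> order G" using Suc by simp
    finally show ?case by (simp add: mult_ac)
  qed
  from this[of t] have "2 ^ t * card (C t) \<le> order G" by simp
  moreover have "C t = {\<one>}" using C by (simp add: descending_chain_def)
  ultimately show ?thesis by simp
qed

text \<open>
  In a finite group the minimum and the maximum are attained, and an unrefinable chain is a
  descending chain.
\<close>
lemma (in group) depth_and_length:
  assumes fin: "finite (carrier G)"
  shows "\<exists>C. unrefinable_chain G (group_depth G) C" and "group_depth G \<le> group_length G"
    and "2 ^ group_length G \<le> order G"
proof -
  show depth: "\<exists>C. unrefinable_chain G (group_depth G) C"
    unfolding group_depth_def using LeastI_ex[OF ex_unrefinable_chain[OF fin]] .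
  let ?P = "\<lambda>t. \<exists>C. descending_chain G t C"
  have bound: "t \<le> order G" if "?P t" for t
    using descending_chain_bound[OF fin] that by (meson le_trans less_exp less_imp_le)
  have d: "?P (group_depth G)" using depth unrefinable_chain_imp_descending_chain by blast
  show "group_depth G \<le> group_length G"
    unfolding group_length_def by (rule Greatest_le_nat[of ?P, OF d bound])
  have "?P (group_length G)"
    unfolding group_length_def by (rule GreatestI_nat[of ?P, OF d bound])
  then show "2 ^ group_length G \<le> order G" using descending_chain_bound[OF fin] by blast
qed

lemma iso_maximal_in:
  assumes G: "group G" and F: "group F" and iso: "\<phi> \<in> iso G F" and mx: "maximal_in G M H"
  shows "maximal_in F (\<phi> ` M) (\<phi> ` H)"
proof -
  interpret G: group G by fact
  have M: "subgroup M G" and H: "subgroup H G" and MH: "M \<subset> H"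
    and between: "\<And>L. subgroup L G \<Longrightarrow> M \<subseteq> L \<Longrightarrow> L \<subseteq> H \<Longrightarrow> L = M \<or> L = H"
    using mx unfolding maximal_in_def by auto
  have bij: "bij_betw \<phi> (carrier G) (carrier F)" using iso by (simp add: iso_def)
  then have inj: "inj_on \<phi> (carrier G)" and surj: "\<phi> ` carrier G = carrier F" by (simp_all add: bij_betw_def)
  note MG = subgroup.subset[OF M] and HG = subgroup.subset[OF H]
  let ?\<psi> = "inv_into (carrier G) \<phi>"
  have \<psi>: "?\<psi> \<in> iso F G" by (rule G.iso_set_sym[OF iso])
  have cancel: "?\<psi> ` \<phi> ` A = A" if "A \<subseteq> carrier G" for A using inv_into_image_cancel[OF inj that] .
  show ?thesis
    unfolding maximal_in_def
  proof (intro conjI allI impI)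
    show "subgroup (\<phi> ` M) F" "subgroup (\<phi> ` H) F"
      using subgroup.iso_subgroup[OF M G F iso] subgroup.iso_subgroup[OF H G F iso] .
    show "\<phi> ` M \<subset> \<phi> ` H" using MH cancel[OF MG] cancel[OF HG] by (metis image_mono psubsetE psubsetI)
    fix L assume L: "subgroup L F" "\<phi> ` M \<subseteq> L" "L \<subseteq> \<phi> ` H"
    have LF: "L \<subseteq> \<phi> ` carrier G" using subgroup.subset[OF L(1)] surj by simp
    have "?\<psi> ` L = M \<or> ?\<psi> ` L = H"
    proof (rule between)
      show "subgroup (?\<psi> ` L) G" by (rule subgroup.iso_subgroup[OF L(1) F G \<psi>])
      show "M \<subseteq> ?\<psi> ` L" using image_mono[OF L(2), of ?\<psi>] cancel[OF MG] by simp
      show "?\<psi> ` L \<subseteq> H" using image_mono[OF L(3), of ?\<psi>] cancel[OF HG] by simp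
    qed
    then show "L = \<phi> ` M \<or> L = \<phi> ` H" using image_inv_into_cancel[OF refl LF] by auto
  qed
qed

lemma iso_steps_to_one:
  assumes "steps_to_one G t H" and G: "group G" and F: "group F" and iso: "\<phi> \<in> iso G F"
  shows "steps_to_one F t (\<phi> ` H)"
  using assms(1)
proof (induction rule: steps_to_one.induct)
  case one
  have "\<phi> \<one>\<^bsub>G\<^esub> = \<one>\<^bsub>F\<^esub>" using iso hom_one[OF _ G F] by (auto simp: iso_def)
  then show ?case by (simp add: steps_to_one.one)
next
  case (step M H t)
  then show ?case using steps_to_one.step[OF iso_maximal_in[OF G F iso]] by blast
qed

lemma (in group) steps_to_one_subgroup:
  assumes "steps_to_one (G\<lparr>carrier := K\<rparr>) t H" and K: "subgroup K G"
  shows "steps_to_one G t H"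
  using assms(1)
proof (induction rule: steps_to_one.induct)
  case one then show ?case by (simp add: steps_to_one.one)
next
  case (step M H t)
  have sub: "subgroup M (G\<lparr>carrier := K\<rparr>)" "subgroup H (G\<lparr>carrier := K\<rparr>)" and MH: "M \<subset> H"
    and between: "\<And>L. subgroup L (G\<lparr>carrier := K\<rparr>) \<Longrightarrow> M \<subseteq> L \<Longrightarrow> L \<subseteq> H \<Longrightarrow> L = M \<or> L = H"
    using step.hyps(1) unfolding maximal_in_def by auto
  have HK: "H \<subseteq> K" using subgroup.subset[OF sub(2)] by simp
  have "maximal_in G M H"
    unfolding maximal_in_def
    using incl_subgroup[OF K] sub MH between subgroup_incl[OF _ K] HK by (meson order_trans)
  then show ?case using step.IH by (rule steps_to_one.step)
qed

text \<open>
  The group of linear type over the algebraic closure of the field with two elements, carried over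
  to natural numbers along an injection of its finite carrier.
\<close>
lemma ex_group_of_large_depth:
  assumes j: "j > 0"
  shows "\<exists>G :: nat monoid. simple_group G \<and> finite (carrier G) \<and> \<not> comm_group G \<and>
    order G = (2 ^ 3 ^ j + 1) * (2 ^ 3 ^ j * (2 ^ 3 ^ j - 1)) \<and> j + 2 \<le> group_depth G"
proof -
  have "(1::bit alg_closure) + 1 = to_ac (1 + 1)" by (simp only: to_ac_add to_ac_1)
  also have "(1::bit) + 1 = 0" by simp
  finally have char2: "(1::bit alg_closure) + 1 = 0" by simp
  interpret M: one_or_two_fixed_points "Moebius :: (bit alg_closure option \<Rightarrow> _) set"
    by (rule Moebius_one_or_two_fixed_points[OF char2])
  interpret G: group M.\<Gamma> by (rule M.group_\<Gamma>)
  obtain H where lt: "M.linear_type H (2 ^ 3 ^ j)" using ex_linear_type[OF char2 j] .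
  note H = M.linD(1)[OF lt] and finH = M.linD(2)[OF lt]
  let ?L = "M.\<Gamma>\<lparr>carrier := H\<rparr>"
  have gL: "group ?L" using G.subgroup_imp_group[OF H] .
  interpret L: group ?L by (rule gL)
  have linear_in_P: "h \<in> Moebius" if "h \<in> H" for h using M.linear_in_P[OF lt that] .
  have cH: "card H = (2 ^ 3 ^ j + 1) * (2 ^ 3 ^ j * (2 ^ 3 ^ j - 1))" by (rule M.linD(5)[OF lt])
  have simple: "simple_group ?L"
  proof
    have "5 * 12 \<le> card H"
      unfolding cH using M.e_bounds[OF lt] M.linD(3)[OF lt] by (intro mult_mono) auto
    then show "1 < order ?L" by (simp add: Coset.order_def)
    fix N assume "N \<lhd> ?L"
    then have N: "subgroup N ?L" and nrm: "\<And>x n. x \<in> H \<Longrightarrow> n \<in> N \<Longrightarrow> x \<otimes>\<^bsub>?L\<^esub> n \<otimes>\<^bsub>?L\<^esub> inv\<^bsub>?L\<^esub> x \<in> N"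
      unfolding L.normal_inv_iff by auto
    have "h \<circ> n \<circ> finv h \<in> N" if "h \<in> H" "n \<in> N" for h n
      using nrm[OF that] G.m_inv_consistent[OF H that(1)] M.inv_\<Gamma>[OF linear_in_P[OF that(1)]] by simp
    then have "N \<noteq> {id} \<Longrightarrow> N = H"
      using M.normal_subgroup_of_linear_type[OF lt G.incl_subgroup[OF H N]] subgroup.subset[OF N] by simp
    then show "N = carrier ?L \<or> N = {\<one>\<^bsub>?L\<^esub>}" by auto
  qed
  obtain f :: "(bit alg_closure option \<Rightarrow> bit alg_closure option) \<Rightarrow> nat" where f: "inj_on f H"
    using finite_imp_inj_to_nat_seg[OF finH] by blast
  define A where "A = image_group f ?L"
  have injf: "inj_on f (carrier ?L)" using f by simp
  have gA: "group A" unfolding A_def by (rule L.inj_imp_image_group_is_group[OF injf])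
  have iso: "f \<in> iso ?L A" unfolding A_def by (rule inj_imp_image_group_iso[OF injf])
  have iso': "inv_into H f \<in> iso A ?L" using L.iso_set_sym[OF iso] by simp
  interpret A: group A by (rule gA)
  have carA: "carrier A = f ` H" by (simp add: A_def image_group_carrier)
  then have finA: "finite (carrier A)" using finH by simp
  have "\<not> comm_group A"
  proof
    assume "comm_group A"
    then interpret A: comm_group A .
    obtain g h where gh: "g \<in> H" "h \<in> H" "g \<circ> h \<noteq> h \<circ> g"
      using M.linear_type_not_commutative[OF lt] .
    have hom: "f (x \<circ> y) = f x \<otimes>\<^bsub>A\<^esub> f y" if "x \<in> H" "y \<in> H" for x y
      using hom_mult[of f ?L A x y] iso that by (simp add: iso_def)
    have "f (g \<circ> h) = f (h \<circ> g)" using gh hom A.m_comm carA by simp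
    then have "g \<circ> h = h \<circ> g" using f gh M.subgroupD(3)[OF H] by (meson inj_onD)
    then show False using gh(3) by simp
  qed
  moreover have "j + 2 \<le> group_depth A"
  proof -
    obtain C where "unrefinable_chain A (group_depth A) C" using A.depth_and_length(1)[OF finA] by blast
    then have "steps_to_one A (group_depth A) (carrier A)"
      using A.unrefinable_chain_imp_steps_to_one[OF _ A.subgroup_self] by simp
    then have "steps_to_one ?L (group_depth A) (inv_into H f ` carrier A)"
      using iso_steps_to_one[OF _ gA gL iso'] by blast
    then have "steps_to_one ?L (group_depth A) H" using carA f by simp
    then have "steps_to_one M.\<Gamma> (group_depth A) H" by (rule G.steps_to_one_subgroup[OF _ H])
    then show ?thesis by (rule depth_linear_type[OF char2 _ lt])
  qed
  moreover have "order A = (2 ^ 3 ^ j + 1) * (2 ^ 3 ^ j * (2 ^ 3 ^ j - 1))"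
    using cH carA f by (simp add: Coset.order_def card_image)
  moreover have "simple_group A" by (rule simple_group.iso_simple[OF simple gA iso])
  ultimately show ?thesis using finA by blast
qed

text \<open>
  This bound is what limits the length to less than \<open>3^(j+1)\<close>.
\<close>
lemma order_bound: "(2 ^ 3 ^ j + 1) * (2 ^ 3 ^ j * (2 ^ 3 ^ j - 1)) < (2::nat) ^ 3 ^ Suc j"
proof -
  define e where "e = (2::nat) ^ 3 ^ j"
  have "e \<ge> 1" by (simp add: e_def)
  then have "(e + 1) * (e * (e - 1)) < e ^ 3"
    by (cases e) (simp_all add: power3_eq_cube algebra_simps)
  also have "e ^ 3 = 2 ^ 3 ^ Suc j" by (simp add: e_def mult.commute flip: power_mult)
  finally show ?thesis unfolding e_def .
qed

lemma order_strict_mono: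
  assumes "i < j"
  shows "(2 ^ 3 ^ i + 1) * (2 ^ 3 ^ i * (2 ^ 3 ^ i - 1)) < (2 ^ 3 ^ j + 1) * (2 ^ 3 ^ j * (2 ^ 3 ^ j - 1 :: nat))"
proof -
  have "(2::nat) ^ 3 ^ i < 2 ^ 3 ^ j" using assms by simp
  moreover from this have "(2::nat) ^ 3 ^ i - 1 < 2 ^ 3 ^ j - 1" by (rule diff_less_mono) simp
  ultimately show ?thesis by (intro mult_strict_mono) auto
qed

theorem proposition8:
  shows "\<exists>G :: nat \<Rightarrow> nat monoid.
    (\<forall>j\<ge>1. simple_group (G j) \<and> finite (carrier (G j)) \<and> \<not> comm_group (G j)) \<and>
    (\<forall>i\<ge>1. \<forall>j\<ge>1. i \<noteq> j \<longrightarrow> \<not> G i \<cong> G j) \<and>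
    filterlim (\<lambda>j. group_length (G j)) at_top sequentially \<and>
    (\<forall>j\<ge>1. real (group_depth (G j)) > log 3 (real (group_length (G j))) + 1)"
proof -
  let ?s = "\<lambda>j. (2 ^ 3 ^ j + 1) * (2 ^ 3 ^ j * (2 ^ 3 ^ j - 1)) :: nat"
  have "\<forall>j\<in>{1..}. \<exists>G :: nat monoid. simple_group G \<and> finite (carrier G) \<and> \<not> comm_group G \<and>
      order G = ?s j \<and> j + 2 \<le> group_depth G"
    using ex_group_of_large_depth by simp
  from bchoice[OF this] obtain G :: "nat \<Rightarrow> nat monoid" where
    G: "\<And>j. j \<ge> 1 \<Longrightarrow> simple_group (G j)" "\<And>j. j \<ge> 1 \<Longrightarrow> finite (carrier (G j))"
      "\<And>j. j \<ge> 1 \<Longrightarrow> \<not> comm_group (G j)" "\<And>j. j \<ge> 1 \<Longrightarrow> order (G j) = ?s j"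
      "\<And>j. j \<ge> 1 \<Longrightarrow> j + 2 \<le> group_depth (G j)"
    by auto
  have grp: "group (G j)" if "j \<ge> 1" for j using G(1)[OF that] by (simp add: simple_group_def)
  note len = group.depth_and_length(2,3)[OF grp G(2)]
  have "\<not> G i \<cong> G j" if "i \<ge> 1" "j \<ge> 1" "i \<noteq> j" for i j
  proof
    assume "G i \<cong> G j"
    then have "?s i = ?s j" using iso_same_card G(4)[OF that(1)] G(4)[OF that(2)]
      unfolding Coset.order_def by metis
    then show False using order_strict_mono[of i j] order_strict_mono[of j i] that(3)
      by (cases "i < j") auto
  qed
  moreover have "filterlim (\<lambda>j. group_length (G j)) at_top sequentially"
  proof (rule filterlim_at_top_mono[OF filterlim_ident])
    show "\<forall>\<^sub>F j in sequentially. j \<le> group_length (G j)"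
      using eventually_ge_at_top[of 1]
    proof eventually_elim
      case (elim j)
      then show ?case using G(5)[OF elim] len(1)[OF elim elim] by linarith
    qed
  qed
  moreover have "real (group_depth (G j)) > log 3 (real (group_length (G j))) + 1" if j: "j \<ge> 1" for j
  proof -
    let ?l = "group_length (G j)"
    have pos: "?l > 0" using G(5)[OF j] len(1)[OF j j] by linarith
    have "(2::nat) ^ ?l < 2 ^ 3 ^ Suc j"
      using len(2)[OF j j] order_bound[of j] G(4)[OF j] by linarith
    then have "?l < 3 ^ Suc j" by simp
    then have "real ?l < 3 ^ Suc j" by (metis of_nat_less_iff of_nat_numeral of_nat_power)
    then have "log 3 (real ?l) < log 3 (3 ^ Suc j)" using pos by (intro log_less) auto
    also have "\<dots> = real (Suc j)" by (subst log_nat_power) auto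
    finally show ?thesis using G(5)[OF j] by linarith
  qed
  ultimately show ?thesis using G(1-3) by blast
qed

end
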